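(* Let $\mu$ be a self-similar measure of finite type satisfying the positive row property (setting described in the context). Let $I$ and $S$ be, respectively, the infimum and the supremum of $\{\dim_{loc}\mu(x): x\text{ interior essential, positive, periodic}\}$. Then $$\{\dim_{loc}\mu(x):x\text{ interior essential}\}=\{\dim_{loc}\mu(x):x\text{ truly essential}\}=[I,S]$$ (sets taken over those $x$ where the local dimension exists). The same equalities hold with $\dim_{loc}$ replaced by $\underline{\dim}_{loc}$ in both sets, and with $\dim_{loc}$ replaced by $\overline{\dim}_{loc}$ in both sets.
   Context: Setting. Let $m\ge 1$ be an integer, $0<\varrho<1$, $0=d_0<d_1<\dots<d_m$, $S_j(x)=\varrho x+d_j$ for $j\in\mathcal A=\{0,\dots,m\}$. Let $K$ be the unique non-empty compact set with $K=\bigcup_j S_j(K)$; the $d_j$ are scaled so that the convex hull of $K$ is $[0,1]$ ($K$ need not be an interval). For $\sigma=(j_1,\dots,j_n)\in\mathcal A^n$ put $S_\sigma=S_{j_1}\circ\cdots\circ S_{j_n}$. The IFS is of finite type if there is a finite set $F\subseteq\mathbb R$ such that for every $n\ge1$ and all $\sigma,\sigma'\in\mathcal A^n$, either $\varrho^{-n}|S_\sigma(0)-S_{\sigma'}(0)|>1$ or $\varrho^{-n}(S_\sigma(0)-S_{\sigma'}(0))\in F$. Given $p_j>0$ with $\sum_j p_j=1$, $\mu$ is the unique Borel probability measure with $\mu=\sum_j p_j\,\mu\circ S_j^{-1}$; its support is $K$; $\mu$ is called of finite type if the IFS is. Local dimensions. $\overline{\dim}_{loc}\mu(x)=\limsup_{r\to0^+}\frac{\log\mu([x-r,x+r])}{\log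 r}$, $\underline{\dim}_{loc}\mu(x)$ is the corresponding $\liminf$, and $\dim_{loc}\mu(x)$ is the common value when the limit exists (it exists at periodic points, defined below). Net intervals. Let $h_1<\dots<h_{s_n}$ be the elements of $\{S_\sigma(0),S_\sigma(1):\sigma\in\mathcal A^n\}$; $\mathcal F_n$ (net intervals of level $n$) is the set of $[h_j,h_{j+1}]$ with $(h_j,h_{j+1})\cap K\ne\emptyset$; $\mathcal F_0=\{[0,1]\}$. Each $\Delta\in\mathcal F_n$, $n\ge1$, is contained in a unique $\widehat\Delta\in\mathcal F_{n-1}$, its parent ($\Delta$ is a child of $\widehat\Delta$). For $\Delta=[a,b]\in\mathcal F_n$: normalized length $\ell_n(\Delta)=\varrho^{-n}(b-a)$; neighbour set $V_n(\Delta)$ = the increasingly ordered tuple of the distinct elements of $\{\varrho^{-n}(a-S_\sigma(0)):\sigma\in\mathcal A^n,\ \Delta\subseteq S_\sigma[0,1]\}$; $r_n(\Delta)$ = position of $\Delta$, from left to right, among the level $n$ net intervals with the same parent and the same normalized length. The characteristic vector is $\mathcal C_n(\Delta)=(\ell_n(\Delta),V_n(\Delta),r_n(\Delta))$. Under finite type the set $\Omega$ of characteristic vectors is finite, and the characteristic vectors of the children of $\Delta$ depend only on that of $\Delta$, so one may speak of children of characteristic vectors. An admissible path is a finite sequence of characteristic vectors, each being the parent of the next. A loop class is a non-empty $\Omega'\subseteq\Omega$ such that any $\alpha,\beta\in\Omega'$ are joined by an admissible path from $\alpha$ to $\beta$ inside $\Omega'$; it is an essential class if in addition all children of elements of $\Omega'$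 are in $\Omega'$. There is exactly one essential class $\Omega_0$ (known). A net interval is essential if its characteristic vector is in $\Omega_0$. A symbolic representation of $x\in K$ is a sequence $[x]=(\mathcal C_0(\Delta_0),\mathcal C_1(\Delta_1),\dots)$ with $x\in\Delta_n\in\mathcal F_n$ and $\Delta_n$ the parent of $\Delta_{n+1}$ for all $n$. Truly essential points. $x\in K$ is a boundary point if it is an endpoint of a net interval of some level. If $x$ is an endpoint of $\Delta_n(x)\in\mathcal F_n$, the other net interval $\Delta_n'(x)$ is the level $n$ net interval on the other side of $x$ having $x$ as an endpoint (the empty set if there is none). $x$ is a boundary essential point if for some $n$ it is an endpoint of $\Delta_n(x)\in\mathcal F_n$ and both $\Delta_n(x)$ and $\Delta_n'(x)$ are essential (the empty set counting as essential). $x$ is an interior essential point if it is not a boundary point and it lies in the interior of some essential net interval. $x$ is truly essential if it is boundary essential or interior essential. Transition matrices. For a level $n$ net interval $\Delta=[a,b]$ with parent $\widehat\Delta=[c,d]$, $V_n(\Delta)=(a_1,\dots,a_N)$, $V_{n-1}(\widehat\Delta)=(c_1,\dots,c_M)$, the primitive transition matrix $T(\mathcal C_{n-1}(\widehat\Delta),\mathcal C_n(\Delta))$ is the $M\times N$ matrix whose $jk$ entry is $p_\ell$ if there are $\ell\in\mathcal A$ and $\sigma\in\mathcal A^{n-1}$ with $S_\sigma(0)=c-\varrho^{n-1}c_j$ and $S_{\sigma\ell}(0)=a-\varrho^n a_k$, and $0$ otherwise (it depends only on the two characteristic vectors). For an admissible path, $T(\gamma_1,\dots,\gamma_n)=T(\gamma_1,\gamma_2)\cdots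 T(\gamma_{n-1},\gamma_n)$. The positive row property: every primitive transition matrix $T(\alpha,\beta)$ with $\alpha,\beta\in\Omega_0$ has a non-zero entry in each row. Periodic points. $x\in K$ is periodic if it has a symbolic representation $(\gamma_0,\dots,\gamma_J,\theta^-,\theta^-,\dots)$, where $\theta$ is an admissible cycle (a non-trivial admissible path with equal first and last letters) and $\theta^-$ is $\theta$ with its last letter deleted; $\theta$ is called a period. $x$ is a positive periodic point if a period $\theta$ can be chosen with all entries of $T(\theta)$ strictly positive. *)

theory Defs
  imports "HOL-Probability.Probability" "Jordan_Normal_Form.Matrix"
begin

text \<open>Net intervals \<open>[a, b]\<close> are represented by the pair \<open>(a, b)\<close>.\<close>

type_synonym net_interval = "real \<times> real"

text \<open>A characteristic vector is a triple of normalized length, neighbour tuple and position.\<close>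

type_synonym char_vec = "real \<times> real list \<times> nat"

locale ifs =
  fixes m :: nat and rho :: real and d :: "nat \<Rightarrow> real" and K :: "real set"
  assumes m_ge_1: "1 \<le> m"
    and rho_pos: "0 < rho" and rho_less_1: "rho < 1"
    and d_0: "d 0 = 0" and d_strict_mono: "strict_mono_on {..m} d"
    and compact_K: "compact K" and K_nonempty: "K \<noteq> {}"
    and K_eq: "K = (\<Union>j\<le>m. (\<lambda>x. rho * x + d j) ` K)"
    and hull_K: "convex hull K = {0..1}"
begin

definition S :: "nat \<Rightarrow> real \<Rightarrow> real" where
  "S j x = rho * x + d j"

definition words :: "nat \<Rightarrow> nat list set" where
  "words n = {w. length w = n \<and> set w \<subseteq> {..m}}"

definition S_word :: "nat list \<Rightarrow> real \<Rightarrow> real" where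
  "S_word w = foldr S w"

definition finite_type :: bool where
  "finite_type \<longleftrightarrow> (\<exists>F. finite F \<and>
     (\<forall>n\<ge>1. \<forall>v\<in>words n. \<forall>w\<in>words n.
        \<bar>S_word v 0 - S_word w 0\<bar> / rho ^ n > 1 \<or> (S_word v 0 - S_word w 0) / rho ^ n \<in> F))"


subsection \<open>Net intervals and characteristic vectors\<close>

definition endpoints :: "nat \<Rightarrow> real set" where
  "endpoints n = (\<Union>w\<in>words n. {S_word w 0, S_word w 1})"

definition net_intervals :: "nat \<Rightarrow> net_interval set" where
  "net_intervals n = {(a, b). a \<in> endpoints n \<and> b \<in> endpoints n \<and> a < b \<and>
     {a<..<b} \<inter> endpoints n = {} \<and> {a<..<b} \<inter> K \<noteq> {}}"

lemma net_intervals_0: "net_intervals 0 = {(0, 1)}"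
proof -
  have "(1::real) extreme_point_of {0..1}"
    by (auto simp: extreme_point_of_def open_segment_eq_real_ivl)
  then have "1 \<in> K"
    using extreme_point_of_convex_hull[of 1 K] hull_K by simp
  then have "rho * 1 + d 0 \<in> K"
    using K_eq by blast
  then have "rho \<in> {0<..<1} \<inter> K"
    using d_0 rho_pos rho_less_1 by simp
  then have K: "{0<..<1} \<inter> K \<noteq> {}"
    by blast
  have "endpoints 0 = {0, 1}"
    by (auto simp: endpoints_def words_def S_word_def)
  with K show ?thesis
    by (auto simp: net_intervals_def)
qed

definition parent :: "nat \<Rightarrow> net_interval \<Rightarrow> net_interval \<Rightarrow> bool" where
  \<comment> \<open>the first interval has level \<open>n\<close> and is the parent of the second, of level \<open>n + 1\<close>\<close>
  "parent n D' D \<longleftrightarrow> D' \<in> net_intervals n \<and> D \<in> net_intervals (Suc n) \<and>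
     {fst D..snd D} \<subseteq> {fst D'..snd D'}"

definition norm_length :: "nat \<Rightarrow> net_interval \<Rightarrow> real" where
  "norm_length n D = (snd D - fst D) / rho ^ n"

definition neighbours :: "nat \<Rightarrow> net_interval \<Rightarrow> real list" where
  "neighbours n D = sorted_list_of_set
     {(fst D - S_word w 0) / rho ^ n | w. w \<in> words n \<and> {fst D..snd D} \<subseteq> S_word w ` {0..1}}"

definition position :: "nat \<Rightarrow> net_interval \<Rightarrow> nat" where
  \<comment> \<open>positions are counted from 1; the level 0 interval, which has no parent, gets position 1\<close>
  "position n D = Suc (card {E \<in> net_intervals n. fst E < fst D \<and> norm_length n E = norm_length n D \<and>
     (\<exists>k D'. n = Suc k \<and> parent k D' D \<and> parent k D' E)})"

definition char_vector :: "nat \<Rightarrow> net_interval \<Rightarrow> char_vec" where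
  "char_vector n D = (norm_length n D, neighbours n D, position n D)"

definition Omega :: "char_vec set" where
  "Omega = {char_vector n D | n D. D \<in> net_intervals n}"

definition child_vec :: "char_vec \<Rightarrow> char_vec \<Rightarrow> bool" where
  \<comment> \<open>the second argument is a child of the first\<close>
  "child_vec \<alpha> \<beta> \<longleftrightarrow> (\<exists>n D' D. parent n D' D \<and> char_vector n D' = \<alpha> \<and> char_vector (Suc n) D = \<beta>)"

definition admissible_path :: "char_vec list \<Rightarrow> bool" where
  "admissible_path \<gamma> \<longleftrightarrow> \<gamma> \<noteq> [] \<and> set \<gamma> \<subseteq> Omega \<and> successively child_vec \<gamma>"

definition loop_class :: "char_vec set \<Rightarrow> bool" where
  "loop_class W \<longleftrightarrow> W \<noteq> {} \<and> W \<subseteq> Omega \<and>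
     (\<forall>\<alpha>\<in>W. \<forall>\<beta>\<in>W. \<exists>\<gamma>. admissible_path \<gamma> \<and> hd \<gamma> = \<alpha> \<and> last \<gamma> = \<beta> \<and> set \<gamma> \<subseteq> W)"

definition essential_class :: "char_vec set \<Rightarrow> bool" where
  "essential_class W \<longleftrightarrow> loop_class W \<and> (\<forall>\<alpha>\<in>W. \<forall>\<beta>. child_vec \<alpha> \<beta> \<longrightarrow> \<beta> \<in> W)"

definition Omega0 :: "char_vec set" where
  \<comment> \<open>under finite type there is exactly one essential class\<close>
  "Omega0 = (THE W. essential_class W)"

definition essential :: "nat \<Rightarrow> net_interval \<Rightarrow> bool" where
  "essential n D \<longleftrightarrow> D \<in> net_intervals n \<and> char_vector n D \<in> Omega0"

definition symbolic_rep :: "real \<Rightarrow> (nat \<Rightarrow> char_vec) \<Rightarrow> bool" where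
  "symbolic_rep x \<gamma> \<longleftrightarrow> (\<exists>D. \<forall>n. D n \<in> net_intervals n \<and> x \<in> {fst (D n)..snd (D n)} \<and>
     parent n (D n) (D (Suc n)) \<and> \<gamma> n = char_vector n (D n))"


subsection \<open>Truly essential points\<close>

definition boundary_point :: "real \<Rightarrow> bool" where
  "boundary_point x \<longleftrightarrow> x \<in> K \<and> (\<exists>n. \<exists>D\<in>net_intervals n. x = fst D \<or> x = snd D)"

definition other_net_interval :: "nat \<Rightarrow> real \<Rightarrow> net_interval \<Rightarrow> net_interval \<Rightarrow> bool" where
  "other_net_interval n x D E \<longleftrightarrow> E \<in> net_intervals n \<and> (x = fst D \<and> x = snd E \<or> x = snd D \<and> x = fst E)"

text \<open>There is at most one other net interval, so the universal quantifier below makes a missing one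
  count as essential.\<close>

definition boundary_essential :: "real \<Rightarrow> bool" where
  "boundary_essential x \<longleftrightarrow> x \<in> K \<and>
     (\<exists>n. \<exists>D\<in>net_intervals n. (x = fst D \<or> x = snd D) \<and> essential n D \<and>
        (\<forall>E. other_net_interval n x D E \<longrightarrow> essential n E))"

definition interior_essential :: "real \<Rightarrow> bool" where
  "interior_essential x \<longleftrightarrow> x \<in> K \<and> \<not> boundary_point x \<and>
     (\<exists>n D. essential n D \<and> x \<in> {fst D<..<snd D})"

definition truly_essential :: "real \<Rightarrow> bool" where
  "truly_essential x \<longleftrightarrow> boundary_essential x \<or> interior_essential x"


subsection \<open>Periodic points\<close>

definition cycle :: "char_vec list \<Rightarrow> bool" where
  "cycle \<theta> \<longleftrightarrow> admissible_path \<theta> \<and> length \<theta> \<ge> 2 \<and> hd \<theta> = last \<theta>"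

definition period :: "real \<Rightarrow> char_vec list \<Rightarrow> bool" where
  \<comment> \<open>\<open>x\<close> is represented by some \<open>\<gamma> 0, \<dots>, \<gamma> J\<close> followed by endless repetitions of \<open>butlast \<theta>\<close>\<close>
  "period x \<theta> \<longleftrightarrow> x \<in> K \<and> cycle \<theta> \<and>
     (\<exists>\<gamma> J. symbolic_rep x \<gamma> \<and> (\<forall>i. \<gamma> (Suc J + i) = butlast \<theta> ! (i mod length (butlast \<theta>))))"

definition periodic :: "real \<Rightarrow> bool" where
  "periodic x \<longleftrightarrow> (\<exists>\<theta>. period x \<theta>)"

end


locale self_similar_measure = ifs m rho d K
  for m rho d K +
  fixes p :: "nat \<Rightarrow> real" and mu :: "real measure"
  assumes p_pos: "j \<le> m \<Longrightarrow> 0 < p j"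
    and p_sum: "(\<Sum>j\<le>m. p j) = 1"
    and prob_mu: "prob_space mu"
    and sets_mu: "sets mu = sets borel"
    and self_similar: "A \<in> sets borel \<Longrightarrow>
      measure mu A = (\<Sum>j\<le>m. p j * measure (distr mu borel (\<lambda>x. rho * x + d j)) A)"
begin

text \<open>Matrix indices start at 0. The \<open>THE\<close> is justified as the \<open>d j\<close> are distinct and
  \<open>S_word (w @ [l]) 0 = S_word w 0 + rho ^ n * d l\<close> for \<open>w\<close> in \<open>words n\<close>.\<close>

definition transition_entry :: "nat \<Rightarrow> net_interval \<Rightarrow> net_interval \<Rightarrow> nat \<Rightarrow> nat \<Rightarrow> real" where
  "transition_entry n D' D j k =
    (let Q = (\<lambda>l. l \<le> m \<and> (\<exists>w\<in>words n.
           S_word w 0 = fst D' - rho ^ n * (neighbours n D' ! j) \<and>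
           S_word (w @ [l]) 0 = fst D - rho ^ Suc n * (neighbours (Suc n) D ! k)))
     in if \<exists>l. Q l then p (THE l. Q l) else 0)"

definition transition_matrix :: "nat \<Rightarrow> net_interval \<Rightarrow> net_interval \<Rightarrow> real mat" where
  "transition_matrix n D' D = mat (length (neighbours n D')) (length (neighbours (Suc n) D))
     (\<lambda>(j, k). transition_entry n D' D j k)"

text \<open>The matrix depends only on the two characteristic vectors, so it can be assigned to them.\<close>

definition primitive_transition :: "char_vec \<Rightarrow> char_vec \<Rightarrow> real mat" where
  "primitive_transition \<alpha> \<beta> = (THE T. \<exists>n D' D. parent n D' D \<and> char_vector n D' = \<alpha> \<and>
     char_vector (Suc n) D = \<beta> \<and> T = transition_matrix n D' D)"

fun path_transition :: "char_vec list \<Rightarrow> real mat" where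
  "path_transition [] = 1\<^sub>m 0"
| "path_transition [(l, V, r)] = 1\<^sub>m (length V)"
| "path_transition (\<alpha> # \<beta> # \<gamma>) = primitive_transition \<alpha> \<beta> * path_transition (\<beta> # \<gamma>)"

definition positive_row_property :: bool where
  "positive_row_property \<longleftrightarrow> (\<forall>\<alpha>\<in>Omega0. \<forall>\<beta>\<in>Omega0. child_vec \<alpha> \<beta> \<longrightarrow>
     (\<forall>j<dim_row (primitive_transition \<alpha> \<beta>). \<exists>k<dim_col (primitive_transition \<alpha> \<beta>).
        primitive_transition \<alpha> \<beta> $$ (j, k) \<noteq> 0))"

definition positive_periodic :: "real \<Rightarrow> bool" where
  "positive_periodic x \<longleftrightarrow> (\<exists>\<theta>. period x \<theta> \<and>
     (\<forall>j<dim_row (path_transition \<theta>). \<forall>k<dim_col (path_transition \<theta>). 0 < path_transition \<theta> $$ (j, k)))"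

end


subsection \<open>Local dimensions\<close>

text \<open>These are extended reals a priori. In the statement they are only taken at points of \<open>K\<close>, the
  support of the measure, so the logarithm is not applied to 0.\<close>

definition upper_local_dim :: "real measure \<Rightarrow> real \<Rightarrow> ereal" where
  "upper_local_dim M x = Limsup (at_right 0) (\<lambda>r. ereal (ln (measure M {x - r..x + r}) / ln r))"

definition lower_local_dim :: "real measure \<Rightarrow> real \<Rightarrow> ereal" where
  "lower_local_dim M x = Liminf (at_right 0) (\<lambda>r. ereal (ln (measure M {x - r..x + r}) / ln r))"

definition has_local_dim :: "real measure \<Rightarrow> real \<Rightarrow> ereal \<Rightarrow> bool" where
  "has_local_dim M x t \<longleftrightarrow> lower_local_dim M x = t \<and> upper_local_dim M x = t"

end

theory Submission
  imports Defs
begin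

text \<open>For a net interval \<open>D\<close> of level \<open>n\<close> the weights of the words covering \<open>D\<close>, grouped by neighbour,
  form a positive row vector, and passing to a descendant multiplies it by the transition matrices.
  Under the positive row property the total weight is comparable with \<open>\<mu>(D)\<close> for essential \<open>D\<close>, and
  below every essential net interval there is, at bounded depth and away from its boundary, a copy of
  one fixed net interval \<open>R\<close> reached by a strictly positive matrix. Closing up paths in this way costs
  only a bounded factor, so the weight is multiplicative up to a bounded factor on the semigroup of
  admissible loops from \<open>R\<close> to \<open>R\<close> that end with such a connector.

  Repeating one loop \<open>E\<close> of length \<open>k\<close> forever gives a positive periodic interior essential point whose
  local dimension differs from the rate of \<open>E\<close> by \<open>O(1/k)\<close>. The balls around a truly essential
  point are covered by boundedly many essential net intervals of comparable size, and each of these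
  has, up to bounded factors, the weight of a loop; so all lower and upper local dimensions lie
  in \<open>[I,S]\<close>. Conversely, a number in \<open>[I,S]\<close> is attained by concatenating loops of slowly growing
  length greedily, choosing a loop of small or of large rate according to the sign of the current
  error.\<close>

subsection \<open>Words and endpoints\<close>

text \<open>Products of transition matrices are far from multiplicative in general, because the zero
  patterns of the factors decide which entries survive; connectors exist to destroy these patterns.
  Two further obstacles shape the proof. The weight of a net interval controls balls around a point
  only if the point keeps away from the endpoints; so connectors, and with them loops, carry a
  margin proportional to their scale, and composition preserves it. An arbitrary truly essential
  point has no such margin, so its balls are handled by packing net intervals; this gives two
  one-sided comparisons with loops, one for each inequality. The uniform constants come from one
  source: there are finitely many types of net intervals, and the properties in question are
  invariant under similarity. Matrices occur only where the positive row property and positive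
  periodic points mention them; elsewhere a weight vector is a function of the real neighbours, and
  monotonicity of the passage to descendants replaces matrix norms. The additive error
  \<open>C0\<close> is harmless since it is divided by the length of a loop, which may be chosen
  large.\<close>

context ifs
begin

abbreviation off :: "nat list \<Rightarrow> real" where
  "off w \<equiv> S_word w 0"

lemma S_word_simps [simp]: "S_word [] x = x" "S_word (j # w) x = rho * S_word w x + d j"
  by (auto simp: S_word_def S_def)

lemma S_word_affine: "S_word w x = rho ^ length w * x + off w"
  by (induction w) (auto simp: algebra_simps)

lemma S_word_append: "S_word (v @ w) x = S_word v (S_word w x)"
  by (induction v) auto

lemma off_append: "off (v @ w) = off v + rho ^ length v * off w"
  using S_word_append[of v w 0] S_word_affine[of v "off w"] by simp

lemma words_0 [simp]: "words 0 = {[]}"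
  by (auto simp: words_def)

lemma words_append: "v \<in> words n \<Longrightarrow> w \<in> words k \<Longrightarrow> v @ w \<in> words (n + k)"
  by (auto simp: words_def)

lemma words_length: "w \<in> words n \<Longrightarrow> length w = n"
  by (auto simp: words_def)

lemma words_take: "w \<in> words (n + k) \<Longrightarrow> take n w \<in> words n"
  and words_drop: "w \<in> words (n + k) \<Longrightarrow> drop n w \<in> words k"
  by (auto simp: words_def dest: in_set_takeD in_set_dropD)

lemma words_split:
  assumes "w \<in> words (n + k)"
  obtains u v where "u \<in> words n" "v \<in> words k" "w = u @ v"
  using words_take[OF assms] words_drop[OF assms] append_take_drop_id[of n w] by metis

lemma finite_words [simp]: "finite (words n)"
proof -
  have "words n = {w. set w \<subseteq> {..m} \<and> length w = n}" by (auto simp: words_def)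
  then show ?thesis using finite_lists_length_eq[of "{..m}" n] by simp
qed

lemma replicate_words: "j \<le> m \<Longrightarrow> replicate n j \<in> words n"
  by (auto simp: words_def)

lemma words_Suc_0 [simp]: "words (Suc 0) = (\<lambda>j. [j]) ` {..m}"
  by (auto simp: words_def length_Suc_conv)

lemma K_sub: "K \<subseteq> {0..1}"
  using hull_subset[of K convex] hull_K by auto

lemma zero_in_K: "0 \<in> K" and one_in_K: "1 \<in> K"
proof -
  have "(0::real) extreme_point_of {0..1}" "(1::real) extreme_point_of {0..1}"
    by (auto simp: extreme_point_of_def open_segment_eq_real_ivl)
  then show "0 \<in> K" "1 \<in> K"
    using extreme_point_of_convex_hull[of 0 K] extreme_point_of_convex_hull[of 1 K] hull_K by simp_all
qed

lemma S_K: "j \<le> m \<Longrightarrow> x \<in> K \<Longrightarrow> rho * x + d j \<in> K"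
  using K_eq by blast

lemma d_mono: "i \<le> j \<Longrightarrow> j \<le> m \<Longrightarrow> d i \<le> d j"
  using strict_mono_onD[OF d_strict_mono, of i j] by (cases "i = j") auto

lemma d_inj: "i \<le> m \<Longrightarrow> j \<le> m \<Longrightarrow> d i = d j \<Longrightarrow> i = j"
  using d_strict_mono strict_mono_on_imp_inj_on[of "{..m}" d] by (auto simp: inj_on_def)

text \<open>The last map fixes 1, as the first one fixes 0. Since 1 lies in some image of
  \<open>K\<close> and \<open>d m\<close> is the largest translation, it cannot be smaller; since
  \<open>K\<close> stays in the unit interval, it cannot be larger.\<close>

lemma d_m: "d m = 1 - rho"
proof -
  obtain x j where x: "x \<in> K" "j \<le> m" "1 = rho * x + d j"
    using one_in_K K_eq by blast
  have "rho * x \<le> rho" using x K_sub rho_pos by (auto simp: mult_left_le)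
  then have "1 - rho \<le> d m" using x d_mono[of j m] by linarith
  moreover have "rho * 1 + d m \<in> K" using S_K one_in_K by blast
  then have "rho * 1 + d m \<le> 1" using K_sub by auto
  ultimately show ?thesis by simp
qed

lemma S_word_K: "w \<in> words n \<Longrightarrow> x \<in> K \<Longrightarrow> S_word w x \<in> K"
  proof (induction w arbitrary: n)
  case (Cons j w)
  then show ?case by (auto simp: words_def intro!: S_K)
qed simp

lemma K_words: "K = (\<Union>w\<in>words n. S_word w ` K)"
proof (induction n)
  case (Suc n)
  show ?case
  proof
    show "(\<Union>w\<in>words (Suc n). S_word w ` K) \<subseteq> K" using S_word_K by blast
    show "K \<subseteq> (\<Union>w\<in>words (Suc n). S_word w ` K)"
    proof
      fix x assume "x \<in> K"
      then obtain y j where y: "y \<in> K" "j \<le> m" "x = rho * y + d j" using K_eq by blast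
      with Suc obtain w z where "w \<in> words n" "z \<in> K" "y = S_word w z" by blast
      then have "j # w \<in> words (Suc n)" "x = S_word (j # w) z" using y by (auto simp: words_def)
      with \<open>z \<in> K\<close> show "x \<in> (\<Union>w\<in>words (Suc n). S_word w ` K)" by blast
    qed
  qed
qed simp

lemma rho_pow_pos [simp]: "0 < rho ^ n"
  using rho_pos by simp

lemma rho_nz [simp]: "rho \<noteq> 0"
  using rho_pos by simp

lemma off_bounds:
  assumes "w \<in> words n" shows "0 \<le> off w" "off w + rho ^ n \<le> 1"
proof -
  have "S_word w 0 \<in> K" "S_word w 1 \<in> K" using S_word_K[OF assms] zero_in_K one_in_K by auto
  then show "0 \<le> off w" "off w + rho ^ n \<le> 1"
    using K_sub S_word_affine[of w 1] words_length[OF assms] by auto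
qed

lemma S_word_image:
  assumes "w \<in> words n" shows "S_word w ` {0..1} = {off w..off w + rho ^ n}"
proof -
  have "S_word w = (\<lambda>x. rho ^ n * x + off w)"
  proof
    fix x show "S_word w x = rho ^ n * x + off w"
      using S_word_affine[of w x] words_length[OF assms] by simp
  qed
  then show ?thesis using image_affinity_atLeastAtMost[of "rho ^ n" "off w" 0 1]
    by (simp only:) (simp add: less_imp_le)
qed

lemma endpoints_iff: "y \<in> endpoints n \<longleftrightarrow> (\<exists>w\<in>words n. y = off w \<or> y = off w + rho ^ n)"
proof -
  have "S_word w 1 = off w + rho ^ n" if "w \<in> words n" for w
    using S_word_affine[of w 1] words_length[OF that] by simp
  then show ?thesis by (auto simp: endpoints_def)
qed

lemma finite_endpoints [simp]: "finite (endpoints n)"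
  by (simp add: endpoints_def)

lemma endpoints_bounds: "y \<in> endpoints n \<Longrightarrow> 0 \<le> y \<and> y \<le> 1"
proof -
  assume "y \<in> endpoints n"
  then obtain w where "w \<in> words n" "y = off w \<or> y = off w + rho ^ n" by (auto simp: endpoints_iff)
  then show ?thesis using off_bounds[of w n] rho_pow_pos[of n] by linarith
qed

lemma off_replicate_0: "off (replicate n 0) = 0"
  by (induction n) (auto simp: d_0)

lemma off_replicate_m: "off (replicate n m) = 1 - rho ^ n"
proof (induction n)
  case (Suc n)
  then show ?case by (simp add: d_m) (simp add: algebra_simps)
qed simp

lemma endpoints_0_1: "0 \<in> endpoints n" "1 \<in> endpoints n"
  unfolding endpoints_iff
  by (rule bexI[of _ "replicate n 0"], simp add: off_replicate_0, simp add: replicate_words)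
     (rule bexI[of _ "replicate n m"], simp add: off_replicate_m, simp add: replicate_words)

text \<open>The map of letter 0 fixes 0 and that of letter \<open>m\<close> fixes 1, so padding a
  word with 0 keeps its left endpoint and padding with \<open>m\<close> keeps its right
  endpoint.\<close>

lemma endpoints_mono_add: "endpoints n \<subseteq> endpoints (n + k)"
proof
  fix y assume "y \<in> endpoints n"
  then obtain w where w: "w \<in> words n" "y = off w \<or> y = off w + rho ^ n" by (auto simp: endpoints_iff)
  from w(2) show "y \<in> endpoints (n + k)"
  proof
    assume "y = off w"
    then have "y = off (w @ replicate k 0)" by (simp add: off_append off_replicate_0)
    then show ?thesis using words_append[OF w(1) replicate_words[of 0 k]] by (auto simp: endpoints_iff)
  next
    assume "y = off w + rho ^ n"
    then have "y = off (w @ replicate k m) + rho ^ (n + k)"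
      using words_length[OF w(1)] by (simp add: off_append off_replicate_m algebra_simps power_add)
    then show ?thesis using words_append[OF w(1) replicate_words[of m k]] by (auto simp: endpoints_iff)
  qed
qed

lemma endpoints_mono: "n \<le> k \<Longrightarrow> endpoints n \<subseteq> endpoints k"
  using endpoints_mono_add[of n "k - n"] by simp

lemma rho_pow_tendsto_0: "(\<lambda>n. rho ^ n) \<longlonglongrightarrow> 0"
  using rho_pos rho_less_1 by (intro LIMSEQ_power_zero) auto

lemma rho_pow_small: "0 < e \<Longrightarrow> \<exists>N. \<forall>n\<ge>N. rho ^ n < e"
  using order_tendstoD(2)[OF rho_pow_tendsto_0] by (auto simp: eventually_sequentially)

lemma infinite_K: "infinite K"
proof
  assume fin: "finite K"
  have "range (\<lambda>n. rho ^ n) \<subseteq> K"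
  proof clarify
    fix n show "rho ^ n \<in> K"
      using S_word_K[OF replicate_words[of 0 n] one_in_K] S_word_affine[of "replicate n 0" 1]
      by (simp add: off_replicate_0)
  qed
  then have "finite (range (\<lambda>n. rho ^ n))" using fin finite_subset by blast
  moreover have "inj (\<lambda>n. rho ^ n)"
    using rho_pos rho_less_1 by (auto intro!: injI simp: power_inject_exp')
  ultimately show False using finite_imageD infinite_UNIV_nat by blast
qed

lemma word_near:
  assumes "x \<in> K" "0 < e"
  obtains N where "\<And>n. n \<ge> N \<Longrightarrow> \<exists>w\<in>words n. x \<in> S_word w ` K \<and> {off w..off w + rho ^ n} \<subseteq> {x - e<..<x + e}"
proof -
  obtain N where N: "\<And>n. n \<ge> N \<Longrightarrow> rho ^ n < e" using rho_pow_small[OF assms(2)] by auto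
  have "\<exists>w\<in>words n. x \<in> S_word w ` K \<and> {off w..off w + rho ^ n} \<subseteq> {x - e<..<x + e}" if "n \<ge> N" for n
  proof -
    obtain w where w: "w \<in> words n" "x \<in> S_word w ` K" using assms(1) K_words[of n] by blast
    then have "x \<in> S_word w ` {0..1}" using K_sub by blast
    then have "x \<in> {off w..off w + rho ^ n}" using S_word_image[OF w(1)] by simp
    then have "{off w..off w + rho ^ n} \<subseteq> {x - e<..<x + e}" using N[OF that] by auto
    with w show ?thesis by blast
  qed
  then show ?thesis using that by blast
qed

text \<open>A small copy of \<open>K\<close> near \<open>x\<close> fits into the interval. This lets
  one choose points of \<open>K\<close> that avoid the finitely many endpoints of a level.\<close>

lemma infinite_K_ivl:
  assumes "x \<in> K" "a < x" "x < b" shows "infinite (K \<inter> {a<..<b})"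
proof -
  define e where "e = min (x - a) (b - x)"
  have "0 < e" using assms by (auto simp: e_def)
  then obtain n w where w: "w \<in> words n" "{off w..off w + rho ^ n} \<subseteq> {x - e<..<x + e}"
    using word_near[OF assms(1)] by (metis order_refl)
  have "S_word w ` K \<subseteq> K" using S_word_K[OF w(1)] by blast
  moreover have "S_word w ` K \<subseteq> {a<..<b}"
  proof -
    have "S_word w ` K \<subseteq> {x - e<..<x + e}" using w S_word_image[OF w(1)] K_sub by blast
    moreover have "{x - e<..<x + e} \<subseteq> {a<..<b}" by (auto simp: e_def)
    ultimately show ?thesis by blast
  qed
  moreover have "inj_on (S_word w) K"
  proof (rule inj_onI)
    fix x y assume "S_word w x = S_word w y"
    then show "x = y" using S_word_affine[of w x] S_word_affine[of w y] by simp
  qed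
  then have "infinite (S_word w ` K)" using infinite_K finite_imageD by blast
  ultimately show ?thesis using finite_subset[of "S_word w ` K" "K \<inter> {a<..<b}"] by blast
qed

end

subsection \<open>Net intervals and similar net intervals\<close>

context ifs
begin

lemma rho_pow_nonneg [simp]: "0 \<le> rho ^ n"
  using rho_pow_pos[of n] by linarith

lemma off_01: assumes "t \<in> words k" shows "off t \<in> {0..1}" "off t + rho ^ k \<in> {0..1}"
proof -
  have "0 \<le> off t" "off t + rho ^ k \<le> 1" "0 < rho ^ k" using off_bounds[OF assms] by simp_all
  then have "0 \<le> off t \<and> off t \<le> 1" "0 \<le> off t + rho ^ k \<and> off t + rho ^ k \<le> 1" by linarith+
  then show "off t \<in> {0..1}" "off t + rho ^ k \<in> {0..1}" by simp_all
qed

abbreviation sub :: "net_interval \<Rightarrow> net_interval \<Rightarrow> bool" where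
  "sub E D \<equiv> fst D \<le> fst E \<and> snd E \<le> snd D"

definition cov :: "nat \<Rightarrow> net_interval \<Rightarrow> nat list set" where
  "cov n D = {w \<in> words n. off w \<le> fst D \<and> snd D \<le> off w + rho ^ n}"

text \<open>The neighbours as a set of reals; the order of the tuple \<open>neighbours\<close>
  matters only for matrix indices.\<close>

definition nb :: "nat \<Rightarrow> net_interval \<Rightarrow> real set" where
  "nb n D = (\<lambda>w. (fst D - off w) / rho ^ n) ` cov n D"

lemma netD:
  assumes "D \<in> net_intervals n"
  shows "fst D \<in> endpoints n" "snd D \<in> endpoints n" "fst D < snd D"
    "{fst D<..<snd D} \<inter> endpoints n = {}" "{fst D<..<snd D} \<inter> K \<noteq> {}"
    "0 \<le> fst D" "snd D \<le> 1"
  using assms endpoints_bounds by (auto simp: net_intervals_def case_prod_beta)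

lemma netI:
  "a \<in> endpoints n \<Longrightarrow> b \<in> endpoints n \<Longrightarrow> a < b \<Longrightarrow> {a<..<b} \<inter> endpoints n = {} \<Longrightarrow> {a<..<b} \<inter> K \<noteq> {}
    \<Longrightarrow> (a, b) \<in> net_intervals n"
  by (auto simp: net_intervals_def)

lemma net_between:
  assumes "0 \<le> c" "c < e" "e \<le> 1" "{c<..<e} \<inter> endpoints n = {}"
  obtains a b where "a \<in> endpoints n" "b \<in> endpoints n" "a \<le> c" "e \<le> b" "{a<..<b} \<inter> endpoints n = {}"
proof -
  define A where "A = {y \<in> endpoints n. y \<le> c}"
  define B where "B = {y \<in> endpoints n. e \<le> y}"
  have fin: "finite A" "A \<noteq> {}" "finite B" "B \<noteq> {}"
    using endpoints_0_1[of n] assms by (auto simp: A_def B_def)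
  have "Max A \<in> A" "Min B \<in> B" using fin by (simp_all add: Max_in Min_in)
  moreover have "{Max A<..<Min B} \<inter> endpoints n = {}"
  proof (rule ccontr)
    assume "{Max A<..<Min B} \<inter> endpoints n \<noteq> {}"
    then obtain y where y: "Max A < y" "y < Min B" "y \<in> endpoints n" by auto
    have "c < y" using y fin Max_ge[of A y] unfolding A_def by (smt (verit) mem_Collect_eq)
    moreover have "y < e" using y fin Min_le[of B y] unfolding B_def by (smt (verit) mem_Collect_eq)
    ultimately show False using assms(4) y by auto
  qed
  ultimately show ?thesis using that by (auto simp: A_def B_def)
qed

lemma net_exists_open:
  assumes "{c<..<e} \<inter> K \<noteq> {}" "{c<..<e} \<inter> endpoints n = {}" "0 \<le> c" "e \<le> 1"
  obtains D where "D \<in> net_intervals n" "fst D \<le> c" "e \<le> snd D"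
proof -
  have "c < e" using assms(1) by auto
  then obtain a b where ab: "a \<in> endpoints n" "b \<in> endpoints n" "a \<le> c" "e \<le> b" "{a<..<b} \<inter> endpoints n = {}"
    using net_between[of c e n] assms by blast
  have "{c<..<e} \<subseteq> {a<..<b}" using ab by auto
  then have "(a, b) \<in> net_intervals n" using ab \<open>c < e\<close> assms(1) by (intro netI) auto
  then show ?thesis using that[of "(a, b)"] ab by simp
qed

text \<open>Endpoints of level \<open>n\<close> are still endpoints at level \<open>n + k\<close>,
  so none of them lies inside \<open>D\<close>.\<close>

lemma net_ancestor:
  assumes "D \<in> net_intervals (n + k)"
  obtains A where "A \<in> net_intervals n" "sub D A"
  using net_exists_open[of "fst D" "snd D" n] netD[OF assms] endpoints_mono_add[of n k]
  by (metis (no_types, lifting) disjoint_iff subsetD)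

lemma net_eqI:
  assumes "D \<in> net_intervals n" "E \<in> net_intervals n" "fst D < snd E" "fst E < snd D"
  shows "D = E"
proof -
  have "fst E \<notin> {fst D<..<snd D}" "fst D \<notin> {fst E<..<snd E}" "snd D \<notin> {fst E<..<snd E}" "snd E \<notin> {fst D<..<snd D}"
    using netD(1,2,4)[OF assms(1)] netD(1,2,4)[OF assms(2)] by blast+
  then have "\<not> fst D < fst E" "\<not> fst E < fst D" "\<not> snd D < snd E" "\<not> snd E < snd D"
    using assms(3,4) by simp_all
  then show ?thesis by (simp add: prod_eq_iff)
qed

lemma net_subset:
  assumes "D \<in> net_intervals n" "E \<in> net_intervals (n + k)" "fst D < snd E" "fst E < snd D"
  shows "sub E D"
proof -
  obtain A where A: "A \<in> net_intervals n" "sub E A" using net_ancestor[OF assms(2)] .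
  then have "D = A" using assms by (intro net_eqI[of D n A]) auto
  then show ?thesis using A by simp
qed

lemma finite_net [simp]: "finite (net_intervals n)"
proof (rule finite_subset)
  show "net_intervals n \<subseteq> endpoints n \<times> endpoints n" by (auto simp: net_intervals_def)
qed simp

text \<open>If \<open>x\<close> is itself an endpoint, \<open>K\<close> may accumulate at it from
  one side only. So a point \<open>z\<close> of \<open>K\<close> is taken closer to \<open>x\<close>
  than every other endpoint of the level; the net interval around \<open>z\<close> cannot end
  strictly between \<open>z\<close> and \<open>x\<close>.\<close>

lemma net_point:
  assumes "x \<in> K"
  obtains D where "D \<in> net_intervals n" "fst D \<le> x" "x \<le> snd D"
proof -
  obtain e where e: "0 < e" "\<And>y. y \<in> endpoints n \<Longrightarrow> y \<noteq> x \<Longrightarrow> e \<le> dist x y"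
    using finite_set_avoid[OF finite_endpoints[of n], of x] by blast
  have "infinite (K \<inter> {x - e<..<x + e})" using infinite_K_ivl[OF assms] e by simp
  then have "infinite (K \<inter> {x - e<..<x + e} - {x})" by simp
  then have "K \<inter> {x - e<..<x + e} - {x} \<noteq> {}" by (rule infinite_imp_nonempty)
  then obtain z where "z \<in> K \<inter> {x - e<..<x + e} - {x}" by blast
  then have z: "z \<in> K" "x - e < z" "z < x + e" "z \<noteq> x" by simp_all
  have dxz: "\<bar>x - z\<bar> < e" using z by linarith
  have nz: "z \<notin> endpoints n" using e(2)[of z] z(4) dxz unfolding dist_real_def by linarith
  have "z \<noteq> 0" "z \<noteq> 1" using nz endpoints_0_1[of n] by metis+
  then have z01: "0 < z" "z < 1" using z(1) K_sub by (metis atLeastAtMost_iff less_le subsetD)+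
  obtain s where s: "0 < s" "\<And>y. y \<in> endpoints n \<Longrightarrow> y \<noteq> z \<Longrightarrow> s \<le> dist z y"
    using finite_set_avoid[OF finite_endpoints[of n], of z] by blast
  have s': "s \<le> \<bar>y - z\<bar>" if "y \<in> endpoints n" for y
    using s(2)[OF that] nz that by (metis dist_commute dist_real_def)
  have b: "0 \<le> z - s" "z + s \<le> 1" using s'[of 0] s'[of 1] endpoints_0_1[of n] z01 by simp_all
  have e1: "{z - s<..<z + s} \<inter> endpoints n = {}"
  proof (rule ccontr)
    assume "{z - s<..<z + s} \<inter> endpoints n \<noteq> {}"
    then obtain y where "y \<in> endpoints n" "z - s < y" "y < z + s" by auto
    then show False using s'[of y] by linarith
  qed
  have "z \<in> {z - s<..<z + s} \<inter> K" using z(1) s(1) by simp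
  then have e2: "{z - s<..<z + s} \<inter> K \<noteq> {}" by (metis emptyE)
  obtain D where D: "D \<in> net_intervals n" "fst D \<le> z - s" "z + s \<le> snd D"
    using net_exists_open[OF e2 e1 b] .
  have "fst D \<le> x"
  proof (rule ccontr)
    assume "\<not> fst D \<le> x"
    then show False using e(2)[OF netD(1)[OF D(1)]] D(2) z s(1) unfolding dist_real_def by linarith
  qed
  moreover have "x \<le> snd D"
  proof (rule ccontr)
    assume "\<not> x \<le> snd D"
    then show False using e(2)[OF netD(2)[OF D(1)]] D(3) z s(1) unfolding dist_real_def by linarith
  qed
  ultimately show ?thesis using that D by blast
qed

lemma net_point_in:
  assumes "x \<in> K" "D \<in> net_intervals n" "fst D < x" "x < snd D"
  obtains E where "E \<in> net_intervals (n + k)" "fst E \<le> x" "x \<le> snd E" "sub E D"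
proof -
  obtain E where E: "E \<in> net_intervals (n + k)" "fst E \<le> x" "x \<le> snd E"
    using net_point[OF assms(1)] .
  have "sub E D" using net_subset[OF assms(2) E(1)] E assms by linarith
  with E that show ?thesis by blast
qed

text \<open>Both ends of the word interval are endpoints of level \<open>n\<close>, and none of
  those lies inside \<open>D\<close>; meeting the interior of \<open>D\<close> therefore forces the
  word interval to cover it.\<close>

lemma covI:
  assumes "D \<in> net_intervals n" "w \<in> words n" "fst D < x" "x < snd D" "off w \<le> x" "x \<le> off w + rho ^ n"
  shows "w \<in> cov n D"
proof -
  have "off w \<in> endpoints n" "off w + rho ^ n \<in> endpoints n" using assms(2) by (auto simp: endpoints_iff)
  then have "off w \<notin> {fst D<..<snd D}" "off w + rho ^ n \<notin> {fst D<..<snd D}"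
    using netD(4)[OF assms(1)] by blast+
  then have "off w \<le> fst D" "snd D \<le> off w + rho ^ n" using assms(3-6) by simp_all
  then show ?thesis using assms(2) by (simp add: cov_def)
qed

lemma K_word_point:
  assumes "x \<in> K"
  obtains w z where "w \<in> words n" "z \<in> K" "x = off w + rho ^ n * z"
proof -
  obtain w z where "w \<in> words n" "z \<in> K" "x = S_word w z" using assms K_words[of n] by blast
  with S_word_affine[of w z] words_length[of w n] that show ?thesis by (simp add: add.commute)
qed

lemma word_point_K: "w \<in> words n \<Longrightarrow> z \<in> K \<Longrightarrow> off w + rho ^ n * z \<in> K"
  using S_word_K[of w n z] S_word_affine[of w z] words_length[of w n] by (simp add: add.commute)

lemma word_point_bounds: "z \<in> {0..1} \<Longrightarrow> off w \<le> off w + rho ^ n * z \<and> off w + rho ^ n * z \<le> off w + rho ^ n"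
  by (auto simp: mult_left_le)

lemma cov_nonempty: assumes "D \<in> net_intervals n" shows "cov n D \<noteq> {}"
proof -
  obtain x where x: "x \<in> K" "fst D < x" "x < snd D" using netD(5)[OF assms] by auto
  obtain w z where w: "w \<in> words n" "z \<in> K" "x = off w + rho ^ n * z" using K_word_point[OF x(1)] .
  then have "w \<in> cov n D"
    using covI[OF assms w(1) x(2,3)] word_point_bounds[of z w n] K_sub by auto
  then show ?thesis by auto
qed

lemma finite_cov [simp]: "finite (cov n D)"
  by (simp add: cov_def)

lemma finite_nb [simp]: "finite (nb n D)"
  by (simp add: nb_def)

lemma nb_nonempty: "D \<in> net_intervals n \<Longrightarrow> nb n D \<noteq> {}"
  using cov_nonempty by (simp add: nb_def)

lemma net_length: "D \<in> net_intervals n \<Longrightarrow> snd D - fst D \<le> rho ^ n"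
  using cov_nonempty[of D n] by (auto simp: cov_def)

lemma norm_length_pos: "D \<in> net_intervals n \<Longrightarrow> 0 < norm_length n D"
  using netD(3)[of D n] by (simp add: norm_length_def)

lemma snd_eq: "snd D = fst D + rho ^ n * norm_length n D"
  by (simp add: norm_length_def)

lemma neighbours_eq: assumes "D \<in> net_intervals n" shows "neighbours n D = sorted_list_of_set (nb n D)"
proof -
  have "w \<in> words n \<and> {fst D..snd D} \<subseteq> S_word w ` {0..1} \<longleftrightarrow> w \<in> cov n D" for w
    using S_word_image[of w n] netD(3)[OF assms] by (auto simp: cov_def)
  then have "{(fst D - off w) / rho ^ n | w. w \<in> words n \<and> {fst D..snd D} \<subseteq> S_word w ` {0..1}} = nb n D"
    by (auto simp: nb_def)
  then show ?thesis by (simp add: neighbours_def)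
qed

lemma set_neighbours: "D \<in> net_intervals n \<Longrightarrow> set (neighbours n D) = nb n D"
  by (simp add: neighbours_eq)

lemma neighbours_eq_iff: "D \<in> net_intervals n \<Longrightarrow> D' \<in> net_intervals n' \<Longrightarrow>
    neighbours n D = neighbours n' D' \<longleftrightarrow> nb n D = nb n' D'"
  by (metis neighbours_eq set_neighbours)

lemma nbD: assumes "v \<in> nb n D"
  obtains w where "w \<in> cov n D" "off w = fst D - rho ^ n * v"
  using assms that by (auto simp: nb_def)

lemma nb_bounds: assumes "v \<in> nb n D" shows "0 \<le> v" "v + norm_length n D \<le> 1"
proof -
  obtain w where w: "w \<in> cov n D" "off w = fst D - rho ^ n * v" using nbD[OF assms] .
  have "0 \<le> rho ^ n * v" using w by (auto simp: cov_def)
  then show "0 \<le> v" using rho_pow_pos[of n] by (simp only: zero_le_mult_iff) linarith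
  have "rho ^ n * (v + norm_length n D) \<le> rho ^ n * 1"
    using w snd_eq[of D n] by (auto simp: cov_def algebra_simps)
  then show "v + norm_length n D \<le> 1" by simp
qed

lemma nb_cov:
  assumes "v \<in> nb n D" "w \<in> words n" "off w = fst D - rho ^ n * v" shows "w \<in> cov n D"
  using assms nbD[OF assms(1)] by (auto simp: cov_def)

lemma cov_nb: "w \<in> cov n D \<Longrightarrow> (fst D - off w) / rho ^ n \<in> nb n D"
  by (auto simp: nb_def)

lemma parent_iff: "parent n D' D \<longleftrightarrow> D' \<in> net_intervals n \<and> D \<in> net_intervals (Suc n) \<and> sub D D'"
proof -
  have "{fst D..snd D} \<subseteq> {fst D'..snd D'} \<longleftrightarrow> sub D D'" if "D \<in> net_intervals (Suc n)"
    using netD(3)[OF that] by auto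
  then show ?thesis by (auto simp: parent_def)
qed

lemma parent_unique: "parent n A D \<Longrightarrow> parent n A' D \<Longrightarrow> A = A'"
  using netD(3)[of D "Suc n"] by (intro net_eqI[of A n A']) (auto simp: parent_iff)

text \<open>Equality of characteristic vectors up to the position, which depends on the siblings of
  an interval and not on its inside.\<close>

definition sim :: "nat \<Rightarrow> net_interval \<Rightarrow> nat \<Rightarrow> net_interval \<Rightarrow> bool" where
  "sim n D n' D' \<longleftrightarrow> D \<in> net_intervals n \<and> D' \<in> net_intervals n' \<and>
     norm_length n D = norm_length n' D' \<and> nb n D = nb n' D'"

text \<open>The increasing affine map that takes \<open>D\<close> onto a similar \<open>D'\<close>.
  The ratio is a quotient of powers because either level may be the larger one.\<close>

definition emb :: "nat \<Rightarrow> net_interval \<Rightarrow> nat \<Rightarrow> net_interval \<Rightarrow> real \<Rightarrow> real" where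
  "emb n D n' D' x = fst D' + rho ^ n' / rho ^ n * (x - fst D)"

abbreviation embI :: "nat \<Rightarrow> net_interval \<Rightarrow> nat \<Rightarrow> net_interval \<Rightarrow> net_interval \<Rightarrow> net_interval" where
  "embI n D n' D' E \<equiv> (emb n D n' D' (fst E), emb n D n' D' (snd E))"

lemma sim_sym: "sim n D n' D' \<Longrightarrow> sim n' D' n D"
  by (auto simp: sim_def)

lemma emb_fst [simp]: "emb n D n' D' (fst D) = fst D'"
  by (simp add: emb_def)

lemma emb_snd: "sim n D n' D' \<Longrightarrow> emb n D n' D' (snd D) = snd D'"
  by (simp add: emb_def snd_eq[of D n] snd_eq[of D' n'] sim_def)

lemma emb_less [simp]: "emb n D n' D' x < emb n D n' D' y \<longleftrightarrow> x < y"
proof -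
  have "0 < rho ^ n' / rho ^ n" by simp
  then show ?thesis unfolding emb_def by (simp only: add_less_cancel_left mult_less_cancel_left_pos) simp
qed

lemma emb_le [simp]: "emb n D n' D' x \<le> emb n D n' D' y \<longleftrightarrow> x \<le> y"
  using emb_less[of n D n' D' y x] by (simp add: not_less[symmetric] del: emb_less)

lemma emb_inv [simp]: "emb n' D' n D (emb n D n' D' x) = x"
  by (simp add: emb_def)

lemma emb_between: "sim n D n' D' \<Longrightarrow> fst D < x \<Longrightarrow> x < snd D \<Longrightarrow> fst D' < emb n D n' D' x \<and> emb n D n' D' x < snd D'"
  using emb_less[of n D n' D' "fst D" x] emb_less[of n D n' D' x "snd D"] emb_snd[of n D n' D'] by auto

section \<open>Transport of endpoints, of \<open>K\<close> and of neighbours between similar net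
  intervals\<close>

lemma emb_rel: "emb n D n' D' (fst D - rho ^ n * v + rho ^ n * t) = fst D' - rho ^ n' * v + rho ^ n' * t"
  by (simp add: emb_def field_simps)

text \<open>Inside \<open>D\<close> only words with a prefix covering \<open>D\<close> contribute,
  so the deeper endpoints are described by \<open>nb n D\<close> alone, in coordinates relative to
  \<open>D\<close>.\<close>

lemma endpoints_rel:
  assumes "D \<in> net_intervals n" "fst D < x" "x < snd D"
  shows "x \<in> endpoints (n + k) \<longleftrightarrow> (\<exists>v\<in>nb n D. \<exists>t\<in>words k.
    x = fst D - rho ^ n * v + rho ^ n * off t \<or> x = fst D - rho ^ n * v + rho ^ n * (off t + rho ^ k))"
proof
  assume "x \<in> endpoints (n + k)"
  then obtain w where w: "w \<in> words (n + k)" "x = off w \<or> x = off w + rho ^ (n + k)"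
    by (auto simp: endpoints_iff)
  obtain u t where ut: "u \<in> words n" "t \<in> words k" "w = u @ t" using words_split[OF w(1)] .
  have o: "off w = off u + rho ^ n * off t" using ut words_length[of u n] by (simp add: off_append)
  have "x = off u + rho ^ n * off t \<or> x = off u + rho ^ n * (off t + rho ^ k)"
    using w(2) o by (auto simp: algebra_simps power_add)
  moreover have "u \<in> cov n D"
  proof (rule covI[OF assms(1) ut(1) assms(2,3)])
    show "off u \<le> x" "x \<le> off u + rho ^ n"
      using calculation word_point_bounds off_01[OF ut(2)] by metis+
  qed
  then have "(fst D - off u) / rho ^ n \<in> nb n D" by (rule cov_nb)
  moreover have "off u = fst D - rho ^ n * ((fst D - off u) / rho ^ n)" by simp
  ultimately show "\<exists>v\<in>nb n D. \<exists>t\<in>words k.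
    x = fst D - rho ^ n * v + rho ^ n * off t \<or> x = fst D - rho ^ n * v + rho ^ n * (off t + rho ^ k)"
    using ut(2) by metis
next
  assume "\<exists>v\<in>nb n D. \<exists>t\<in>words k.
    x = fst D - rho ^ n * v + rho ^ n * off t \<or> x = fst D - rho ^ n * v + rho ^ n * (off t + rho ^ k)"
  then obtain v t where vt: "v \<in> nb n D" "t \<in> words k"
    "x = fst D - rho ^ n * v + rho ^ n * off t \<or> x = fst D - rho ^ n * v + rho ^ n * (off t + rho ^ k)" by blast
  obtain u where u: "u \<in> cov n D" "off u = fst D - rho ^ n * v" using nbD[OF vt(1)] .
  then have "u \<in> words n" by (simp add: cov_def)
  then have "u @ t \<in> words (n + k)" "off (u @ t) = off u + rho ^ n * off t"
    using words_append vt(2) words_length[of u n] by (auto simp: off_append)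
  moreover have "x = off u + rho ^ n * off t \<or> x = off u + rho ^ n * off t + rho ^ (n + k)"
    using vt(3) u(2) by (auto simp: algebra_simps power_add)
  ultimately show "x \<in> endpoints (n + k)" unfolding endpoints_iff by metis
qed

lemma K_rel:
  assumes "D \<in> net_intervals n" "fst D < x" "x < snd D"
  shows "x \<in> K \<longleftrightarrow> (\<exists>v\<in>nb n D. \<exists>z\<in>K. x = fst D - rho ^ n * v + rho ^ n * z)"
proof
  assume "x \<in> K"
  then obtain u z where w: "u \<in> words n" "z \<in> K" "x = off u + rho ^ n * z" by (rule K_word_point)
  have "u \<in> cov n D"
    using covI[OF assms(1) w(1) assms(2,3)] w word_point_bounds[of z u n] K_sub by auto
  then have "(fst D - off u) / rho ^ n \<in> nb n D" by (rule cov_nb)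
  moreover have "off u = fst D - rho ^ n * ((fst D - off u) / rho ^ n)" by simp
  ultimately show "\<exists>v\<in>nb n D. \<exists>z\<in>K. x = fst D - rho ^ n * v + rho ^ n * z"
    using w by metis
next
  assume "\<exists>v\<in>nb n D. \<exists>z\<in>K. x = fst D - rho ^ n * v + rho ^ n * z"
  then obtain v z where vz: "v \<in> nb n D" "z \<in> K" "x = fst D - rho ^ n * v + rho ^ n * z" by blast
  obtain u where u: "u \<in> cov n D" "off u = fst D - rho ^ n * v" using nbD[OF vz(1)] .
  then show "x \<in> K" using word_point_K[of u n z] vz by (auto simp: cov_def)
qed

text \<open>The interval of the prefix contains that of the whole word, hence the midpoint of
  \<open>E\<close>, which lies inside \<open>D\<close>.\<close>

lemma cov_take:
  assumes "D \<in> net_intervals n" "E \<in> net_intervals (n + k)" "sub E D" "u @ t \<in> cov (n + k) E" "u \<in> words n" "t \<in> words k"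
  shows "u \<in> cov n D"
proof -
  have o: "off (u @ t) = off u + rho ^ n * off t" using words_length[OF assms(5)] by (simp add: off_append)
  have e: "fst E < snd E" using netD(3)[OF assms(2)] .
  have b: "off u + rho ^ n * off t \<le> fst E" "snd E \<le> off u + rho ^ n * (off t + rho ^ k)"
    using assms(4) o by (auto simp: cov_def power_add algebra_simps)
  have "off u \<le> fst E" "snd E \<le> off u + rho ^ n"
    using b off_01[OF assms(6)] word_point_bounds[of "off t" u n] word_point_bounds[of "off t + rho ^ k" u n] by linarith+
  then show ?thesis using covI[OF assms(1,5), of "(fst E + snd E) / 2"] assms(3) e by auto
qed

text \<open>The two bounds on \<open>v'\<close> express that a word with the corresponding offset
  covers \<open>E\<close>. Thus the neighbours of a descendant are computed from those of
  \<open>D\<close>, the relative place of \<open>E\<close> and its normalized length.\<close>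

lemma nb_rel:
  assumes "D \<in> net_intervals n" "E \<in> net_intervals (n + k)" "sub E D"
  shows "v' \<in> nb (n + k) E \<longleftrightarrow> 0 \<le> v' \<and> v' + norm_length (n + k) E \<le> 1 \<and>
    (\<exists>v\<in>nb n D. \<exists>t\<in>words k. rho ^ k * v' = (fst E - fst D) / rho ^ n + v - off t)"
    (is "_ \<longleftrightarrow> ?R")
proof
  assume v': "v' \<in> nb (n + k) E"
  obtain w where w: "w \<in> cov (n + k) E" "off w = fst E - rho ^ (n + k) * v'" using nbD[OF v'] .
  then have "w \<in> words (n + k)" by (simp add: cov_def)
  then obtain u t where ut: "u \<in> words n" "t \<in> words k" "w = u @ t" using words_split by blast
  have o: "off w = off u + rho ^ n * off t" using ut words_length[of u n] by (simp add: off_append)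
  have "u \<in> cov n D" using cov_take[OF assms] ut w by blast
  then have "(fst D - off u) / rho ^ n \<in> nb n D" by (rule cov_nb)
  moreover have "rho ^ k * v' = (fst E - fst D) / rho ^ n + (fst D - off u) / rho ^ n - off t"
    using o w(2) by (simp add: field_simps power_add)
  ultimately show ?R using nb_bounds[OF v'] ut(2) by blast
next
  assume ?R
  then obtain v t where R: "0 \<le> v'" "v' + norm_length (n + k) E \<le> 1" "v \<in> nb n D" "t \<in> words k"
    "rho ^ k * v' = (fst E - fst D) / rho ^ n + v - off t" by blast
  obtain u where u: "u \<in> cov n D" "off u = fst D - rho ^ n * v" using nbD[OF R(3)] .
  then have uw: "u \<in> words n" by (simp add: cov_def)
  have "rho ^ n * (rho ^ k * v') = fst E - fst D + rho ^ n * v - rho ^ n * off t"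
    using R(5) by (simp add: field_simps)
  then have o: "off (u @ t) = fst E - rho ^ (n + k) * v'"
    using u words_length[OF uw] by (simp add: off_append power_add algebra_simps)
  have "0 \<le> rho ^ (n + k) * v'" using R(1) by simp
  moreover have "rho ^ (n + k) * (v' + norm_length (n + k) E) \<le> rho ^ (n + k) * 1"
    using R(2) by (intro mult_left_mono) auto
  ultimately have "u @ t \<in> cov (n + k) E"
    using words_append[OF uw R(4)] o snd_eq[of E "n + k"] by (auto simp: cov_def algebra_simps)
  moreover have "v' = (fst E - off (u @ t)) / rho ^ (n + k)" using o by simp
  ultimately show "v' \<in> nb (n + k) E" unfolding nb_def by blast
qed

lemma sim_endpoints:
  assumes "sim n D n' D'" "fst D \<le> x" "x \<le> snd D"
  shows "emb n D n' D' x \<in> endpoints (n' + k) \<longleftrightarrow> x \<in> endpoints (n + k)"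
proof -
  have D: "D \<in> net_intervals n" "D' \<in> net_intervals n'" "nb n' D' = nb n D" using assms by (auto simp: sim_def)
  have e: "fst D \<in> endpoints (n + k)" "snd D \<in> endpoints (n + k)" "fst D' \<in> endpoints (n' + k)" "snd D' \<in> endpoints (n' + k)"
    using netD(1,2)[OF D(1)] netD(1,2)[OF D(2)] endpoints_mono_add[of n k] endpoints_mono_add[of n' k] by auto
  \<comment> \<open>The description by neighbours is available inside \<open>D\<close> only; the
    ends of \<open>D\<close> are endpoints at every deeper level.\<close>
  consider "x = fst D" | "x = snd D" | "fst D < x" "x < snd D" using assms by linarith
  then show ?thesis
  proof cases
    case 3
    have eq: "emb n D n' D' x = fst D' - rho ^ n' * v + rho ^ n' * t \<longleftrightarrow> x = fst D - rho ^ n * v + rho ^ n * t" for v t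
      by (metis emb_rel emb_inv)
    show ?thesis
      using endpoints_rel[OF D(1) 3, of k] emb_between[OF assms(1) 3]
        endpoints_rel[OF D(2), of "emb n D n' D' x" k] by (simp add: D(3) eq)
  qed (use e emb_snd[OF assms(1)] in auto)
qed

lemma sim_K:
  assumes "sim n D n' D'" "fst D < x" "x < snd D"
  shows "emb n D n' D' x \<in> K \<longleftrightarrow> x \<in> K"
proof -
  have D: "D \<in> net_intervals n" "D' \<in> net_intervals n'" "nb n' D' = nb n D" using assms by (auto simp: sim_def)
  have eq: "emb n D n' D' x = fst D' - rho ^ n' * v + rho ^ n' * t \<longleftrightarrow> x = fst D - rho ^ n * v + rho ^ n * t" for v t
    by (metis emb_rel emb_inv)
  show ?thesis
    using K_rel[OF D(1) assms(2,3)] emb_between[OF assms] K_rel[OF D(2), of "emb n D n' D' x"] by (simp add: D(3) eq)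
qed

lemma sim_desc_net:
  assumes "sim n D n' D'" "E \<in> net_intervals (n + k)" "sub E D"
  shows "embI n D n' D' E \<in> net_intervals (n' + k)" "sub (embI n D n' D' E) D'"
proof -
  note E = netD[OF assms(2)]
  show s: "sub (embI n D n' D' E) D'"
    using assms(3) emb_snd[OF assms(1)] emb_le[of n D n' D' "fst D" "fst E"] emb_le[of n D n' D' "snd E" "snd D"]
    by auto
  show "embI n D n' D' E \<in> net_intervals (n' + k)"
  proof (rule netI)
    show "emb n D n' D' (fst E) \<in> endpoints (n' + k)" "emb n D n' D' (snd E) \<in> endpoints (n' + k)"
      using sim_endpoints[OF assms(1)] E assms(3) by auto
    show "emb n D n' D' (fst E) < emb n D n' D' (snd E)" using E by simp
    show "{emb n D n' D' (fst E)<..<emb n D n' D' (snd E)} \<inter> endpoints (n' + k) = {}"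
    proof (rule ccontr)
      assume "{emb n D n' D' (fst E)<..<emb n D n' D' (snd E)} \<inter> endpoints (n' + k) \<noteq> {}"
      then obtain y where y: "emb n D n' D' (fst E) < y" "y < emb n D n' D' (snd E)" "y \<in> endpoints (n' + k)" by auto
      define x where "x = emb n' D' n D y"
      have xy: "y = emb n D n' D' x" by (simp add: x_def)
      have "fst E < x" "x < snd E" using y unfolding xy by simp_all
      then have "x \<in> endpoints (n + k)"
        using y(3) assms(3) sim_endpoints[OF assms(1), of x k] unfolding xy by simp
      then show False using E(4) \<open>fst E < x\<close> \<open>x < snd E\<close> by auto
    qed
    obtain x where x: "x \<in> K" "fst E < x" "x < snd E" using E(5) by auto
    then have "emb n D n' D' x \<in> K" using sim_K[OF assms(1), of x] assms(3) by simp
    then show "{emb n D n' D' (fst E)<..<emb n D n' D' (snd E)} \<inter> K \<noteq> {}"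
      using x by (intro notI) (force simp: disjoint_iff)
  qed
qed

lemma norm_length_emb: "norm_length (n' + k) (embI n D n' D' E) = norm_length (n + k) E"
  by (simp add: norm_length_def emb_def power_add field_simps)

lemma sim_desc:
  assumes "sim n D n' D'" "E \<in> net_intervals (n + k)" "sub E D"
  shows "sim (n + k) E (n' + k) (embI n D n' D' E)"
proof -
  have D: "D \<in> net_intervals n" "D' \<in> net_intervals n'" "nb n' D' = nb n D" using assms by (auto simp: sim_def)
  note E' = sim_desc_net[OF assms]
  have "(emb n D n' D' (fst E) - fst D') / rho ^ n' = (fst E - fst D) / rho ^ n"
    by (simp add: emb_def field_simps)
  then have "nb (n + k) E = nb (n' + k) (embI n D n' D' E)"
    unfolding set_eq_iff nb_rel[OF D(1) assms(2,3)] nb_rel[OF D(2) E'] norm_length_emb D(3) by simp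
  then show ?thesis using assms E' by (simp add: sim_def norm_length_emb)
qed

text \<open>Restricted to a descendant and its image the embedding is again the canonical one, so
  transport in several stages is consistent.\<close>

lemma emb_emb: "emb (n + k) E (n' + k) (embI n D n' D' E) = emb n D n' D'"
  by (rule ext) (simp add: emb_def power_add field_simps)

lemma sim_parent:
  assumes "sim n D n' D'" "parent n D E" shows "parent n' D' (embI n D n' D' E)"
  using assms sim_desc_net[OF assms(1), of E 1] by (auto simp: parent_iff sim_def)

section \<open>Positions and characteristic vectors of descendants\<close>

lemma position_Suc:
  assumes "parent n D E"
  shows "position (Suc n) E = Suc (card {F. parent n D F \<and> fst F < fst E \<and> norm_length (Suc n) F = norm_length (Suc n) E})"
proof -
  have "{F \<in> net_intervals (Suc n). fst F < fst E \<and> norm_length (Suc n) F = norm_length (Suc n) E \<and>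
     (\<exists>k D'. Suc n = Suc k \<and> parent k D' E \<and> parent k D' F)} =
     {F. parent n D F \<and> fst F < fst E \<and> norm_length (Suc n) F = norm_length (Suc n) E}" (is "?A = ?B")
  proof -
    have p: "(\<exists>k D'. Suc n = Suc k \<and> parent k D' E \<and> parent k D' F) \<longleftrightarrow> parent n D F" for F
      using assms parent_unique[OF assms] by (metis nat.inject)
    have "F \<in> net_intervals (Suc n) \<and> parent n D F \<longleftrightarrow> parent n D F" for F by (auto simp: parent_iff)
    then show ?thesis unfolding p by (intro Collect_cong) metis
  qed
  then show ?thesis by (simp add: position_def)
qed

text \<open>The embedding is an increasing bijection between the children that keeps normalized
  lengths, so the sets counted by the two positions correspond.\<close>

lemma sim_position_child:
  assumes "sim n D n' D'" "parent n D E"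
  shows "position (Suc n') (embI n D n' D' E) = position (Suc n) E"
proof -
  have nl: "norm_length (Suc n') (embI n D n' D' F) = norm_length (Suc n) F" for F
    using norm_length_emb[of n' 1 n D D' F] by simp
  have nl': "norm_length (Suc n) (embI n' D' n D F) = norm_length (Suc n') F" for F
    using norm_length_emb[of n 1 n' D' D F] by simp
  have "bij_betw (embI n D n' D')
     {F. parent n D F \<and> fst F < fst E \<and> norm_length (Suc n) F = norm_length (Suc n) E}
     {F. parent n' D' F \<and> fst F < fst (embI n D n' D' E) \<and> norm_length (Suc n') F = norm_length (Suc n') (embI n D n' D' E)}"
  proof (rule bij_betw_byWitness[where f' = "embI n' D' n D"])
    show "embI n' D' n D ` {F. parent n' D' F \<and> fst F < fst (embI n D n' D' E) \<and> norm_length (Suc n') F = norm_length (Suc n') (embI n D n' D' E)}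
       \<subseteq> {F. parent n D F \<and> fst F < fst E \<and> norm_length (Suc n) F = norm_length (Suc n) E}"
    proof clarify
      fix a b assume p: "parent n' D' (a, b)" "fst (a, b) < fst (embI n D n' D' E)"
        "norm_length (Suc n') (a, b) = norm_length (Suc n') (embI n D n' D' E)"
      have "emb n' D' n D a < fst E" using p(2) by (metis emb_inv emb_less fst_conv)
      then show "parent n D (embI n' D' n D (a, b)) \<and> fst (embI n' D' n D (a, b)) < fst E \<and>
        norm_length (Suc n) (embI n' D' n D (a, b)) = norm_length (Suc n) E"
        using sim_parent[OF sim_sym[OF assms(1)] p(1)] p(3) nl[of E] nl'[of "(a, b)"] by simp
    qed
  qed (use sim_parent[OF assms(1)] nl in auto)
  then show ?thesis
    by (simp only: position_Suc[OF assms(2)] position_Suc[OF sim_parent[OF assms]] bij_betw_same_card)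
qed

lemma net_parent:
  assumes "D \<in> net_intervals n" "E \<in> net_intervals (n + Suc k)" "sub E D"
  obtains P where "parent (n + k) P E" "P \<in> net_intervals (n + k)" "sub P D"
proof -
  obtain P where P: "P \<in> net_intervals (n + k)" "sub E P" using net_ancestor[of E "n + k" 1] assms(2) by auto
  have "sub P D" using net_subset[OF assms(1) P(1)] P(2) assms(3) netD(3)[OF assms(2)] by linarith
  with P assms that show ?thesis by (auto simp: parent_iff)
qed

lemma sim_position:
  assumes "sim n D n' D'" "E \<in> net_intervals (n + Suc k)" "sub E D"
  shows "position (n' + Suc k) (embI n D n' D' E) = position (n + Suc k) E"
proof -
  have D: "D \<in> net_intervals n" using assms by (auto simp: sim_def)
  obtain P where P: "parent (n + k) P E" "P \<in> net_intervals (n + k)" "sub P D"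
    using net_parent[OF D assms(2,3)] .
  show ?thesis
    using sim_position_child[OF sim_desc[OF assms(1) P(2,3)] P(1)] by (simp add: emb_emb)
qed

lemma char_vector_eq_iff:
  assumes "D \<in> net_intervals n" "D' \<in> net_intervals n'"
  shows "char_vector n D = char_vector n' D' \<longleftrightarrow> sim n D n' D' \<and> position n D = position n' D'"
  using assms by (auto simp: char_vector_def sim_def neighbours_eq_iff)

text \<open>Similarity controls proper descendants only, hence \<open>Suc k\<close>: the position of
  \<open>D\<close> itself is decided outside \<open>D\<close>.\<close>

lemma sim_char_vector:
  assumes "sim n D n' D'" "E \<in> net_intervals (n + Suc k)" "sub E D"
  shows "char_vector (n' + Suc k) (embI n D n' D' E) = char_vector (n + Suc k) E"
  using char_vector_eq_iff[of E "n + Suc k" "embI n D n' D' E" "n' + Suc k"]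
    sim_desc_net[OF assms] sim_desc[OF assms] sim_position[OF assms] assms by simp

text \<open>Among the children of one length the position strictly increases from left to right,
  since the counted sets are strictly nested.\<close>

lemma child_unique:
  assumes "parent n D E" "parent n D F" "char_vector (Suc n) E = char_vector (Suc n) F"
  shows "E = F"
proof -
  have *: "False" if "parent n D E" "parent n D F" "char_vector (Suc n) E = char_vector (Suc n) F" "fst E < fst F" for E F
  proof -
    let ?A = "\<lambda>E. {G. parent n D G \<and> fst G < fst E \<and> norm_length (Suc n) G = norm_length (Suc n) E}"
    have "norm_length (Suc n) E = norm_length (Suc n) F" "position (Suc n) E = position (Suc n) F"
      using that by (auto simp: char_vector_def)
    then have "?A E \<subset> ?A F" "card (?A E) = card (?A F)"
      subgoal
        using that(1,4) by (intro psubsetI) auto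
      using position_Suc[OF that(1)] position_Suc[OF that(2)] \<open>position (Suc n) E = position (Suc n) F\<close> by linarith
    moreover have "finite (?A F)" by (rule finite_subset[OF _ finite_net[of "Suc n"]]) (auto simp: parent_iff)
    ultimately show False using psubset_card_mono[of "?A F" "?A E"] by linarith
  qed
  have "fst E = fst F" using *[of E F] *[of F E] assms by (metis less_linear)
  moreover have "E \<in> net_intervals (Suc n)" "F \<in> net_intervals (Suc n)" using assms(1,2) by (simp_all only: parent_iff)
  ultimately show ?thesis using netD(3)[of E "Suc n"] netD(3)[of F "Suc n"]
    by (intro net_eqI[of E "Suc n" F]) linarith+
qed

text \<open>This is what makes a transition matrix depend on the two characteristic vectors only:
  any two realizations of the pair differ by an embedding.\<close>

lemma parent_transfer:
  assumes "parent n D E" "parent n' D' E'" "char_vector n D = char_vector n' D'" "char_vector (Suc n) E = char_vector (Suc n') E'"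
  shows "sim n D n' D'" "E' = embI n D n' D' E"
proof -
  have D: "D \<in> net_intervals n" "D' \<in> net_intervals n'" "E \<in> net_intervals (Suc n)" "sub E D"
    using assms(1,2) by (simp_all only: parent_iff)
  show s: "sim n D n' D'" using char_vector_eq_iff[OF D(1,2)] assms by simp
  have "char_vector (Suc n') (embI n D n' D' E) = char_vector (Suc n) E"
    using sim_char_vector[OF s, of E 0] D by simp
  then show "E' = embI n D n' D' E"
    using child_unique[OF assms(2) sim_parent[OF s assms(1)]] assms(4) by metis
qed

end

subsection \<open>Finite type and the essential class\<close>

declare split_paired_Ex [simp del] split_paired_All [simp del]

context ifs
begin

text \<open>The image of \<open>E\<close> under \<open>S_word w\<close>. In general it need not be a
  net interval, since other words can place endpoints inside it.\<close>

definition shiftI :: "nat list \<Rightarrow> net_interval \<Rightarrow> net_interval" where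
  "shiftI w E = (off w + rho ^ length w * fst E, off w + rho ^ length w * snd E)"

lemma shift_endpoints:
  assumes "w \<in> words k" "y \<in> endpoints n" shows "off w + rho ^ k * y \<in> endpoints (k + n)"
proof -
  obtain u where u: "u \<in> words n" "y = off u \<or> y = off u + rho ^ n" using assms(2) by (auto simp: endpoints_iff)
  have "w @ u \<in> words (k + n)" "off (w @ u) = off w + rho ^ k * off u"
    using words_append[OF assms(1) u(1)] words_length[OF assms(1)] by (simp_all add: off_append)
  moreover from this have "off w + rho ^ k * y = off (w @ u) \<or> off w + rho ^ k * y = off (w @ u) + rho ^ (k + n)"
    using u(2) by (auto simp: algebra_simps power_add)
  ultimately show ?thesis unfolding endpoints_iff by metis
qed

text \<open>A point of \<open>K\<close> in the interval that is no endpoint lies inside some net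
  interval, which cannot extend across the endpoints \<open>a\<close> and \<open>b\<close>.\<close>

lemma net_in_ivl:
  assumes "z \<in> K" "a < z" "z < b" "a \<in> endpoints n" "b \<in> endpoints n"
  obtains E where "E \<in> net_intervals n" "a \<le> fst E" "snd E \<le> b"
proof -
  have "infinite (K \<inter> {a<..<b} - endpoints n)" using infinite_K_ivl[OF assms(1-3)] by simp
  then obtain y where y: "y \<in> K" "a < y" "y < b" "y \<notin> endpoints n"
    using infinite_imp_nonempty by (metis DiffE IntE ex_in_conv greaterThanLessThan_iff)
  obtain E where E: "E \<in> net_intervals n" "fst E \<le> y" "y \<le> snd E" using net_point[OF y(1)] .
  have "y \<noteq> fst E" "y \<noteq> snd E" using netD(1,2)[OF E(1)] y(4) by metis+
  then have "fst E < y" "y < snd E" using E by simp_all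
  moreover have "a \<notin> {fst E<..<snd E}" "b \<notin> {fst E<..<snd E}" using netD(4)[OF E(1)] assms(4,5) by blast+
  ultimately have "a \<le> fst E" "snd E \<le> b" using y by auto
  with E(1) that show ?thesis by blast
qed

text \<open>Minimizing first the normalized length and then maximizing the number of neighbours forces all
  images of \<open>D\<close> under the maps of the iterated function system to be net intervals of the same type. This
  produces the essential class, and its uniqueness.\<close>

definition core :: "nat \<Rightarrow> net_interval \<Rightarrow> bool" where
  "core n D \<longleftrightarrow> D \<in> net_intervals n \<and> (\<forall>k. \<forall>w\<in>words k. sim n D (k + n) (shiftI w D))"

definition net_types :: "(real \<times> real set) set" where
  "net_types = {(norm_length n D, nb n D) | n D. D \<in> net_intervals n}"

lemma net_typesI: "D \<in> net_intervals n \<Longrightarrow> (norm_length n D, nb n D) \<in> net_types"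
  by (auto simp: net_types_def)

text \<open>Measured from a word covering \<open>D\<close>, both ends of \<open>D\<close> have
  normalized distances in one finite set; the length is a difference of two of them, and the
  neighbours are such distances.\<close>

lemma finite_net_types:
  assumes finite_type shows "finite net_types"
proof -
  obtain F where F: "finite F" "\<And>n v w. n \<ge> 1 \<Longrightarrow> v \<in> words n \<Longrightarrow> w \<in> words n \<Longrightarrow>
     \<bar>off v - off w\<bar> / rho ^ n > 1 \<or> (off v - off w) / rho ^ n \<in> F"
    using assms unfolding finite_type_def by blast
  \<comment> \<open>The 0 accounts for level 0, about which the finite type condition says nothing;
    the shift by 1 accounts for right ends of word intervals.\<close>
  define G where "G = insert 0 F \<union> (\<lambda>x. x + 1) ` insert 0 F"
  have finG: "finite G" using F(1) by (simp add: G_def)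
  have FG: "(off v - off w) / rho ^ n \<in> insert 0 F" if vw: "v \<in> words n" "w \<in> words n" "\<bar>off v - off w\<bar> \<le> rho ^ n" for v w n
  proof (cases "n = 0")
    case False
    have "\<bar>off v - off w\<bar> / rho ^ n \<le> 1" using vw(3) by simp
    then show ?thesis using F(2)[OF _ vw(1,2)] False by fastforce
  qed (use vw(1,2) in simp)
  have G: "(y - off w) / rho ^ n \<in> G" if y: "w \<in> words n" "y \<in> endpoints n" "off w \<le> y" "y \<le> off w + rho ^ n" for w n y
  proof -
    obtain v where v: "v \<in> words n" "y = off v \<or> y = off v + rho ^ n" using y(2) by (auto simp: endpoints_iff)
    have "(off v - off w) / rho ^ n \<in> insert 0 F"
      using v(2) y(3,4) by (intro FG[OF v(1) y(1)]) (auto simp: abs_if)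
    moreover have "(off v + rho ^ n - off w) / rho ^ n = (off v - off w) / rho ^ n + 1"
      by (simp add: field_simps)
    ultimately show ?thesis unfolding G_def using v(2) by auto
  qed
  have "net_types \<subseteq> (\<lambda>(x, y). x - y) ` (G \<times> G) \<times> Pow G"
  proof
    fix t assume "t \<in> net_types"
    then obtain n D where D: "D \<in> net_intervals n" "t = (norm_length n D, nb n D)" by (auto simp: net_types_def)
    have c: "(fst D - off w) / rho ^ n \<in> G \<and> (snd D - off w) / rho ^ n \<in> G" if "w \<in> cov n D" for w
      using that netD(1,2,3)[OF D(1)] G[of w n "fst D"] G[of w n "snd D"] by (auto simp: cov_def)
    obtain w where "w \<in> cov n D" using cov_nonempty[OF D(1)] by auto
    moreover have "norm_length n D = (snd D - off w) / rho ^ n - (fst D - off w) / rho ^ n" for w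
      by (simp add: norm_length_def field_simps)
    ultimately have "norm_length n D \<in> (\<lambda>(x, y). x - y) ` (G \<times> G)" using c by force
    moreover have "nb n D \<subseteq> G" using c by (auto simp: nb_def)
    ultimately show "t \<in> (\<lambda>(x, y). x - y) ` (G \<times> G) \<times> Pow G" using D(2) by simp
  qed
  then show ?thesis using finG by (meson finite_subset finite_SigmaI finite_imageI finite_Pow_iff)
qed

lemma core_exists:
  assumes finite_type obtains n D where "core n D"
proof -
  have fin: "finite net_types" using finite_net_types[OF assms] .
  have ne: "net_types \<noteq> {}" using net_typesI[of "(0,1)" 0] net_intervals_0 by auto
  define l where "l = Min (fst ` net_types)"
  have l: "l \<le> norm_length n D" if "D \<in> net_intervals n" for n D
    using net_typesI[OF that] fin unfolding l_def by (intro Min_le) force+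
  define T where "T = {t \<in> net_types. fst t = l}"
  have "l \<in> fst ` net_types" using fin ne by (simp add: l_def)
  then have "T \<noteq> {}" "finite T" using fin by (auto simp: T_def)
  then have "Max ((card \<circ> snd) ` T) \<in> (card \<circ> snd) ` T" by (intro Max_in) auto
  then obtain t where t: "t \<in> T" "card (snd t) = Max ((card \<circ> snd) ` T)" by auto
  then obtain n D where D: "D \<in> net_intervals n" "norm_length n D = l" "t = (l, nb n D)"
    by (auto simp: T_def net_types_def)
  have mx: "card (nb k E) \<le> card (nb n D)" if "E \<in> net_intervals k" "norm_length k E = l" for k E
  proof -
    have "(l, nb k E) \<in> T" using net_typesI[OF that(1)] that(2) by (simp add: T_def)
    then have "(card \<circ> snd) (l, nb k E) \<le> Max ((card \<circ> snd) ` T)" using \<open>finite T\<close> by (intro Max_ge finite_imageI imageI)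
    then show ?thesis using t(2) D(3) by simp
  qed
  have "sim n D (k + n) (shiftI w D)" if w: "w \<in> words k" for k w
  proof -
    note N = netD[OF D(1)] and lw = words_length[OF w]
    have e: "fst (shiftI w D) \<in> endpoints (k + n)" "snd (shiftI w D) \<in> endpoints (k + n)"
      using shift_endpoints[OF w N(1)] shift_endpoints[OF w N(2)] lw by (simp_all add: shiftI_def)
    obtain x where x: "x \<in> K" "fst D < x" "x < snd D" using N(5) by auto
    obtain E where E: "E \<in> net_intervals (k + n)" "fst (shiftI w D) \<le> fst E" "snd E \<le> snd (shiftI w D)"
      by (rule net_in_ivl[OF word_point_K[OF w x(1)] _ _ e]) (use x lw in \<open>auto simp: shiftI_def\<close>)
    have nl: "norm_length (k + n) (shiftI w D) = l"
      unfolding D(2)[symmetric] using lw by (simp add: shiftI_def norm_length_def field_simps power_add)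
    \<comment> \<open>The image of \<open>D\<close> has the minimal normalized length, so a net
      interval contained in it must be all of it.\<close>
    have "rho ^ (k + n) * l \<le> rho ^ (k + n) * norm_length (k + n) E"
      using l[OF E(1)] by (intro mult_left_mono) auto
    then have "snd (shiftI w D) - fst (shiftI w D) \<le> snd E - fst E"
      using snd_eq[of E "k + n"] snd_eq[of "shiftI w D" "k + n"] nl by simp
    then have "E = shiftI w D" using E by (simp add: prod_eq_iff)
    then have net: "shiftI w D \<in> net_intervals (k + n)" using E by simp
    \<comment> \<open>Prefixing \<open>w\<close> turns a word covering \<open>D\<close> into one
      covering the image, with the same normalized offset; maximality of the number of neighbours
      then excludes further ones.\<close>
    have "nb n D \<subseteq> nb (k + n) (shiftI w D)"
    proof
      fix v assume "v \<in> nb n D"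
      then obtain u where u: "u \<in> cov n D" "off u = fst D - rho ^ n * v" by (rule nbD)
      then have uw: "u \<in> words n" by (simp add: cov_def)
      have o: "off (w @ u) = off w + rho ^ k * off u" using lw by (simp add: off_append)
      have "rho ^ k * off u \<le> rho ^ k * fst D" "rho ^ k * snd D \<le> rho ^ k * (off u + rho ^ n)"
        using u(1) by (auto simp: cov_def)
      then have "w @ u \<in> cov (k + n) (shiftI w D)"
        using words_append[OF w uw] o lw by (simp add: cov_def shiftI_def power_add algebra_simps)
      moreover have "v = (fst (shiftI w D) - off (w @ u)) / rho ^ (k + n)"
        using o u(2) lw by (simp add: shiftI_def power_add field_simps)
      ultimately show "v \<in> nb (k + n) (shiftI w D)" unfolding nb_def by blast
    qed
    then have "nb n D = nb (k + n) (shiftI w D)" using mx[OF net nl] by (intro card_seteq) auto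
    then show ?thesis using net nl D by (simp add: sim_def)
  qed
  then have "core n D" using D(1) by (simp add: core_def)
  then show ?thesis by (rule that)
qed

section \<open>Descendants and reachability between characteristic vectors\<close>

lemma desc_reach:
  assumes "D \<in> net_intervals n" "E \<in> net_intervals (n + k)" "sub E D"
  shows "child_vec\<^sup>*\<^sup>* (char_vector n D) (char_vector (n + k) E)"
  using assms(2,3)
proof (induction k arbitrary: E)
  case 0
  then have "E = D" using netD(3)[of E n] netD(3)[OF assms(1)] assms(1) by (intro net_eqI[of E n D]) auto
  then show ?case by simp
next
  case (Suc k)
  obtain P where P: "parent (n + k) P E" "P \<in> net_intervals (n + k)" "sub P D"
    using net_parent[OF assms(1) Suc.prems] .
  have "child_vec (char_vector (n + k) P) (char_vector (n + Suc k) E)"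
    unfolding child_vec_def using P(1) by (metis add_Suc_right)
  then show ?case using Suc.IH[OF P(2,3)] by simp
qed

text \<open>The pair witnessing \<open>child_vec\<close> may live anywhere; its embedding moves the
  child below the given \<open>D\<close>.\<close>

lemma child_vec_lift:
  assumes "child_vec (char_vector n D) \<beta>" "D \<in> net_intervals n"
  obtains E where "parent n D E" "char_vector (Suc n) E = \<beta>"
proof -
  obtain k P Q where P: "parent k P Q" "char_vector k P = char_vector n D" "char_vector (Suc k) Q = \<beta>"
    using assms(1) by (auto simp: child_vec_def)
  have PQ: "P \<in> net_intervals k" "Q \<in> net_intervals (k + Suc 0)" "sub Q P" using P(1) by (simp_all add: parent_iff)
  have s: "sim k P n D" using char_vector_eq_iff[OF PQ(1) assms(2)] P by simp
  show ?thesis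
    using that[OF sim_parent[OF s P(1)]] sim_char_vector[OF s PQ(2,3)] P(3) by simp
qed

lemma reach_desc:
  assumes "child_vec\<^sup>*\<^sup>* (char_vector n D) \<beta>" "D \<in> net_intervals n"
  obtains k E where "E \<in> net_intervals (n + k)" "sub E D" "char_vector (n + k) E = \<beta>"
proof -
  have "\<exists>k E. E \<in> net_intervals (n + k) \<and> sub E D \<and> char_vector (n + k) E = \<beta>"
    using assms(1)
  proof (induction rule: rtranclp_induct)
    case base
    show ?case using assms(2) by (intro exI[of _ 0] exI[of _ D]) auto
  next
    case (step \<beta> \<gamma>)
    then obtain k E where E: "E \<in> net_intervals (n + k)" "sub E D" "char_vector (n + k) E = \<beta>" by blast
    then obtain E' where E': "parent (n + k) E E'" "char_vector (Suc (n + k)) E' = \<gamma>"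
      using child_vec_lift step by metis
    have "E' \<in> net_intervals (n + Suc k)" "sub E' D" using E' E by (auto simp: parent_iff)
    then show ?case using E'(2) by (intro exI[of _ "Suc k"] exI[of _ E']) auto
  qed
  then show ?thesis using that by blast
qed

lemma char_vector_in_Omega: "D \<in> net_intervals n \<Longrightarrow> char_vector n D \<in> Omega"
  by (auto simp: Omega_def)

lemma child_vec_Omega: "child_vec \<alpha> \<beta> \<Longrightarrow> \<alpha> \<in> Omega \<and> \<beta> \<in> Omega"
  by (auto simp: child_vec_def parent_def intro!: char_vector_in_Omega)

lemma reach_path:
  assumes "child_vec\<^sup>*\<^sup>* \<alpha> \<beta>" "\<alpha> \<in> Omega"
  shows "\<exists>\<gamma>. admissible_path \<gamma> \<and> hd \<gamma> = \<alpha> \<and> last \<gamma> = \<beta> \<and> set \<gamma> \<subseteq> {\<delta>. child_vec\<^sup>*\<^sup>* \<alpha> \<delta>}"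
  using assms(1)
proof (induction rule: rtranclp_induct)
  case base
  show ?case using assms(2) by (intro exI[of _ "[\<alpha>]"]) (simp add: admissible_path_def)
next
  case (step \<beta> \<delta>)
  then obtain \<gamma> where g: "admissible_path \<gamma>" "hd \<gamma> = \<alpha>" "last \<gamma> = \<beta>" "set \<gamma> \<subseteq> {\<delta>. child_vec\<^sup>*\<^sup>* \<alpha> \<delta>}" by blast
  have "child_vec\<^sup>*\<^sup>* \<alpha> \<delta>" using step by simp
  then show ?case using g step child_vec_Omega[of \<beta> \<delta>]
    by (intro exI[of _ "\<gamma> @ [\<delta>]"]) (auto simp: admissible_path_def successively_append_iff)
qed

lemma path_reach:
  assumes "successively child_vec \<gamma>" "\<gamma> \<noteq> []" shows "child_vec\<^sup>*\<^sup>* (hd \<gamma>) (last \<gamma>)"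
  using assms
proof (induction \<gamma>)
  case (Cons a \<gamma>)
  then show ?case
    by (cases \<gamma>) (auto intro: converse_rtranclp_into_rtranclp)
qed simp

end

text \<open>\<open>R\<close> is a child of the core and not the core itself: similarity leaves open
  the position of an image of the core but fixes the positions of its children. So all images of
  \<open>R\<close> under words have one characteristic vector, \<open>alpha\<close>.\<close>

locale ft_ifs = ifs m rho d K for m rho d K +
  fixes n0 :: nat and R0 :: net_interval and nR :: nat and R :: net_interval
  assumes ft: finite_type and core: "core n0 R0" and nR: "nR = Suc n0" and R: "parent n0 R0 R"
begin

lemma R_net: "R \<in> net_intervals nR" and R0_net: "R0 \<in> net_intervals n0" and R_sub: "sub R R0"
  using R by (simp_all add: parent_iff nR)

definition alpha :: char_vec where "alpha = char_vector nR R"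

lemma shift_R:
  assumes "w \<in> words k"
  shows "shiftI w R \<in> net_intervals (k + nR)" "char_vector (k + nR) (shiftI w R) = alpha" "sim nR R (k + nR) (shiftI w R)"
proof -
  have s: "sim n0 R0 (k + n0) (shiftI w R0)" using core assms by (simp add: core_def)
  have "emb n0 R0 (k + n0) (shiftI w R0) x = off w + rho ^ k * x" for x
    using words_length[OF assms] by (simp add: emb_def shiftI_def field_simps power_add)
  then have e: "embI n0 R0 (k + n0) (shiftI w R0) R = shiftI w R"
    using words_length[OF assms] by (simp add: shiftI_def)
  have R': "R \<in> net_intervals (n0 + Suc 0)" "sub R R0" using R_net R_sub by (simp_all add: nR)
  show "shiftI w R \<in> net_intervals (k + nR)" "char_vector (k + nR) (shiftI w R) = alpha" "sim nR R (k + nR) (shiftI w R)"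
    using sim_desc_net[OF s R'] sim_char_vector[OF s R'] sim_desc[OF s R'] unfolding e alpha_def by (simp_all add: nR)
qed

text \<open>Every neighbour of the image of \<open>R\<close> under \<open>w\<close> is realized by a
  word that begins with \<open>w\<close>. Hence an image of \<open>R\<close> below a word that
  passes through a given neighbour is fully linked to that neighbour.\<close>

lemma shift_R_nb:
  assumes "w \<in> words k" "v \<in> nb nR R"
  obtains u where "u \<in> words nR" "off (w @ u) = fst (shiftI w R) - rho ^ (k + nR) * v"
proof -
  obtain u where u: "u \<in> cov nR R" "off u = fst R - rho ^ nR * v" using nbD[OF assms(2)] .
  have "off (w @ u) = off w + rho ^ k * (fst R - rho ^ nR * v)"
    using u(2) words_length[OF assms(1)] by (simp add: off_append)
  also have "\<dots> = fst (shiftI w R) - rho ^ (k + nR) * v"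
    using words_length[OF assms(1)] by (simp add: shiftI_def power_add algebra_simps)
  finally show ?thesis using that[of u] u(1) by (simp add: cov_def)
qed

lemma shift_R_bounds:
  assumes "w \<in> words k" shows "off w \<le> fst (shiftI w R)" "snd (shiftI w R) \<le> off w + rho ^ k"
  using netD(6,7)[OF R_net] words_length[OF assms] by (simp_all add: shiftI_def mult_left_le)

text \<open>A long word has its whole interval inside \<open>D\<close>, and that interval contains
  the image of \<open>R\<close>.\<close>

lemma alpha_descendant:
  assumes "D \<in> net_intervals n"
  obtains k E where "E \<in> net_intervals (n + k)" "sub E D" "char_vector (n + k) E = alpha"
proof -
  obtain x where x: "x \<in> K" "fst D < x" "x < snd D" using netD(5)[OF assms] by auto
  define e where "e = min (x - fst D) (snd D - x)"
  have "0 < e" using x by (simp add: e_def)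
  then obtain N where N: "\<And>n. n \<ge> N \<Longrightarrow> \<exists>w\<in>words n. x \<in> S_word w ` K \<and> {off w..off w + rho ^ n} \<subseteq> {x - e<..<x + e}"
    using word_near[OF x(1)] by metis
  define k where "k = n + N"
  obtain w where w: "w \<in> words k" "{off w..off w + rho ^ k} \<subseteq> {x - e<..<x + e}" using N[of k] by (auto simp: k_def)
  have "off w \<in> {off w..off w + rho ^ k}" "off w + rho ^ k \<in> {off w..off w + rho ^ k}" by simp_all
  then have "off w \<in> {x - e<..<x + e}" "off w + rho ^ k \<in> {x - e<..<x + e}" using w(2) by blast+
  then have "fst D < off w" "off w + rho ^ k < snd D" by (auto simp: e_def)
  then have "sub (shiftI w R) D" using shift_R_bounds[OF w(1)] by simp
  moreover have "k + nR = n + (N + nR)" by (simp add: k_def)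
  ultimately show ?thesis using that[of "shiftI w R" "N + nR"] shift_R(1,2)[OF w(1)] by (simp only:)
qed

text \<open>Every characteristic vector reaches \<open>alpha\<close>. So the vectors reachable from
  \<open>alpha\<close> form a loop class closed under children, and every essential class contains
  \<open>alpha\<close> and therefore equals it.\<close>

lemma Omega0_eq: "Omega0 = {\<beta>. child_vec\<^sup>*\<^sup>* alpha \<beta>}"
proof -
  let ?V = "{\<beta>. child_vec\<^sup>*\<^sup>* alpha \<beta>}"
  have VO: "?V \<subseteq> Omega"
  proof
    fix \<beta> assume "\<beta> \<in> ?V"
    then have "child_vec\<^sup>*\<^sup>* alpha \<beta>" by simp
    then show "\<beta> \<in> Omega"
      by (induction rule: rtranclp_induct) (use char_vector_in_Omega[OF R_net] child_vec_Omega in \<open>auto simp: alpha_def\<close>)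
  qed
  have bk: "child_vec\<^sup>*\<^sup>* \<beta> alpha" if "\<beta> \<in> Omega" for \<beta>
  proof -
    obtain n D where D: "D \<in> net_intervals n" "\<beta> = char_vector n D" using \<open>\<beta> \<in> Omega\<close> by (auto simp: Omega_def)
    obtain k E where "E \<in> net_intervals (n + k)" "sub E D" "char_vector (n + k) E = alpha" using alpha_descendant[OF D(1)] .
    then show ?thesis using desc_reach[OF D(1)] D(2) by metis
  qed
  have ess: "essential_class ?V"
    unfolding essential_class_def loop_class_def
  proof (intro conjI ballI allI impI VO)
    show "?V \<noteq> {}" by blast
    fix \<alpha> \<beta> assume ab: "\<alpha> \<in> ?V" "\<beta> \<in> ?V"
    then have "\<alpha> \<in> Omega" using VO by blast
    then have "child_vec\<^sup>*\<^sup>* \<alpha> \<beta>" using bk[of \<alpha>] ab by simp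
    then obtain \<gamma> where g: "admissible_path \<gamma>" "hd \<gamma> = \<alpha>" "last \<gamma> = \<beta>" "set \<gamma> \<subseteq> {\<delta>. child_vec\<^sup>*\<^sup>* \<alpha> \<delta>}"
      using reach_path[OF _ \<open>\<alpha> \<in> Omega\<close>] by blast
    have "set \<gamma> \<subseteq> ?V" using g(4) ab(1) by (auto intro: rtranclp_trans)
    then show "\<exists>\<gamma>. admissible_path \<gamma> \<and> hd \<gamma> = \<alpha> \<and> last \<gamma> = \<beta> \<and> set \<gamma> \<subseteq> ?V" using g by blast
  qed (simp add: rtranclp.rtrancl_into_rtrancl)
  have "W = ?V" if W: "essential_class W" for W
  proof -
    have W': "W \<noteq> {}" "W \<subseteq> Omega" "\<And>\<alpha> \<beta>. \<alpha> \<in> W \<Longrightarrow> child_vec \<alpha> \<beta> \<Longrightarrow> \<beta> \<in> W"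
      "\<And>\<alpha> \<beta>. \<alpha> \<in> W \<Longrightarrow> \<beta> \<in> W \<Longrightarrow> \<exists>\<gamma>. admissible_path \<gamma> \<and> hd \<gamma> = \<alpha> \<and> last \<gamma> = \<beta> \<and> set \<gamma> \<subseteq> W"
      using W unfolding essential_class_def loop_class_def by blast+
    have cl: "\<beta> \<in> W" if "child_vec\<^sup>*\<^sup>* \<alpha> \<beta>" "\<alpha> \<in> W" for \<alpha> \<beta>
      using that by (induction rule: rtranclp_induct) (use W'(3) in blast)+
    obtain \<alpha> where "\<alpha> \<in> W" using W' by blast
    then have aW: "alpha \<in> W" using cl[OF bk] W' by blast
    then have "?V \<subseteq> W" using cl by blast
    moreover have "W \<subseteq> ?V"
    proof
      fix \<beta> assume "\<beta> \<in> W"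
      then obtain \<gamma> where "admissible_path \<gamma>" "hd \<gamma> = alpha" "last \<gamma> = \<beta>" using W'(4)[OF aW] by blast
      then show "\<beta> \<in> ?V" using path_reach[of \<gamma>] by (auto simp: admissible_path_def)
    qed
    ultimately show ?thesis by blast
  qed
  then show ?thesis unfolding Omega0_def using ess by (intro the_equality) blast+
qed

lemma alpha_in_Omega0: "alpha \<in> Omega0"
  by (simp add: Omega0_eq)

lemma essentialD:
  assumes "essential n D"
  obtains k E where "E \<in> net_intervals (nR + k)" "sub E R" "char_vector (nR + k) E = char_vector n D"
  using assms reach_desc[of nR R "char_vector n D"] R_net unfolding essential_def Omega0_eq alpha_def by blast

lemma essential_desc:
  assumes "essential n D" "E \<in> net_intervals (n + k)" "sub E D" shows "essential (n + k) E"
  using assms desc_reach[of D n E k] unfolding essential_def Omega0_eq by (auto intro: rtranclp_trans)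

lemma essential_alpha: "D \<in> net_intervals n \<Longrightarrow> char_vector n D = alpha \<Longrightarrow> essential n D"
  using alpha_in_Omega0 by (simp add: essential_def)

lemma essential_R: "essential nR R"
  using essential_alpha[OF R_net] by (simp add: alpha_def)

lemma essential_net: "essential n D \<Longrightarrow> D \<in> net_intervals n"
  by (simp add: essential_def)

lemma alpha_sim: "D \<in> net_intervals n \<Longrightarrow> char_vector n D = alpha \<Longrightarrow> sim nR R n D"
  using char_vector_eq_iff[OF R_net, of D n] by (simp add: alpha_def)

text \<open>Source of uniform constants: a bound that may be enlarged and is inherited by similar
  net intervals can be taken as the maximum over the finitely many types. Real constants are encoded
  by natural numbers to fit this form.\<close>

lemma finite_types_bound:
  fixes P :: "nat \<Rightarrow> net_interval \<Rightarrow> nat \<Rightarrow> bool"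
  assumes ex: "\<And>n D. essential n D \<Longrightarrow> \<exists>B. P n D B"
    and mono: "\<And>n D B B'. P n D B \<Longrightarrow> B \<le> B' \<Longrightarrow> P n D B'"
    and sim: "\<And>n D n' D' B. essential n D \<Longrightarrow> essential n' D' \<Longrightarrow> sim n D n' D' \<Longrightarrow> P n D B \<Longrightarrow> P n' D' B"
  obtains B where "\<And>n D. essential n D \<Longrightarrow> P n D B"
proof -
  define T where "T = {(norm_length n D, nb n D) | n D. essential n D}"
  have "T \<subseteq> net_types" by (auto simp: T_def net_types_def essential_def)
  then have finT: "finite T" using finite_net_types[OF ft] finite_subset by blast
  have "\<exists>B. \<forall>n D. essential n D \<longrightarrow> (norm_length n D, nb n D) = t \<longrightarrow> P n D B" if t: "t \<in> T" for t
  proof -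
    obtain n D where D: "essential n D" "t = (norm_length n D, nb n D)" using t by (auto simp: T_def)
    obtain B where B: "P n D B" using ex[OF D(1)] by blast
    have "P n' D' B" if e: "essential n' D'" "(norm_length n' D', nb n' D') = t" for n' D'
    proof (rule sim[OF D(1) e(1) _ B])
      show "sim n D n' D'" using D e(2) essential_net[OF D(1)] essential_net[OF e(1)] by (simp add: sim_def)
    qed
    then show ?thesis by blast
  qed
  then have "\<forall>t\<in>T. \<exists>B. \<forall>n D. essential n D \<longrightarrow> (norm_length n D, nb n D) = t \<longrightarrow> P n D B" by simp
  from bchoice[OF this] obtain f where f: "\<And>t n D. t \<in> T \<Longrightarrow> essential n D \<Longrightarrow> (norm_length n D, nb n D) = t \<Longrightarrow> P n D (f t)"
    by blast
  have "P n D (Max (f ` T))" if "essential n D" for n D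
  proof -
    have "(norm_length n D, nb n D) \<in> T" unfolding T_def using that by blast
    then have "f (norm_length n D, nb n D) \<le> Max (f ` T)" "P n D (f (norm_length n D, nb n D))"
      using f[OF _ that refl] finT by (simp_all only: Max_ge finite_imageI imageI)
    from mono[OF this(2,1)] show ?thesis .
  qed
  then show ?thesis by (rule that)
qed

lemma min_length:
  obtains l where "0 < l" "\<And>n D. D \<in> net_intervals n \<Longrightarrow> l \<le> norm_length n D"
proof -
  have fin: "finite (fst ` net_types)" using finite_net_types[OF ft] by simp
  have ne: "fst ` net_types \<noteq> {}" using net_typesI[OF R_net] by auto
  have "Min (fst ` net_types) \<in> fst ` net_types" using fin ne by simp
  then have "0 < Min (fst ` net_types)" by (auto simp: net_types_def norm_length_pos)
  moreover have "Min (fst ` net_types) \<le> norm_length n D" if "D \<in> net_intervals n" for n D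
    using fin net_typesI[OF that] by (intro Min_le) force+
  ultimately show ?thesis using that by blast
qed

end

subsection \<open>The measure of a net interval\<close>

context self_similar_measure
begin

interpretation mu: prob_space mu by (rule prob_mu)

section \<open>Weights of words and iterated self-similarity of the measure\<close>

definition pw :: "nat list \<Rightarrow> real" where "pw w = prod_list (map p w)"

definition pmin :: real where "pmin = Min (p ` {..m})"

lemma pw_simps [simp]: "pw [] = 1" "pw (j # w) = p j * pw w"
  by (simp_all add: pw_def)

lemma pw_append: "pw (u @ v) = pw u * pw v"
  by (simp add: pw_def)

lemma pmin: "0 < pmin" "j \<le> m \<Longrightarrow> pmin \<le> p j" "pmin \<le> 1"
proof -
  have "pmin \<in> p ` {..m}" unfolding pmin_def by (intro Min_in) auto
  then show "0 < pmin" using p_pos by auto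
  show le: "j \<le> m \<Longrightarrow> pmin \<le> p j" for j unfolding pmin_def by (intro Min_le) auto
  have "p 0 \<le> (\<Sum>j\<le>m. p j)" using p_pos by (intro member_le_sum) (auto intro: less_imp_le)
  then show "pmin \<le> 1" using le[of 0] p_sum by simp
qed

lemma pw_ge: "w \<in> words n \<Longrightarrow> pmin ^ n \<le> pw w"
proof (induction w arbitrary: n)
  case (Cons j w)
  then obtain k where k: "n = Suc k" "w \<in> words k" "j \<le> m" by (auto simp: words_def)
  then show ?case using Cons.IH[OF k(2)] pmin p_pos[of j] by (auto intro!: mult_mono)
qed (simp add: words_def)

lemma pw_pos: "w \<in> words n \<Longrightarrow> 0 < pw w"
  using pw_ge[of w n] pmin(1) by (meson less_le_trans zero_less_power)

lemma words_Suc: "words (Suc n) = (\<lambda>(j, w). j # w) ` ({..m} \<times> words n)"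
  by (auto simp: words_def length_Suc_conv image_iff)

lemma sum_words_Suc: "(\<Sum>w\<in>words (Suc n). f w) = (\<Sum>j\<le>m. \<Sum>w\<in>words n. f (j # w))"
proof -
  have "inj_on (\<lambda>(j, w). j # w) ({..m} \<times> words n)" by (auto simp: inj_on_def)
  then show ?thesis
    unfolding words_Suc by (subst sum.reindex) (auto simp: sum.cartesian_product intro!: sum.cong)
qed

lemma inj_append_words: "inj_on (\<lambda>(u, t). u @ t) (words n \<times> words k)"
proof (rule inj_onI, clarify)
  fix u t u' t' assume "u \<in> words n" "u' \<in> words n" "u @ t = u' @ t'"
  moreover from this have "length u = length u'" using words_length by metis
  ultimately show "u = u' \<and> t = t'" by simp
qed

lemma sum_words_add: "(\<Sum>w\<in>words (n + k). f w) = (\<Sum>u\<in>words n. \<Sum>t\<in>words k. f (u @ t))"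
proof -
  have "words (n + k) = (\<lambda>(u, t). u @ t) ` (words n \<times> words k)"
    using words_append[of _ n _ k] by (force elim!: words_split)
  then show ?thesis
    by (simp only:) (subst sum.reindex[OF inj_append_words], auto simp: sum.cartesian_product intro!: sum.cong)
qed

lemma sum_pw: "(\<Sum>w\<in>words n. pw w) = 1"
proof (induction n)
  case (Suc n)
  then show ?case by (simp add: sum_words_Suc sum_distrib_left[symmetric] p_sum)
qed simp

lemma space_mu: "space mu = UNIV"
  using sets_eq_imp_space_eq[OF sets_mu] by simp

lemma mu_self_similar:
  assumes "A \<in> sets borel" shows "measure mu A = (\<Sum>j\<le>m. p j * measure mu {x. rho * x + d j \<in> A})"
proof -
  have "measure (distr mu borel (\<lambda>x. rho * x + d j)) A = measure mu {x. rho * x + d j \<in> A}" for j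
  proof -
    have "(\<lambda>x. rho * x + d j) \<in> measurable mu borel"
      unfolding measurable_cong_sets[OF sets_mu refl] by measurable
    then show ?thesis using assms by (simp add: measure_distr space_mu vimage_def)
  qed
  then show ?thesis using self_similar[OF assms] by simp
qed

lemma mu_words_S:
  assumes "A \<in> sets borel" shows "measure mu A = (\<Sum>w\<in>words n. pw w * measure mu {x. S_word w x \<in> A})"
  using assms
proof (induction n arbitrary: A)
  case (Suc n)
  have A': "{x. rho * x + d j \<in> A} \<in> sets borel" for j
  proof -
    have "(\<lambda>x. rho * x + d j) -` A \<inter> space borel \<in> sets borel"
      by (rule measurable_sets[OF _ Suc.prems]) measurable
    then show ?thesis by (simp add: vimage_def)
  qed
  have "measure mu A = (\<Sum>j\<le>m. p j * (\<Sum>w\<in>words n. pw w * measure mu {x. S_word w x \<in> {x. rho * x + d j \<in> A}}))"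
    unfolding mu_self_similar[OF Suc.prems] using Suc.IH[OF A'] by simp
  then show ?case by (simp add: sum_words_Suc sum_distrib_left mult.assoc)
qed simp

lemma mu_words:
  assumes "A \<in> sets borel" shows "measure mu A = (\<Sum>w\<in>words n. pw w * measure mu {x. off w + rho ^ n * x \<in> A})"
proof -
  have "{x. S_word w x \<in> A} = {x. off w + rho ^ n * x \<in> A}" if "w \<in> words n" for w
    using S_word_affine[of w] words_length[OF that] by (metis add.commute)
  then show ?thesis unfolding mu_words_S[OF assms, of n] by simp
qed

lemma borel_mu [simp]: "A \<in> sets borel \<Longrightarrow> A \<in> sets mu"
  by (simp add: sets_mu)

lemma mu_mono: "A \<subseteq> B \<Longrightarrow> B \<in> sets borel \<Longrightarrow> measure mu A \<le> measure mu B"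
  using mu.finite_measure_mono[of A B] by simp

lemma mu_le_1: "measure mu A \<le> 1"
  by (rule mu.prob_le_1)

section \<open>The measure lives on \<open>K\<close> and has no atoms\<close>

lemma infdist_S: "j \<le> m \<Longrightarrow> infdist (rho * x + d j) K \<le> rho * infdist x K"
proof -
  assume j: "j \<le> m"
  obtain y where y: "y \<in> K" "infdist x K = dist x y"
    using infdist_attains_inf[OF compact_imp_closed[OF compact_K] K_nonempty] by metis
  have "infdist (rho * x + d j) K \<le> dist (rho * x + d j) (rho * y + d j)"
    using S_K[OF j y(1)] by (rule infdist_le)
  also have "\<dots> = rho * dist x y"
    using rho_pos by (simp add: dist_real_def abs_mult right_diff_distrib[symmetric])
  finally show ?thesis using y by simp
qed

text \<open>The complement of the \<open>e\<close>-neighbourhood of \<open>K\<close> is mapped by the inverse branches into that of the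
  \<open>e / rho\<close>-neighbourhood, so its measure is bounded by arbitrarily small tails.\<close>

lemma mu_far: assumes "0 < e" shows "measure mu {x. e < infdist x K} = 0"
proof -
  have b: "{x. e < infdist x K} \<in> sets borel" for e
    by (intro borel_open open_Collect_less continuous_intros)
  have step: "measure mu {x. e < infdist x K} \<le> measure mu {x. e / rho < infdist x K}" for e
  proof -
    have "{x. rho * x + d j \<in> {x. e < infdist x K}} \<subseteq> {x. e / rho < infdist x K}" if "j \<le> m" for j
      using infdist_S[OF that] rho_pos by (auto simp: divide_less_eq mult.commute intro: less_le_trans)
    then have "p j * measure mu {x. rho * x + d j \<in> {x. e < infdist x K}} \<le> p j * measure mu {x. e / rho < infdist x K}" if "j \<le> m" for j
      using p_pos[OF that] that by (intro mult_left_mono mu_mono b) auto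
    then have "measure mu {x. e < infdist x K} \<le> (\<Sum>j\<le>m. p j * measure mu {x. e / rho < infdist x K})"
      unfolding mu_self_similar[OF b[of e]] by (intro sum_mono) auto
    also have "\<dots> = measure mu {x. e / rho < infdist x K}" by (simp add: sum_distrib_right[symmetric] p_sum)
    finally show ?thesis .
  qed
  have it: "measure mu {x. e < infdist x K} \<le> measure mu {x. e / rho ^ n < infdist x K}" for n
  proof (induction n)
    case (Suc n)
    then show ?case using step[of "e / rho ^ n"] by (simp add: field_simps)
  qed simp
  have "(\<lambda>n. measure mu {x. e / rho ^ n < infdist x K}) \<longlonglongrightarrow> measure mu (\<Inter>n. {x. e / rho ^ n < infdist x K})"
  proof (rule mu.finite_Lim_measure_decseq)
    show "decseq (\<lambda>n. {x. e / rho ^ n < infdist x K})"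
    proof (rule decseq_SucI, clarify)
      fix n x assume h: "e / rho ^ Suc n < infdist x K"
      have "rho ^ Suc n \<le> rho ^ n" using rho_less_1 rho_pos by (intro power_decreasing) auto
      then have "e / rho ^ n \<le> e / rho ^ Suc n" using assms by (intro divide_left_mono mult_pos_pos rho_pow_pos) auto
      then show "e / rho ^ n < infdist x K" using h by linarith
    qed
  qed (use b in auto)
  also have "(\<Inter>n. {x. e / rho ^ n < infdist x K}) = {}"
  proof (rule ccontr)
    assume "(\<Inter>n. {x. e / rho ^ n < infdist x K}) \<noteq> {}"
    then obtain x where x: "e / rho ^ n < infdist x K" for n by auto
    have pos: "0 < infdist x K" using x[of 0] assms by simp
    obtain n where "rho ^ n < e / infdist x K" using rho_pow_small[of "e / infdist x K"] pos assms by auto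
    then show False using x[of n] pos by (simp add: field_simps)
  qed
  finally have "(\<lambda>n. measure mu {x. e / rho ^ n < infdist x K}) \<longlonglongrightarrow> 0" by simp
  then have "measure mu {x. e < infdist x K} \<le> 0" using it by (intro LIMSEQ_le_const) auto
  then show ?thesis by (simp add: measure_le_0_iff)
qed

lemma mu_compl_K: "measure mu (- K) = 0"
proof -
  have cK: "closed K" using compact_imp_closed[OF compact_K] .
  have "emeasure mu (\<Union>n. {x. 1 / real (Suc n) < infdist x K}) = 0"
  proof (rule emeasure_UN_eq_0)
    show "emeasure mu {x. 1 / real (Suc n) < infdist x K} = 0" for n
      using mu_far[of "1 / real (Suc n)"] by (simp add: mu.emeasure_eq_measure)
    show "range (\<lambda>n. {x. 1 / real (Suc n) < infdist x K}) \<subseteq> sets mu"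
      by (auto intro!: borel_mu borel_open open_Collect_less continuous_intros)
  qed
  moreover have "(\<Union>n. {x. 1 / real (Suc n) < infdist x K}) = - K"
  proof (intro equalityI subsetI)
    fix x assume "x \<in> (\<Union>n. {x. 1 / real (Suc n) < infdist x K})"
    then obtain n where "1 / real (Suc n) < infdist x K" by auto
    moreover have "0 < 1 / real (Suc n)" by simp
    ultimately have "infdist x K \<noteq> 0" by linarith
    then show "x \<in> - K" by auto
  next
    fix x assume "x \<in> - K"
    then have "infdist x K \<noteq> 0" using in_closed_iff_infdist_zero[OF cK K_nonempty] by simp
    then have "0 < infdist x K" using infdist_nonneg[of x K] by linarith
    then obtain n where "1 / real (Suc n) < infdist x K" by (rule nat_approx_posE)
    then show "x \<in> (\<Union>n. {x. 1 / real (Suc n) < infdist x K})" by auto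
  qed
  ultimately show ?thesis by (simp add: mu.emeasure_eq_measure)
qed

lemma K_borel [simp]: "K \<in> sets borel"
  using compact_imp_closed[OF compact_K] by (rule borel_closed)

lemma compl_K_borel [simp]: "- K \<in> sets borel"
  using K_borel by (rule borel_comp)

lemma mu_K: "measure mu K = 1"
proof -
  have "- K \<in> mu.events" by (intro borel_mu compl_K_borel)
  then show ?thesis
    using mu.prob_compl[of "- K"] mu_compl_K by (simp add: space_mu Compl_eq_Diff_UNIV[symmetric])
qed

lemma mu_Int_K: "A \<in> sets borel \<Longrightarrow> measure mu (A \<inter> K) = measure mu A"
proof -
  assume A: "A \<in> sets borel"
  have "measure mu A = measure mu ((A \<inter> K) \<union> (A \<inter> - K))" by (simp add: Int_Un_distrib[symmetric])
  also have "\<dots> = measure mu (A \<inter> K) + measure mu (A \<inter> - K)"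
    using A by (intro mu.finite_measure_Union borel_mu sets.Int compl_K_borel K_borel) auto
  also have "measure mu (A \<inter> - K) \<le> measure mu (- K)" by (intro mu_mono) auto
  then have "measure mu (A \<inter> - K) = 0" using mu_compl_K by (simp add: measure_le_0_iff)
  finally show ?thesis by simp
qed

text \<open>The atoms of maximal mass form a finite set that is invariant under the inverse branches.\<close>

lemma mu_single: "measure mu {x} = 0"
proof (rule ccontr)
  let ?f = "\<lambda>x. measure mu {x}"
  assume "?f x \<noteq> 0"
  then have x: "0 < ?f x" using measure_nonneg[of mu "{x}"] by linarith
  have fin: "finite {y. c \<le> ?f y}" if "0 < c" for c
  proof (rule ccontr)
    assume "infinite {y. c \<le> ?f y}"
    obtain N :: nat where N: "1 / c < real N" using reals_Archimedean2 by blast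
    obtain F where F: "F \<subseteq> {y. c \<le> ?f y}" "finite F" "card F = N"
      using infinite_arbitrarily_large[OF \<open>infinite _\<close>] by blast
    have "real N * c \<le> (\<Sum>y\<in>F. ?f y)" using sum_bounded_below[of F c ?f] F by auto
    also have "\<dots> = measure mu F" using mu.finite_measure_eq_sum_singleton[OF F(2)] by simp
    also have "\<dots> \<le> 1" by (rule mu_le_1)
    finally show False using N that by (simp add: field_simps)
  qed
  define M where "M = Max (?f ` {y. ?f x \<le> ?f y})"
  have finx: "finite {y. ?f x \<le> ?f y}" using fin[OF x] .
  have "M \<in> ?f ` {y. ?f x \<le> ?f y}" unfolding M_def using finx by (intro Max_in) auto
  then obtain z where z: "?f z = M" "?f x \<le> M" by auto
  have M: "?f y \<le> M" for y
  proof (cases "?f x \<le> ?f y")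
    case True then show ?thesis unfolding M_def using finx by (intro Max_ge) auto
  qed (use z in linarith)
  define A where "A = {y. ?f y = M}"
  have "A \<subseteq> {y. ?f x \<le> ?f y}" using z by (auto simp: A_def)
  then have finA: "finite A" using finx finite_subset by blast
  have neA: "A \<noteq> {}" using z by (auto simp: A_def)
  have cl: "(y - d j) / rho \<in> A" if "y \<in> A" "j \<le> m" for y j
  proof (rule ccontr)
    assume n: "(y - d j) / rho \<notin> A"
    have pre: "{x. rho * x + d i \<in> {y}} = {(y - d i) / rho}" for i
      by (auto simp: field_simps)
    \<comment> \<open>The maximum \<open>M\<close> is a convex combination, with positive
      coefficients, of masses that are at most \<open>M\<close>; a single smaller one is
      impossible.\<close>
    have "M = (\<Sum>i\<le>m. p i * ?f ((y - d i) / rho))"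
      using mu_self_similar[of "{y}"] that(1) unfolding pre by (simp add: A_def)
    also have "\<dots> < (\<Sum>i\<le>m. p i * M)"
    proof (rule sum_strict_mono_ex1)
      show "\<forall>i\<in>{..m}. p i * ?f ((y - d i) / rho) \<le> p i * M" using M p_pos by (auto intro!: mult_left_mono less_imp_le)
      have "?f ((y - d j) / rho) < M" using n M[of "(y - d j) / rho"] by (simp add: A_def)
      then show "\<exists>i\<in>{..m}. p i * ?f ((y - d i) / rho) < p i * M" using p_pos that(2) by (intro bexI[of _ j]) auto
    qed simp
    also have "\<dots> = M" by (simp add: sum_distrib_right[symmetric] p_sum)
    finally show False by simp
  qed
  \<comment> \<open>The inverses of the first and of the last map expand away from their fixed
    points 0 and 1. Invariance of the finite set puts its maximum at or below 0 and its minimum at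
    or above 1.\<close>
  have "Max A \<in> A" "Min A \<in> A" using finA neA by auto
  then have "Max A / rho \<in> A" "(Min A - d m) / rho \<in> A" using cl[of "Max A" 0] cl[of "Min A" m] d_0 by auto
  then have "Max A / rho \<le> Max A" "Min A \<le> (Min A - d m) / rho" using finA by (auto intro: Max_ge Min_le)
  then have "Max A \<le> rho * Max A" "rho * Min A + d m \<le> Min A" using rho_pos by (simp_all add: field_simps)
  then have "(1 - rho) * Max A \<le> 0" "(1 - rho) * 1 \<le> (1 - rho) * Min A" by (simp_all add: d_m algebra_simps)
  then have "Max A \<le> 0" "1 \<le> Min A" using rho_less_1 by (auto simp: mult_le_0_iff)
  moreover have "Min A \<le> Max A" using finA neA by simp
  ultimately show False by linarith
qed

text \<open>Only the term of \<open>w\<close> itself is kept in the self-similar sum; its preimage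
  contains \<open>K\<close> and so has full measure.\<close>

lemma mu_word_ivl: assumes "w \<in> words n" shows "pw w \<le> measure mu {off w..off w + rho ^ n}"
proof -
  have "measure mu {x. off w + rho ^ n * x \<in> {off w..off w + rho ^ n}} \<ge> measure mu K"
  proof (rule mu_mono)
    show "K \<subseteq> {x. off w + rho ^ n * x \<in> {off w..off w + rho ^ n}}"
    proof
      fix x assume "x \<in> K"
      then have "x \<in> {0..1}" using K_sub by blast
      from word_point_bounds[OF this, of w n] show "x \<in> {x. off w + rho ^ n * x \<in> {off w..off w + rho ^ n}}" by simp
    qed
    have "{x. off w + rho ^ n * x \<in> {off w..off w + rho ^ n}} = {0..1}"
    proof -
      have "0 \<le> rho ^ n * x \<longleftrightarrow> 0 \<le> x" "rho ^ n * x \<le> rho ^ n \<longleftrightarrow> x \<le> 1" for x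
        using mult_le_cancel_left_pos[OF rho_pow_pos, of n 0 x] mult_le_cancel_left_pos[OF rho_pow_pos, of n x 1]
        by (simp_all only: mult_zero_right mult_1_right)
      then show ?thesis by (simp add: atLeastAtMost_def atLeast_def atMost_def Collect_conj_eq[symmetric])
    qed
    then show "{x. off w + rho ^ n * x \<in> {off w..off w + rho ^ n}} \<in> sets borel" by simp
  qed
  then have "pw w \<le> pw w * measure mu {x. off w + rho ^ n * x \<in> {off w..off w + rho ^ n}}"
    using mu_K pw_pos[OF assms] by simp
  also have "\<dots> \<le> measure mu {off w..off w + rho ^ n}"
  proof -
    have "pw w * measure mu {x. off w + rho ^ n * x \<in> {off w..off w + rho ^ n}} \<le>
       (\<Sum>u\<in>words n. pw u * measure mu {x. off u + rho ^ n * x \<in> {off w..off w + rho ^ n}})"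
      using assms by (intro member_le_sum mult_nonneg_nonneg) (auto dest: pw_pos)
    then show ?thesis using mu_words[of "{off w..off w + rho ^ n}" n] by simp
  qed
  finally show ?thesis .
qed

lemma mu_ball_ge:
  assumes "x \<in> K" shows "pmin ^ n \<le> measure mu {x - rho ^ n..x + rho ^ n}"
proof -
  obtain w z where w: "w \<in> words n" "z \<in> K" "x = off w + rho ^ n * z" using K_word_point[OF assms] .
  have "off w \<le> x" "x \<le> off w + rho ^ n" using w word_point_bounds[of z w n] K_sub by auto
  then have "measure mu {off w..off w + rho ^ n} \<le> measure mu {x - rho ^ n..x + rho ^ n}"
    by (intro mu_mono) auto
  then show ?thesis using mu_word_ivl[OF w(1)] pw_ge[OF w(1)] by linarith
qed

section \<open>Weight vectors of net intervals and their comparison with the measure\<close>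

definition q :: "nat \<Rightarrow> real \<Rightarrow> real" where
  "q n y = (\<Sum>w\<in>words n. if off w = y then pw w else 0)"

text \<open>\<open>Q n D\<close> is the row vector of the weights of \<open>D\<close>, indexed by the neighbours themselves instead of
  their positions in the neighbour tuple.\<close>

definition Q :: "nat \<Rightarrow> net_interval \<Rightarrow> real \<Rightarrow> real" where
  "Q n D v = q n (fst D - rho ^ n * v)"

text \<open>The sum of the entries of \<open>Q n D\<close> (see \<open>mass_eq\<close>), used as the
  norm of the weight vector.\<close>

definition mass :: "nat \<Rightarrow> net_interval \<Rightarrow> real" where
  "mass n D = (\<Sum>w\<in>cov n D. pw w)"

lemma q_nonneg: "0 \<le> q n y"
  unfolding q_def by (intro sum_nonneg) (auto dest: pw_pos)

lemma q_ge: "w \<in> words n \<Longrightarrow> off w = y \<Longrightarrow> pw w \<le> q n y"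
proof -
  assume w: "w \<in> words n" "off w = y"
  have "(if off w = y then pw w else 0) \<le> q n y"
    unfolding q_def using w by (intro member_le_sum) (auto dest: pw_pos)
  then show ?thesis using w by simp
qed

lemma Q_nonneg: "0 \<le> Q n D v"
  by (simp add: Q_def q_nonneg)

lemma Q_ge: "v \<in> nb n D \<Longrightarrow> pmin ^ n \<le> Q n D v"
proof -
  assume "v \<in> nb n D"
  then obtain w where w: "w \<in> cov n D" "off w = fst D - rho ^ n * v" by (rule nbD)
  then have "w \<in> words n" by (simp add: cov_def)
  then show ?thesis using q_ge[of w n, OF _ w(2)] pw_ge[of w n] by (simp add: Q_def)
qed

lemma mass_eq: "mass n D = (\<Sum>v\<in>nb n D. Q n D v)"
proof -
  let ?f = "\<lambda>w. (fst D - off w) / rho ^ n"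
  have "mass n D = (\<Sum>v\<in>?f ` cov n D. \<Sum>w\<in>{w \<in> cov n D. ?f w = v}. pw w)"
    unfolding mass_def by (rule sum.image_gen) simp
  also have "\<dots> = (\<Sum>v\<in>nb n D. Q n D v)"
  proof (rule sum.cong)
    fix v assume v: "v \<in> nb n D"
    have f: "?f w = v \<longleftrightarrow> off w = fst D - rho ^ n * v" for w by (auto simp: field_simps)
    have "{w \<in> cov n D. ?f w = v} = {w \<in> words n. off w = fst D - rho ^ n * v}"
      unfolding f using nb_cov[OF v] by (auto simp: cov_def)
    then show "(\<Sum>w\<in>{w \<in> cov n D. ?f w = v}. pw w) = Q n D v"
      by (simp add: Q_def q_def sum.If_cases Int_def)
  qed (simp add: nb_def)
  finally show ?thesis .
qed

lemma Q_le_mass: "v \<in> nb n D \<Longrightarrow> Q n D v \<le> mass n D"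
  unfolding mass_eq by (intro member_le_sum) (auto simp: Q_nonneg)

lemma mass_le_1: "mass n D \<le> 1"
proof -
  have "mass n D \<le> (\<Sum>w\<in>words n. pw w)" unfolding mass_def
    by (intro sum_mono2) (auto simp: cov_def dest: pw_pos)
  then show ?thesis by (simp add: sum_pw)
qed

lemma mass_ge: "D \<in> net_intervals n \<Longrightarrow> pmin ^ n \<le> mass n D"
  using nb_nonempty[of D n] Q_ge[of _ n D] Q_le_mass[of _ n D] by force

lemma mass_pos: "D \<in> net_intervals n \<Longrightarrow> 0 < mass n D"
  using mass_ge[of D n] pmin(1) by (meson less_le_trans zero_less_power)

lemma q_add: "q (n + k) y = (\<Sum>t\<in>words k. pw t * q n (y - rho ^ n * off t))"
proof -
  have "q (n + k) y = (\<Sum>u\<in>words n. \<Sum>t\<in>words k. if off (u @ t) = y then pw (u @ t) else 0)"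
    unfolding q_def sum_words_add ..
  also have "\<dots> = (\<Sum>t\<in>words k. \<Sum>u\<in>words n. if off (u @ t) = y then pw (u @ t) else 0)"
    by (rule sum.swap)
  also have "\<dots> = (\<Sum>t\<in>words k. pw t * q n (y - rho ^ n * off t))"
  proof (rule sum.cong[OF refl])
    fix t
    have "(if off (u @ t) = y then pw (u @ t) else 0) = pw t * (if off u = y - rho ^ n * off t then pw u else 0)"
      if "u \<in> words n" for u
      using words_length[OF that] by (auto simp: off_append pw_append)
    then show "(\<Sum>u\<in>words n. if off (u @ t) = y then pw (u @ t) else 0) = pw t * q n (y - rho ^ n * off t)"
      by (simp add: q_def sum_distrib_left)
  qed
  finally show ?thesis .
qed

text \<open>This is the product of a row vector with a transition matrix: \<open>v\<close> is the
  neighbour of \<open>D\<close> from which the word \<open>t\<close> leads to \<open>v'\<close>, and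
  a word \<open>t\<close> without such a neighbour contributes 0.\<close>

lemma Q_desc:
  assumes "D \<in> net_intervals n" "E \<in> net_intervals (n + k)" "sub E D" "v' \<in> nb (n + k) E"
  shows "Q (n + k) E v' = (\<Sum>t\<in>words k. pw t *
    (let v = rho ^ k * v' + off t - (fst E - fst D) / rho ^ n in if v \<in> nb n D then Q n D v else 0))"
  unfolding Q_def[of "n + k"] q_add
proof (rule sum.cong[OF refl])
  fix t assume t: "t \<in> words k"
  define v where "v = rho ^ k * v' + off t - (fst E - fst D) / rho ^ n"
  have eq: "fst E - rho ^ (n + k) * v' - rho ^ n * off t = fst D - rho ^ n * v"
    by (simp add: v_def field_simps power_add)
  \<comment> \<open>A word with this offset, extended by \<open>t\<close>, would cover
    \<open>E\<close>; its prefix would then cover \<open>D\<close> and make \<open>v\<close> a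
    neighbour.\<close>
  have "q n (fst D - rho ^ n * v) = 0" if v: "v \<notin> nb n D"
  proof -
    have "off u \<noteq> fst D - rho ^ n * v" if u: "u \<in> words n" for u
    proof
      assume o: "off u = fst D - rho ^ n * v"
      then have "off (u @ t) = fst E - rho ^ (n + k) * v'"
        using words_length[OF u] eq by (simp add: off_append)
      then have "u @ t \<in> cov (n + k) E" using nb_cov[OF assms(4) words_append[OF u t]] by simp
      then have "u \<in> cov n D" using cov_take[OF assms(1,2,3) _ u t] by simp
      then have "(fst D - off u) / rho ^ n \<in> nb n D" by (rule cov_nb)
      then show False using v o by simp
    qed
    then show ?thesis by (simp add: q_def)
  qed
  then show "pw t * q n (fst E - rho ^ (n + k) * v' - rho ^ n * off t) = pw t * (let v = rho ^ k * v' + off t - (fst E - fst D) / rho ^ n in if v \<in> nb n D then Q n D v else 0)"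
    unfolding eq by (simp add: v_def[symmetric] Q_def Let_def)
qed

text \<open>The passage from \<open>Q n D\<close> to a descendant is a nonnegative linear map which depends on the type
  of \<open>D\<close> only; monotonicity is all that is needed of the transition matrices.\<close>

lemma Q_mono:
  assumes "sim n D n' D'" "\<And>v. v \<in> nb n D \<Longrightarrow> c * Q n' D' v \<le> Q n D v"
    and E: "E \<in> net_intervals (n + k)" "sub E D" and v': "v' \<in> nb (n + k) E"
  shows "c * Q (n' + k) (embI n D n' D' E) v' \<le> Q (n + k) E v'"
proof -
  have D: "D \<in> net_intervals n" "D' \<in> net_intervals n'" "nb n' D' = nb n D" using assms by (auto simp: sim_def)
  note E' = sim_desc_net[OF assms(1) E]
  have v'': "v' \<in> nb (n' + k) (embI n D n' D' E)" using sim_desc[OF assms(1) E] v' by (simp add: sim_def)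
  have u: "(fst (embI n D n' D' E) - fst D') / rho ^ n' = (fst E - fst D) / rho ^ n"
    by (simp add: emb_def field_simps)
  show ?thesis
    unfolding Q_desc[OF D(1) E v'] Q_desc[OF D(2) E' v''] u D(3) sum_distrib_left
  proof (rule sum_mono)
    fix t assume t: "t \<in> words k"
    let ?v = "rho ^ k * v' + off t - (fst E - fst D) / rho ^ n"
    have "c * (if ?v \<in> nb n D then Q n' D' ?v else 0) \<le> (if ?v \<in> nb n D then Q n D ?v else 0)"
      using assms(2) by simp
    from mult_left_mono[OF this, of "pw t"] pw_pos[OF t]
    show "c * (pw t * (let v = ?v in if v \<in> nb n D then Q n' D' v else 0)) \<le>
       pw t * (let v = ?v in if v \<in> nb n D then Q n D v else 0)"
      by (simp add: Let_def mult.left_commute)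
  qed
qed

lemma mass_mono:
  assumes "sim n D n' D'" "\<And>v. v \<in> nb n D \<Longrightarrow> c * Q n' D' v \<le> Q n D v"
    and E: "E \<in> net_intervals (n + k)" "sub E D"
  shows "c * mass (n' + k) (embI n D n' D' E) \<le> mass (n + k) E"
proof -
  have "nb (n' + k) (embI n D n' D' E) = nb (n + k) E" using sim_desc[OF assms(1) E] by (simp add: sim_def)
  then show ?thesis
    unfolding mass_eq sum_distrib_left using Q_mono[OF assms] by (auto intro!: sum_mono)
qed

text \<open>A word covering \<open>E\<close> extends one covering \<open>D\<close>, and all
  extensions of a word by \<open>k\<close> letters together weigh as much as the word.\<close>

lemma mass_desc:
  assumes "D \<in> net_intervals n" "E \<in> net_intervals (n + k)" "sub E D" shows "mass (n + k) E \<le> mass n D"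
proof -
  have "cov (n + k) E \<subseteq> (\<lambda>(u, t). u @ t) ` (cov n D \<times> words k)"
  proof
    fix w assume w: "w \<in> cov (n + k) E"
    then have "w \<in> words (n + k)" by (simp add: cov_def)
    then obtain u t where ut: "u \<in> words n" "t \<in> words k" "w = u @ t" by (rule words_split)
    then have "u \<in> cov n D" using cov_take[OF assms] w by blast
    then show "w \<in> (\<lambda>(u, t). u @ t) ` (cov n D \<times> words k)" using ut by force
  qed
  moreover have "0 \<le> pw (u @ t)" if "u \<in> cov n D" "t \<in> words k" for u t
    using that pw_pos[of u n] pw_pos[of t k] by (simp add: pw_append cov_def)
  ultimately have "mass (n + k) E \<le> (\<Sum>w\<in>(\<lambda>(u, t). u @ t) ` (cov n D \<times> words k). pw w)"
    unfolding mass_def by (intro sum_mono2) auto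
  also have "inj_on (\<lambda>(u, t). u @ t) (cov n D \<times> words k)"
    by (rule inj_on_subset[OF inj_append_words]) (auto simp: cov_def)
  then have "(\<Sum>w\<in>(\<lambda>(u, t). u @ t) ` (cov n D \<times> words k). pw w) = (\<Sum>u\<in>cov n D. \<Sum>t\<in>words k. pw u * pw t)"
    by (subst sum.reindex) (auto simp: sum.cartesian_product pw_append intro!: sum.cong)
  also have "\<dots> = mass n D" by (simp add: sum_distrib_left[symmetric] sum_pw mass_def)
  finally show ?thesis .
qed

text \<open>A word that does not cover \<open>D\<close> carries a copy of \<open>K\<close> that
  meets \<open>D\<close> at most in its two endpoints, and these are null because there are no
  atoms.\<close>

lemma mu_le_mass: assumes "D \<in> net_intervals n" shows "measure mu {fst D..snd D} \<le> mass n D"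
proof -
  have z: "measure mu {x. off w + rho ^ n * x \<in> {fst D..snd D}} = 0" if w: "w \<in> words n" "w \<notin> cov n D" for w
  proof -
    have eq: "{x. off w + rho ^ n * x \<in> {fst D..snd D}} = {(fst D - off w) / rho ^ n..(snd D - off w) / rho ^ n}"
      by (auto simp: field_simps)
    have "{x. off w + rho ^ n * x \<in> {fst D..snd D}} \<inter> K \<subseteq> {(fst D - off w) / rho ^ n, (snd D - off w) / rho ^ n}"
    proof
      fix x assume x: "x \<in> {x. off w + rho ^ n * x \<in> {fst D..snd D}} \<inter> K"
      then have "off w \<le> off w + rho ^ n * x" "off w + rho ^ n * x \<le> off w + rho ^ n"
        using word_point_bounds[of x w n] K_sub by auto
      then have "\<not> (fst D < off w + rho ^ n * x \<and> off w + rho ^ n * x < snd D)"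
        using covI[OF assms w(1), of "off w + rho ^ n * x"] w(2) by blast
      then have "off w + rho ^ n * x = fst D \<or> off w + rho ^ n * x = snd D" using x by auto
      then show "x \<in> {(fst D - off w) / rho ^ n, (snd D - off w) / rho ^ n}" by (auto simp: field_simps)
    qed
    then have "measure mu ({x. off w + rho ^ n * x \<in> {fst D..snd D}} \<inter> K) \<le> measure mu {(fst D - off w) / rho ^ n, (snd D - off w) / rho ^ n}"
      by (rule mu_mono) simp
    also have "\<dots> = (\<Sum>y\<in>{(fst D - off w) / rho ^ n, (snd D - off w) / rho ^ n}. measure mu {y})"
      by (rule mu.finite_measure_eq_sum_singleton) auto
    also have "\<dots> = 0" by (simp add: mu_single)
    finally have "measure mu ({x. off w + rho ^ n * x \<in> {fst D..snd D}} \<inter> K) = 0" by (simp add: measure_le_0_iff)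
    then show ?thesis using mu_Int_K[of "{(fst D - off w) / rho ^ n..(snd D - off w) / rho ^ n}"] unfolding eq by simp
  qed
  have "measure mu {fst D..snd D} = (\<Sum>w\<in>words n. pw w * measure mu {x. off w + rho ^ n * x \<in> {fst D..snd D}})"
    by (rule mu_words) simp
  also have "\<dots> = (\<Sum>w\<in>cov n D. pw w * measure mu {x. off w + rho ^ n * x \<in> {fst D..snd D}})"
    using z by (intro sum.mono_neutral_right) (auto simp: cov_def)
  also have "\<dots> \<le> mass n D" unfolding mass_def
    using mu_le_1 by (intro sum_mono) (auto simp: cov_def mult_left_le dest: pw_pos)
  finally show ?thesis .
qed

text \<open>In the coordinates of a word with neighbour \<open>v\<close>, the interval
  \<open>D\<close> becomes \<open>{v..v + norm_length n D}\<close>; so \<open>c\<close> bounds from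
  below the share of the word's weight that falls into \<open>D\<close>.\<close>

lemma mu_ge_mass:
  assumes "D \<in> net_intervals n" "\<And>v. v \<in> nb n D \<Longrightarrow> c \<le> measure mu {v..v + norm_length n D}"
  shows "c * mass n D \<le> measure mu {fst D..snd D}"
proof -
  have "c * mass n D = (\<Sum>w\<in>cov n D. pw w * c)" by (simp add: mass_def sum_distrib_left mult.commute)
  also have "\<dots> \<le> (\<Sum>w\<in>cov n D. pw w * measure mu {x. off w + rho ^ n * x \<in> {fst D..snd D}})"
  proof (rule sum_mono)
    fix w assume w: "w \<in> cov n D"
    have "{x. off w + rho ^ n * x \<in> {fst D..snd D}} = {(fst D - off w) / rho ^ n..(fst D - off w) / rho ^ n + norm_length n D}"
      by (auto simp: field_simps norm_length_def)
    then show "pw w * c \<le> pw w * measure mu {x. off w + rho ^ n * x \<in> {fst D..snd D}}"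
      using assms(2)[OF cov_nb[OF w]] w pw_pos[of w n] by (simp add: cov_def)
  qed
  also have "\<dots> \<le> (\<Sum>w\<in>words n. pw w * measure mu {x. off w + rho ^ n * x \<in> {fst D..snd D}})"
    by (intro sum_mono2) (auto simp: cov_def dest: pw_pos)
  also have "\<dots> = measure mu {fst D..snd D}" by (rule mu_words[symmetric]) simp
  finally show ?thesis .
qed

end

subsection \<open>Links between neighbours and transition matrices\<close>

context ifs
begin

text \<open>For a descendant \<open>E\<close> of \<open>D\<close> this is positivity of the \<open>(v, w)\<close> entry of the transition matrix
  from \<open>D\<close> to \<open>E\<close>.\<close>

definition linked :: "nat \<Rightarrow> net_interval \<Rightarrow> nat \<Rightarrow> net_interval \<Rightarrow> real \<Rightarrow> real \<Rightarrow> bool" where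
  "linked n D k E v w \<longleftrightarrow> (\<exists>t\<in>words k. off t = (fst E - fst D) / rho ^ n + v - rho ^ k * w)"

lemma linked_trans:
  assumes "linked n D k E v w" "linked (n + k) E l F w z" shows "linked n D (k + l) F v z"
proof -
  obtain t s where t: "t \<in> words k" "off t = (fst E - fst D) / rho ^ n + v - rho ^ k * w"
    and s: "s \<in> words l" "off s = (fst F - fst E) / rho ^ (n + k) + w - rho ^ l * z"
    using assms by (auto simp: linked_def)
  have "off (t @ s) = off t + rho ^ k * off s" using words_length[OF t(1)] by (simp add: off_append)
  also have "\<dots> = (fst F - fst D) / rho ^ n + v - rho ^ (k + l) * z"
    unfolding t(2) s(2) by (simp add: field_simps power_add)
  finally show ?thesis using words_append[OF t(1) s(1)] unfolding linked_def by blast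
qed

lemma linked_word:
  assumes "u \<in> words n" "off u = fst D - rho ^ n * v" "t \<in> words k" "off (u @ t) = fst E - rho ^ (n + k) * w"
  shows "linked n D k E v w"
proof -
  have "off (u @ t) = off u + rho ^ n * off t" using words_length[OF assms(1)] by (simp add: off_append)
  then have "off t = (fst E - fst D) / rho ^ n + v - rho ^ k * w"
    using assms(2,4) by (simp add: field_simps power_add)
  then show ?thesis using assms(3) by (auto simp: linked_def)
qed

lemma linked_wordE:
  assumes "linked n D k E v w" "u \<in> words n" "off u = fst D - rho ^ n * v"
  obtains t where "t \<in> words k" "off (u @ t) = fst E - rho ^ (n + k) * w"
proof -
  obtain t where t: "t \<in> words k" "off t = (fst E - fst D) / rho ^ n + v - rho ^ k * w"
    using assms(1) by (auto simp: linked_def)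
  have "off (u @ t) = off u + rho ^ n * off t" using words_length[OF assms(2)] by (simp add: off_append)
  also have "\<dots> = fst E - rho ^ (n + k) * w" unfolding t(2) assms(3) by (simp add: field_simps power_add)
  finally show ?thesis using that t(1) by blast
qed

lemma linked_emb: "linked n' D' k (embI n D n' D' E) v w \<longleftrightarrow> linked n D k E v w"
proof -
  have "(fst (embI n D n' D' E) - fst D') / rho ^ n' = (fst E - fst D) / rho ^ n"
    by (simp add: emb_def field_simps)
  then show ?thesis by (simp only: linked_def)
qed

text \<open>Converse of \<open>linked_trans\<close>: cut the linking word at level
  \<open>n + k\<close>; the first part covers \<open>E\<close> because the whole word covers
  \<open>F\<close>.\<close>

lemma linked_split:
  assumes "D \<in> net_intervals n" "E \<in> net_intervals (n + k)" "F \<in> net_intervals (n + k + l)" "sub E D" "sub F E"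
    "v \<in> nb n D" "z \<in> nb (n + k + l) F" "linked n D (k + l) F v z"
  obtains w where "w \<in> nb (n + k) E" "linked n D k E v w" "linked (n + k) E l F w z"
proof -
  obtain u where u: "u \<in> cov n D" "off u = fst D - rho ^ n * v" using nbD[OF assms(6)] .
  then have uw: "u \<in> words n" by (simp add: cov_def)
  obtain t where t: "t \<in> words (k + l)" "off (u @ t) = fst F - rho ^ (n + (k + l)) * z"
    using linked_wordE[OF assms(8) uw u(2)] .
  obtain a b where ab: "a \<in> words k" "b \<in> words l" "t = a @ b" using words_split[OF t(1)] .
  have ua: "u @ a \<in> words (n + k)" using words_append[OF uw ab(1)] .
  have o: "off ((u @ a) @ b) = fst F - rho ^ (n + k + l) * z" using t(2) ab(3) by (simp add: add.assoc)
  have "(u @ a) @ b \<in> cov (n + k + l) F" using nb_cov[OF assms(7) words_append[OF ua ab(2)] o] .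
  then have c: "u @ a \<in> cov (n + k) E" using cov_take[OF assms(2,3,5) _ ua ab(2)] by blast
  define w where "w = (fst E - off (u @ a)) / rho ^ (n + k)"
  have w: "w \<in> nb (n + k) E" unfolding w_def by (rule cov_nb[OF c])
  have ow: "off (u @ a) = fst E - rho ^ (n + k) * w" by (simp add: w_def)
  show ?thesis using that[OF w linked_word[OF uw u(2) ab(1) ow] linked_word[OF ua ow ab(2) o]] .
qed

end

section \<open>Entries of transition matrices in terms of links\<close>

context self_similar_measure
begin

text \<open>Neighbour \<open>j\<close> already prescribes the offset of the word \<open>w\<close>
  and guarantees that one exists, so the condition reduces to the equation \<open>d l = c\<close>,
  which has at most one solution.\<close>

lemma transition_entry_eq:
  fixes D :: net_interval and k :: nat
  assumes D': "D' \<in> net_intervals n" and j: "j < length (neighbours n D')"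
  defines "c \<equiv> (fst D - fst D') / rho ^ n + neighbours n D' ! j - rho * (neighbours (Suc n) D ! k)"
  shows "transition_entry n D' D j k = (if \<exists>l\<le>m. d l = c then p (THE l. l \<le> m \<and> d l = c) else 0)"
proof -
  let ?v = "neighbours n D' ! j" and ?w = "neighbours (Suc n) D ! k"
  have "?v \<in> nb n D'" using j set_neighbours[OF D'] nth_mem by blast
  then obtain u where "u \<in> cov n D'" and u: "off u = fst D' - rho ^ n * ?v" by (rule nbD)
  then have uw: "u \<in> words n" by (simp add: cov_def)
  have "(\<exists>w\<in>words n. off w = fst D' - rho ^ n * ?v \<and> off (w @ [l]) = fst D - rho ^ Suc n * ?w) \<longleftrightarrow> d l = c" for l
  proof -
    have o: "off (w @ [l]) = off w + rho ^ n * d l" if "w \<in> words n" for w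
      using words_length[OF that] by (simp add: off_append)
    have "fst D' - rho ^ n * ?v + rho ^ n * d l = fst D - rho ^ Suc n * ?w \<longleftrightarrow> d l = c"
      unfolding c_def by (auto simp: field_simps)
    then show ?thesis using o u uw by auto
  qed
  then show ?thesis unfolding transition_entry_def Let_def by auto
qed

lemma transition_entry_cases:
  assumes "D' \<in> net_intervals n" "j < length (neighbours n D')"
  shows "0 \<le> transition_entry n D' D j k"
    and "0 < transition_entry n D' D j k \<longleftrightarrow> linked n D' (Suc 0) D (neighbours n D' ! j) (neighbours (Suc n) D ! k)"
proof -
  define c where "c = (fst D - fst D') / rho ^ n + neighbours n D' ! j - rho * (neighbours (Suc n) D ! k)"
  have l: "linked n D' (Suc 0) D (neighbours n D' ! j) (neighbours (Suc n) D ! k) \<longleftrightarrow> (\<exists>l\<le>m. d l = c)"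
    unfolding linked_def words_Suc_0 c_def by auto
  have e: "transition_entry n D' D j k = (if \<exists>l\<le>m. d l = c then p (THE l. l \<le> m \<and> d l = c) else 0)"
    unfolding c_def by (rule transition_entry_eq[OF assms])
  have "0 < p (THE l. l \<le> m \<and> d l = c)" if ex: "\<exists>l\<le>m. d l = c"
  proof -
    obtain l where l: "l \<le> m" "d l = c" using ex by blast
    have "(THE l. l \<le> m \<and> d l = c) = l"
    proof (rule the_equality)
      show "x = l" if "x \<le> m \<and> d x = c" for x using d_inj[of x l] l that by simp
    qed (use l in simp)
    then show ?thesis using p_pos l by simp
  qed
  then show "0 \<le> transition_entry n D' D j k" "0 < transition_entry n D' D j k \<longleftrightarrow> linked n D' (Suc 0) D (neighbours n D' ! j) (neighbours (Suc n) D ! k)"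
    unfolding e l by (cases "\<exists>l\<le>m. d l = c"; simp add: less_imp_le)+
qed

lemma transition_matrix_transfer:
  assumes "parent n D E" "parent n' D' E'" "char_vector n D = char_vector n' D'" "char_vector (Suc n) E = char_vector (Suc n') E'"
  shows "transition_matrix n D E = transition_matrix n' D' E'"
proof -
  have D: "D \<in> net_intervals n" "D' \<in> net_intervals n'" using assms(1,2) by (simp_all only: parent_iff)
  have nb: "neighbours n D = neighbours n' D'" "neighbours (Suc n) E = neighbours (Suc n') E'"
    using assms(3,4) by (simp_all add: char_vector_def)
  have "E' = embI n D n' D' E" using parent_transfer[OF assms] by blast
  then have u: "(fst E' - fst D') / rho ^ n' = (fst E - fst D) / rho ^ n" by (simp add: emb_def field_simps)
  show ?thesis unfolding transition_matrix_def nb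
  proof (rule cong_mat)
    fix j k assume j: "j < length (neighbours n' D')"
    then have j': "j < length (neighbours n D)" by (simp add: nb)
    show "(\<lambda>(j, k). transition_entry n D E j k) (j, k) = (\<lambda>(j, k). transition_entry n' D' E' j k) (j, k)"
      unfolding split_conv transition_entry_eq[OF D(1) j'] transition_entry_eq[OF D(2) j] nb u ..
  qed simp_all
qed

lemma primitive_transition_eq:
  assumes "parent n D E"
  shows "primitive_transition (char_vector n D) (char_vector (Suc n) E) = transition_matrix n D E"
  unfolding primitive_transition_def
proof (rule the_equality)
  show "T = transition_matrix n D E" if "\<exists>k D' D''. parent k D' D'' \<and> char_vector k D' = char_vector n D \<and>
     char_vector (Suc k) D'' = char_vector (Suc n) E \<and> T = transition_matrix k D' D''" for T
    using that transition_matrix_transfer[OF _ assms] by blast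
qed (use assms in blast)

text \<open>All factors are nonnegative, so one positive summand makes an entry of the product
  positive; its index is the intermediate neighbour supplied by \<open>linked_split\<close>.\<close>

lemma path_transition_chain:
  assumes "\<And>i. i < L \<Longrightarrow> parent (n + i) (Ds i) (Ds (Suc i))" "Ds 0 \<in> net_intervals n"
  defines "T \<equiv> path_transition (map (\<lambda>i. char_vector (n + i) (Ds i)) [0..<Suc L])"
  shows "dim_row T = length (neighbours n (Ds 0))" "dim_col T = length (neighbours (n + L) (Ds L))"
    "j < dim_row T \<Longrightarrow> k < dim_col T \<Longrightarrow> 0 \<le> T $$ (j, k)"
    "j < dim_row T \<Longrightarrow> k < dim_col T \<Longrightarrow> linked n (Ds 0) L (Ds L) (neighbours n (Ds 0) ! j) (neighbours (n + L) (Ds L) ! k) \<Longrightarrow> 0 < T $$ (j, k)"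
proof -
  have "let T = path_transition (map (\<lambda>i. char_vector (n + i) (Ds i)) [0..<Suc L]) in
    dim_row T = length (neighbours n (Ds 0)) \<and> dim_col T = length (neighbours (n + L) (Ds L)) \<and>
    (\<forall>j<dim_row T. \<forall>k<dim_col T. 0 \<le> T $$ (j, k) \<and>
      (linked n (Ds 0) L (Ds L) (neighbours n (Ds 0) ! j) (neighbours (n + L) (Ds L) ! k) \<longrightarrow> 0 < T $$ (j, k)))"
    using assms(1,2)
  proof (induction L arbitrary: n Ds)
    case 0
    \<comment> \<open>A link of length 0 forces equal neighbours, and as the tuple has no
      repetitions the entry is on the diagonal of the identity matrix.\<close>
    have "distinct (neighbours n (Ds 0))" using neighbours_eq[OF 0(2)] by simp
    then show ?case
      by (auto simp: char_vector_def linked_def Let_def nth_eq_iff_index_eq)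
  next
    case (Suc L)
    define Es where "Es = (\<lambda>i. Ds (Suc i))"
    define T' where "T' = path_transition (map (\<lambda>i. char_vector (Suc n + i) (Es i)) [0..<Suc L])"
    have par: "parent n (Ds 0) (Es 0)" using Suc.prems(1)[of 0] by (simp add: Es_def)
    have ES: "parent (Suc n + i) (Es i) (Es (Suc i))" if "i < L" for i
      using Suc.prems(1)[of "Suc i"] that by (simp add: Es_def)
    have Es0: "Es 0 \<in> net_intervals (Suc n)" using par by (simp add: parent_iff)
    have IH: "dim_row T' = length (neighbours (Suc n) (Es 0))" "dim_col T' = length (neighbours (Suc n + L) (Es L))"
      "\<And>j k. j < dim_row T' \<Longrightarrow> k < dim_col T' \<Longrightarrow> 0 \<le> T' $$ (j, k)"
      "\<And>j k. j < dim_row T' \<Longrightarrow> k < dim_col T' \<Longrightarrow>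
        linked (Suc n) (Es 0) L (Es L) (neighbours (Suc n) (Es 0) ! j) (neighbours (Suc n + L) (Es L) ! k) \<Longrightarrow> 0 < T' $$ (j, k)"
      using Suc.IH[of "Suc n" Es, OF ES Es0] unfolding T'_def[symmetric] Let_def by blast+
    have upt: "[0..<Suc (Suc L)] = 0 # map Suc [0..<Suc L]" by (simp add: map_Suc_upt upt_conv_Cons del: upt_Suc)
    define T where "T = path_transition (map (\<lambda>i. char_vector (n + i) (Ds i)) [0..<Suc (Suc L)])"
    have hd: "map (\<lambda>i. char_vector (Suc n + i) (Es i)) [0..<Suc L] =
       char_vector (Suc n) (Es 0) # map (\<lambda>i. char_vector (Suc n + i) (Es i)) [1..<Suc L]"
      by (simp add: upt_conv_Cons del: upt_Suc)
    have "T = path_transition (char_vector n (Ds 0) # map (\<lambda>i. char_vector (Suc n + i) (Es i)) [0..<Suc L])"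
      unfolding T_def upt by (simp add: Es_def comp_def del: upt_Suc)
    also have "\<dots> = primitive_transition (char_vector n (Ds 0)) (char_vector (Suc n) (Es 0)) * T'"
      unfolding T'_def hd by simp
    finally have T: "T = transition_matrix n (Ds 0) (Es 0) * T'" using primitive_transition_eq[OF par] by simp
    let ?P = "transition_matrix n (Ds 0) (Es 0)"
    have P: "dim_row ?P = length (neighbours n (Ds 0))" "dim_col ?P = length (neighbours (Suc n) (Es 0))"
      "\<And>j i. j < dim_row ?P \<Longrightarrow> i < dim_col ?P \<Longrightarrow> ?P $$ (j, i) = transition_entry n (Ds 0) (Es 0) j i"
      by (simp_all add: transition_matrix_def)
    have dims: "dim_row T = length (neighbours n (Ds 0))" "dim_col T = length (neighbours (n + Suc L) (Ds (Suc L)))"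
      using T P IH by (simp_all add: Es_def)
    have entry: "T $$ (j, k) = (\<Sum>i<dim_row T'. ?P $$ (j, i) * T' $$ (i, k))" if "j < dim_row T" "k < dim_col T" for j k
      using that IH(1) P(2) unfolding T by (simp add: scalar_prod_def lessThan_atLeast0)
    have nn: "0 \<le> ?P $$ (j, i) * T' $$ (i, k)" if "j < dim_row T" "k < dim_col T" "i < dim_row T'" for j i k
      using that P IH T transition_entry_cases(1)[OF Suc.prems(2), of j "Es 0" i] dims by simp
    have "0 < T $$ (j, k)" if jk: "j < dim_row T" "k < dim_col T"
      and l: "linked n (Ds 0) (Suc L) (Ds (Suc L)) (neighbours n (Ds 0) ! j) (neighbours (n + Suc L) (Ds (Suc L)) ! k)" for j k
    proof -
      have sub0: "sub (Es 0) (Ds 0)" using par by (simp add: parent_iff)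
      have "Es i \<in> net_intervals (Suc n + i) \<and> sub (Es i) (Es 0)" if "i \<le> L" for i
        using that
      proof (induction i)
        case (Suc i)
        then have "parent (Suc n + i) (Es i) (Es (Suc i))" using ES by simp
        then show ?case using Suc by (auto simp: parent_iff)
      qed (use Es0 in simp)
      then have EL: "Es L \<in> net_intervals (n + Suc 0 + L)" "sub (Es L) (Es 0)" by simp_all
      have vj: "neighbours n (Ds 0) ! j \<in> nb n (Ds 0)" using set_neighbours[OF Suc.prems(2)] jk dims nth_mem by metis
      have zk: "neighbours (n + Suc L) (Ds (Suc L)) ! k \<in> nb (n + Suc 0 + L) (Es L)"
        using set_neighbours[OF EL(1)] jk dims nth_mem[of k "neighbours (n + Suc L) (Ds (Suc L))"] by (simp add: Es_def)
      obtain w where w: "w \<in> nb (n + Suc 0) (Es 0)" "linked n (Ds 0) (Suc 0) (Es 0) (neighbours n (Ds 0) ! j) w"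
        "linked (n + Suc 0) (Es 0) L (Es L) w (neighbours (n + Suc L) (Ds (Suc L)) ! k)"
        by (rule linked_split[of "Ds 0" n "Es 0" "Suc 0" "Es L" L, OF Suc.prems(2) _ EL(1) sub0 EL(2) vj zk])
           (use Es0 l in \<open>simp_all add: Es_def\<close>)
      obtain i where i: "i < dim_row T'" "w = neighbours (Suc n) (Es 0) ! i"
        using w(1) set_neighbours[OF Es0] IH(1)
        by (metis (no_types, lifting) add_Suc_right add_0_right in_set_conv_nth)
      have "0 < ?P $$ (j, i)"
        using P jk dims i IH(1) w(2) transition_entry_cases(2)[OF Suc.prems(2), of j "Es 0" i] by simp
      moreover have "0 < T' $$ (i, k)"
        using IH(4)[OF i(1), of k] w(3) jk dims IH(2) i(2) by (simp add: Es_def)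
      ultimately have "0 < ?P $$ (j, i) * T' $$ (i, k)" by simp
      also have "\<dots> \<le> T $$ (j, k)" unfolding entry[OF jk] using nn[OF jk] i(1) by (intro member_le_sum) auto
      finally show ?thesis .
    qed
    moreover have "0 \<le> T $$ (j, k)" if jk: "j < dim_row T" "k < dim_col T" for j k
      unfolding entry[OF jk] using nn[OF jk] by (intro sum_nonneg) auto
    ultimately show ?case unfolding T_def[symmetric] Let_def using dims by blast
  qed
  then show "dim_row T = length (neighbours n (Ds 0))" "dim_col T = length (neighbours (n + L) (Ds L))"
    "j < dim_row T \<Longrightarrow> k < dim_col T \<Longrightarrow> 0 \<le> T $$ (j, k)"
    "j < dim_row T \<Longrightarrow> k < dim_col T \<Longrightarrow> linked n (Ds 0) L (Ds L) (neighbours n (Ds 0) ! j) (neighbours (n + L) (Ds L) ! k) \<Longrightarrow> 0 < T $$ (j, k)"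
    unfolding T_def Let_def by blast+
qed

end

section \<open>Consequences of the positive row property: connectors\<close>

locale ft_ssm = self_similar_measure m rho d K p mu + ft_ifs m rho d K n0 R0 nR R
  for m rho d K p mu n0 R0 nR R +
  assumes prp: positive_row_property
begin

lemma row_child:
  assumes "essential n D" "parent n D E" "v \<in> nb n D"
  obtains w where "w \<in> nb (Suc n) E" "linked n D (Suc 0) E v w"
proof -
  have D: "D \<in> net_intervals n" and E: "E \<in> net_intervals (Suc n)" using assms(2) by (simp_all add: parent_iff)
  have cv: "child_vec (char_vector n D) (char_vector (Suc n) E)" unfolding child_vec_def using assms(2) by blast
  have "essential (Suc n) E" using essential_desc[OF assms(1), of E "Suc 0"] assms(2) by (simp add: parent_iff)
  then have O: "char_vector n D \<in> Omega0" "char_vector (Suc n) E \<in> Omega0" using assms(1) by (simp_all add: essential_def)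
  obtain j where j: "j < length (neighbours n D)" "v = neighbours n D ! j"
    using assms(3) set_neighbours[OF D] by (metis in_set_conv_nth)
  have "\<exists>k<dim_col (transition_matrix n D E). transition_matrix n D E $$ (j, k) \<noteq> 0"
    using prp O cv j(1) unfolding positive_row_property_def primitive_transition_eq[OF assms(2), symmetric]
    by (metis (no_types, lifting) assms(2) dim_row_mat(1) primitive_transition_eq transition_matrix_def)
  then obtain k where k: "k < length (neighbours (Suc n) E)" "transition_entry n D E j k \<noteq> 0"
    using j by (auto simp: transition_matrix_def)
  then have "linked n D (Suc 0) E v (neighbours (Suc n) E ! k)"
    using transition_entry_cases[OF D j(1), of E k] j(2) by simp
  moreover have "neighbours (Suc n) E ! k \<in> nb (Suc n) E" using k(1) set_neighbours[OF E] nth_mem by blast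
  ultimately show ?thesis using that by blast
qed

text \<open>Essential net intervals have essential descendants, so the positive row property applies
  at every step: each neighbour survives into each descendant.\<close>

lemma row_desc:
  assumes "essential n D" "E \<in> net_intervals (n + k)" "sub E D" "v \<in> nb n D"
  shows "\<exists>w\<in>nb (n + k) E. linked n D k E v w"
  using assms(2,3)
proof (induction k arbitrary: E)
  case 0
  then have "E = D" using netD(3)[of E n] netD(3)[OF essential_net[OF assms(1)]] essential_net[OF assms(1)]
    by (intro net_eqI[of E n D]) auto
  then show ?case using assms(4) by (intro bexI[of _ v]) (auto simp: linked_def)
next
  case (Suc k)
  obtain P where P: "parent (n + k) P E" "P \<in> net_intervals (n + k)" "sub P D"
    using net_parent[OF essential_net[OF assms(1)] Suc.prems] .
  obtain w where w: "w \<in> nb (n + k) P" "linked n D k P v w" using Suc.IH[OF P(2,3)] by blast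
  obtain z where z: "z \<in> nb (Suc (n + k)) E" "linked (n + k) P (Suc 0) E w z"
    using row_child[OF essential_desc[OF assms(1) P(2,3)] P(1) w(1)] .
  show ?case using linked_trans[OF w(2) z(2)] z(1) by auto
qed

text \<open>Choose a deep net interval around a point of \<open>K\<close> inside \<open>D\<close>.
  By \<open>row_desc\<close> it has a neighbour linked to \<open>v\<close>, and the corresponding
  word interval contains the point and is too short to reach the ends of \<open>D\<close>.\<close>

lemma dive_word:
  assumes "essential n D" "v \<in> nb n D"
  obtains u k t where "u \<in> words n" "off u = fst D - rho ^ n * v" "t \<in> words k"
    "fst D < off (u @ t)" "off (u @ t) + rho ^ (n + k) < snd D"
proof -
  have D: "D \<in> net_intervals n" using assms by (simp add: essential_def)
  obtain x where x: "x \<in> K" "fst D < x" "x < snd D" using netD(5)[OF D] by auto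
  define e where "e = min (x - fst D) (snd D - x)"
  have "0 < e" using x by (simp add: e_def)
  then obtain N where N: "rho ^ (n + N) < e" using rho_pow_small[of e] by (metis le_add2)
  obtain E' where E': "E' \<in> net_intervals (n + N)" "fst E' \<le> x" "x \<le> snd E'" "sub E' D" using net_point_in[OF x(1) D x(2,3)] .
  obtain w where w: "w \<in> nb (n + N) E'" "linked n D N E' v w" using row_desc[OF assms(1) E'(1,4) assms(2)] by blast
  obtain u where "u \<in> cov n D" and u: "off u = fst D - rho ^ n * v" using nbD[OF assms(2)] .
  then have uw: "u \<in> words n" by (simp add: cov_def)
  obtain t where t: "t \<in> words N" "off (u @ t) = fst E' - rho ^ (n + N) * w" using linked_wordE[OF w(2) uw u] .
  have ut: "u @ t \<in> words (n + N)" using words_append[OF uw t(1)] .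
  have "u @ t \<in> cov (n + N) E'" using nb_cov[OF w(1) ut t(2)] .
  then have "fst D < off (u @ t)" "off (u @ t) + rho ^ (n + N) < snd D"
    using E' N unfolding cov_def e_def by auto
  then show ?thesis using that uw u t(1) by blast
qed

text \<open>The image of \<open>R\<close> under the word \<open>u @ t\<close> has vector
  \<open>alpha\<close>, and by \<open>shift_R_nb\<close> all its neighbours come from extensions of
  that word, that is, from \<open>v\<close>.\<close>

lemma dive:
  assumes "essential n D" "v \<in> nb n D"
  obtains k E where "0 < k" "E \<in> net_intervals (n + k)" "fst D < fst E" "snd E < snd D"
    "char_vector (n + k) E = alpha" "\<And>w. w \<in> nb (n + k) E \<Longrightarrow> linked n D k E v w"
proof -
  obtain u N t where u: "u \<in> words n" "off u = fst D - rho ^ n * v" and t: "t \<in> words N"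
    and in_D: "fst D < off (u @ t)" "off (u @ t) + rho ^ (n + N) < snd D" using dive_word[OF assms] .
  have ut: "u @ t \<in> words (n + N)" using words_append[OF u(1) t] .
  let ?F = "shiftI (u @ t) R"
  show ?thesis
  proof (rule that[of "N + nR" ?F])
    show "0 < N + nR" by (simp add: nR)
    show "?F \<in> net_intervals (n + (N + nR))" "char_vector (n + (N + nR)) ?F = alpha"
      using shift_R(1,2)[OF ut] by (simp_all only: add.assoc)
    show "fst D < fst ?F" "snd ?F < snd D" using in_D shift_R_bounds[OF ut] by linarith+
    fix z assume "z \<in> nb (n + (N + nR)) ?F"
    then have "z \<in> nb nR R" using shift_R(3)[OF ut] by (simp add: sim_def add.assoc)
    then obtain b where b: "b \<in> words nR" "off ((u @ t) @ b) = fst ?F - rho ^ (n + N + nR) * z" using shift_R_nb[OF ut] by blast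
    show "linked n D (N + nR) ?F v z"
      by (rule linked_word[OF u words_append[OF t b(1)]]) (use b(2) in \<open>simp add: add.assoc\<close>)
  qed
qed

text \<open>The single number \<open>B\<close> bounds the depth from above and, through its
  reciprocal, the margin on both sides in units of the scale of \<open>D\<close>; this monotone form
  suits \<open>finite_types_bound\<close>.\<close>

definition conn :: "nat \<Rightarrow> nat \<Rightarrow> net_interval \<Rightarrow> nat \<Rightarrow> net_interval \<Rightarrow> bool" where
  "conn B n D k E \<longleftrightarrow> 0 < k \<and> k \<le> B \<and> E \<in> net_intervals (n + k) \<and> char_vector (n + k) E = alpha \<and>
     fst D + rho ^ n / (1 + real B) \<le> fst E \<and> snd E + rho ^ n / (1 + real B) \<le> snd D \<and>
     (\<forall>v\<in>nb n D. \<forall>w\<in>nb (n + k) E. linked n D k E v w)"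

lemma conn_sub: "conn B n D k E \<Longrightarrow> sub E D"
proof -
  assume c: "conn B n D k E"
  have "0 \<le> rho ^ n / (1 + real B)" by simp
  then show ?thesis using c unfolding conn_def by linarith
qed

text \<open>The rows of the transition matrix are made positive one after another: diving into the image of
  the core under a word through neighbour \<open>v\<close> makes row \<open>v\<close> positive, and the positive row property
  keeps the rows that are already positive.\<close>

lemma conn_essential:
  assumes "essential n D" shows "\<exists>B k E. conn B n D k E"
proof -
  have D: "D \<in> net_intervals n" using assms by (simp add: essential_def)
  have "\<exists>k E. 0 < k \<and> E \<in> net_intervals (n + k) \<and> fst D < fst E \<and> snd E < snd D \<and>
    char_vector (n + k) E = alpha \<and> (\<forall>v\<in>U. \<forall>w\<in>nb (n + k) E. linked n D k E v w)" if "finite U" "U \<subseteq> nb n D" for U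
    using that
  proof (induction U)
    case empty
    obtain v where "v \<in> nb n D" using nb_nonempty[OF D] by blast
    then show ?case using dive[OF assms] by (metis empty_iff)
  next
    case (insert v U)
    then obtain k E where E: "0 < k" "E \<in> net_intervals (n + k)" "fst D < fst E" "snd E < snd D"
      "char_vector (n + k) E = alpha" "\<And>v w. v \<in> U \<Longrightarrow> w \<in> nb (n + k) E \<Longrightarrow> linked n D k E v w" by auto
    have "sub E D" using E by simp
    then obtain w where w: "w \<in> nb (n + k) E" "linked n D k E v w"
      using row_desc[OF assms E(2)] insert.prems by blast
    obtain l F where F: "0 < l" "F \<in> net_intervals (n + k + l)" "fst E < fst F" "snd F < snd E"
      "char_vector (n + k + l) F = alpha" "\<And>z. z \<in> nb (n + k + l) F \<Longrightarrow> linked (n + k) E l F w z"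
      using dive[OF essential_alpha[OF E(2,5)] w(1)] by blast
    have "linked n D (k + l) F v' z" if "v' \<in> insert v U" "z \<in> nb (n + (k + l)) F" for v' z
      using linked_trans[of n D k E v' w l F z] that w E(6)[of v' w] F(6)[of z] by (auto simp: add.assoc)
    then show ?case using F E by (intro exI[of _ "k + l"] exI[of _ F]) (auto simp: add.assoc)
  qed
  from this[of "nb n D"] obtain k E where E: "0 < k" "E \<in> net_intervals (n + k)" "fst D < fst E" "snd E < snd D"
    "char_vector (n + k) E = alpha" "\<forall>v\<in>nb n D. \<forall>w\<in>nb (n + k) E. linked n D k E v w" by auto
  define e where "e = min (fst E - fst D) (snd D - snd E)"
  have "0 < e" using E by (simp add: e_def)
  obtain B' :: nat where B': "rho ^ n / e < real B'" using reals_Archimedean2 by blast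
  define B where "B = max k B'"
  have "rho ^ n / e < 1 + real B" using B' by (simp add: B_def)
  then have "rho ^ n / (1 + real B) < e" using \<open>0 < e\<close> by (simp add: field_simps)
  then have "conn B n D k E" unfolding conn_def using E by (auto simp: e_def B_def)
  then show ?thesis by blast
qed

lemma conn_mono: "conn B n D k E \<Longrightarrow> B \<le> B' \<Longrightarrow> conn B' n D k E"
proof -
  assume c: "conn B n D k E" and B: "B \<le> B'"
  have "rho ^ n / (1 + real B') \<le> rho ^ n / (1 + real B)" using B by (intro divide_left_mono) auto
  then show ?thesis using c B unfolding conn_def by auto
qed

lemma emb_add: "emb n D n' D' (x + rho ^ n * c) = emb n D n' D' x + rho ^ n' * c"
  by (simp add: emb_def field_simps)

lemma conn_sim:
  assumes "sim n D n' D'" "conn B n D k E" shows "conn B n' D' k (embI n D n' D' E)"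
proof -
  have c: "0 < k" "k \<le> B" "E \<in> net_intervals (n + k)" "char_vector (n + k) E = alpha"
     "fst D + rho ^ n * (1 / (1 + real B)) \<le> fst E" "snd E + rho ^ n * (1 / (1 + real B)) \<le> snd D"
     "\<And>v w. v \<in> nb n D \<Longrightarrow> w \<in> nb (n + k) E \<Longrightarrow> linked n D k E v w" and s: "sub E D"
    using assms(2) conn_sub[OF assms(2)] by (simp_all add: conn_def)
  have nb: "nb n' D' = nb n D" "nb (n' + k) (embI n D n' D' E) = nb (n + k) E"
    using assms(1) sim_desc[OF assms(1) c(3) s] by (simp_all add: sim_def)
  obtain l where l: "k = Suc l" using c(1) by (cases k) auto
  have cv: "char_vector (n' + k) (embI n D n' D' E) = alpha"
    using sim_char_vector[OF assms(1), of E l] c(3,4) s by (simp add: l)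
  have "fst D' + rho ^ n' * (1 / (1 + real B)) \<le> emb n D n' D' (fst E)"
    using emb_le[of n D n' D' "fst D + rho ^ n * (1 / (1 + real B))" "fst E"] c(5) by (simp only: emb_add emb_fst)
  moreover have "emb n D n' D' (snd E) + rho ^ n' * (1 / (1 + real B)) \<le> snd D'"
    using emb_le[of n D n' D' "snd E + rho ^ n * (1 / (1 + real B))" "snd D"] c(6) by (simp only: emb_add emb_snd[OF assms(1)])
  ultimately show ?thesis
    unfolding conn_def nb using c cv sim_desc_net(1)[OF assms(1) c(3) s] linked_emb by auto
qed

lemma conn_bound: obtains B where "\<And>n D. essential n D \<Longrightarrow> \<exists>k E. conn B n D k E"
proof (rule finite_types_bound[where P = "\<lambda>n D B. \<exists>k E. conn B n D k E"])
  show "\<exists>B k E. conn B n D k E" if "essential n D" for n D using conn_essential[OF that] .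
  show "\<exists>k E. conn B' n D k E" if "\<exists>k E. conn B n D k E" "B \<le> B'" for n D B B' using that conn_mono by blast
  show "\<exists>k E. conn B n' D' k E" if "sim n D n' D'" "\<exists>k E. conn B n D k E" for n D n' D' B using that conn_sim by blast
qed (use that in blast)

end

subsection \<open>Loops at a fixed essential characteristic vector\<close>

lemma (in ifs) emb_comp: "emb n A n' D (emb n A (n + k) E x) = emb n A (n' + k) (embI n A n' D E) x"
  by (simp add: emb_def power_add field_simps)

context ft_ssm
begin

definition B :: nat where
  "B = (SOME B. \<forall>n D. essential n D \<longrightarrow> (\<exists>k E. conn B n D k E))"

lemma conn_B:
  assumes "essential n D" obtains k E where "conn B n D k E"
proof -
  have "\<exists>B. \<forall>n D. essential n D \<longrightarrow> (\<exists>k E. conn B n D k E)" using conn_bound by metis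
  from someI_ex[OF this] have "\<forall>n D. essential n D \<longrightarrow> (\<exists>k E. conn B n D k E)" unfolding B_def .
  with assms that show ?thesis by blast
qed

definition gap :: real where "gap = 1 / (1 + real B)"

lemma gap: "0 < gap" "gap \<le> 1"
  by (simp_all add: gap_def)

text \<open>By \<open>mu_ge_mass\<close> it suffices to bound finitely many relative measures away
  from 0. The constant has the form \<open>1 / (1 + real N)\<close> so that
  \<open>finite_types_bound\<close> applies.\<close>

lemma mu_ge_mass_essential:
  obtains c where "0 < c" "\<And>n D. essential n D \<Longrightarrow> c * mass n D \<le> measure mu {fst D..snd D}"
proof -
  obtain N where N: "\<And>n D. essential n D \<Longrightarrow> \<forall>v\<in>nb n D. 1 / (1 + real N) \<le> measure mu {v..v + norm_length n D}"
  proof (rule finite_types_bound[where P = "\<lambda>n D N. \<forall>v\<in>nb n D. 1 / (1 + real N) \<le> measure mu {v..v + norm_length n D}"])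
    fix n D assume ess: "essential n D"
    \<comment> \<open>The word through \<open>v\<close> found by \<open>dive_word\<close> shows, in
      the coordinates of \<open>u\<close>, a whole word interval inside
      \<open>{v..v + norm_length n D}\<close>.\<close>
    have pos: "0 < measure mu {v..v + norm_length n D}" if v: "v \<in> nb n D" for v
    proof -
      obtain u k t where u: "u \<in> words n" "off u = fst D - rho ^ n * v" and t: "t \<in> words k"
        and in_D: "fst D < off (u @ t)" "off (u @ t) + rho ^ (n + k) < snd D" using dive_word[OF ess v] .
      have o: "off (u @ t) = fst D - rho ^ n * v + rho ^ n * off t" using words_length[OF u(1)] u(2) by (simp add: off_append)
      have "rho ^ n * v \<le> rho ^ n * off t" using in_D(1) o by linarith
      then have "v \<le> off t" by simp
      moreover have "rho ^ n * (off t + rho ^ k) \<le> rho ^ n * (v + norm_length n D)"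
        using in_D(2) o snd_eq[of D n] by (simp add: power_add algebra_simps)
      then have "off t + rho ^ k \<le> v + norm_length n D" by simp
      ultimately have "measure mu {off t..off t + rho ^ k} \<le> measure mu {v..v + norm_length n D}"
        by (intro mu_mono) auto
      then show ?thesis using mu_word_ivl[OF t] pw_pos[OF t] by linarith
    qed
    have "\<forall>v\<in>nb n D. \<exists>N::nat. 1 / (1 + real N) \<le> measure mu {v..v + norm_length n D}"
    proof
      fix v assume "v \<in> nb n D"
      from nat_approx_posE[OF pos[OF this]] obtain N where "1 / real (Suc N) < measure mu {v..v + norm_length n D}" .
      then show "\<exists>N::nat. 1 / (1 + real N) \<le> measure mu {v..v + norm_length n D}" by (intro exI[of _ N]) simp
    qed
    from bchoice[OF this] obtain f where f: "\<And>v. v \<in> nb n D \<Longrightarrow> 1 / (1 + real (f v :: nat)) \<le> measure mu {v..v + norm_length n D}" by blast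
    have "1 / (1 + real (Max (f ` nb n D))) \<le> measure mu {v..v + norm_length n D}" if v: "v \<in> nb n D" for v
    proof -
      have "f v \<le> Max (f ` nb n D)" using v by (intro Max_ge) auto
      then have "1 / (1 + real (Max (f ` nb n D))) \<le> 1 / (1 + real (f v))" by (intro divide_left_mono) auto
      then show ?thesis using f[OF v] by linarith
    qed
    then show "\<exists>N. \<forall>v\<in>nb n D. 1 / (1 + real N) \<le> measure mu {v..v + norm_length n D}" by blast
  next
    fix n D and N N' :: nat
    assume h: "\<forall>v\<in>nb n D. 1 / (1 + real N) \<le> measure mu {v..v + norm_length n D}" "N \<le> N'"
    have "1 / (1 + real N') \<le> 1 / (1 + real N)" using h(2) by (intro divide_left_mono) auto
    then show "\<forall>v\<in>nb n D. 1 / (1 + real N') \<le> measure mu {v..v + norm_length n D}" using h(1) by force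
  qed ((simp add: sim_def)[1], rule that, blast)
  have "1 / (1 + real N) * mass n D \<le> measure mu {fst D..snd D}" if "essential n D" for n D
    using mu_ge_mass[OF essential_net[OF that]] N[OF that] by blast
  then show ?thesis using that[of "1 / (1 + real N)"] by simp
qed

lemma card_nb_bound: obtains N where "0 < N" "\<And>n D. essential n D \<Longrightarrow> card (nb n D) \<le> N"
proof -
  obtain N where "\<And>n D. essential n D \<Longrightarrow> card (nb n D) \<le> N"
    by (rule finite_types_bound[where P = "\<lambda>n D N. card (nb n D) \<le> N"]) (auto simp: sim_def)
  then have "\<And>n D. essential n D \<Longrightarrow> card (nb n D) \<le> Suc N" by (meson le_SucI)
  then show ?thesis using that by blast
qed

lemma linked_Q:
  assumes "D \<in> net_intervals n" "E \<in> net_intervals (n + k)" "sub E D" "v \<in> nb n D" "w \<in> nb (n + k) E" "linked n D k E v w"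
  shows "pmin ^ k * Q n D v \<le> Q (n + k) E w"
proof -
  obtain t where t: "t \<in> words k" "off t = (fst E - fst D) / rho ^ n + v - rho ^ k * w"
    using assms(6) by (auto simp: linked_def)
  let ?g = "\<lambda>t. pw t * (let v = rho ^ k * w + off t - (fst E - fst D) / rho ^ n in if v \<in> nb n D then Q n D v else 0)"
  have "pmin ^ k * Q n D v \<le> pw t * Q n D v" using pw_ge[OF t(1)] Q_nonneg by (intro mult_right_mono)
  also have "\<dots> = ?g t" using t(2) assms(4) by (simp add: Let_def)
  also have "\<dots> \<le> (\<Sum>t\<in>words k. ?g t)"
    using t(1) by (intro member_le_sum) (auto simp: Let_def intro!: mult_nonneg_nonneg Q_nonneg dest: pw_pos)
  also have "\<dots> = Q (n + k) E w" using Q_desc[OF assms(1-3,5)] by simp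
  finally show ?thesis .
qed

text \<open>Every neighbour \<open>w\<close> receives at least the fraction \<open>pmin ^ B\<close>
  of each entry of \<open>Q n D\<close>. Summing over the entries costs a factor \<open>N\<close>, a
  bound for their number.\<close>

lemma conn_mass:
  obtains c where "0 < c" "\<And>n D k E w. essential n D \<Longrightarrow> conn B n D k E \<Longrightarrow> w \<in> nb (n + k) E \<Longrightarrow> c * mass n D \<le> Q (n + k) E w"
proof -
  obtain N where N: "0 < N" "\<And>n D. essential n D \<Longrightarrow> card (nb n D) \<le> N"
    using card_nb_bound by blast
  have "pmin ^ B / real N * mass n D \<le> Q (n + k) E w" if e: "essential n D" and c: "conn B n D k E" and w: "w \<in> nb (n + k) E" for n D k E w
  proof -
    have D: "D \<in> net_intervals n" using essential_net[OF e] .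
    have E: "k \<le> B" "E \<in> net_intervals (n + k)" "sub E D" "\<And>v. v \<in> nb n D \<Longrightarrow> linked n D k E v w"
      using c conn_sub[OF c] w by (auto simp: conn_def)
    have "pmin ^ B * mass n D \<le> pmin ^ k * mass n D"
      using pmin mass_pos[OF D] E(1) by (intro mult_right_mono power_decreasing) auto
    also have "\<dots> = (\<Sum>v\<in>nb n D. pmin ^ k * Q n D v)" by (simp add: mass_eq sum_distrib_left)
    also have "\<dots> \<le> (\<Sum>v\<in>nb n D. Q (n + k) E w)" using linked_Q[OF D E(2,3) _ w] E(4) by (intro sum_mono) auto
    also have "\<dots> \<le> real N * Q (n + k) E w"
      using N(2)[OF e] Q_nonneg by (simp add: mult_right_mono)
    finally show ?thesis using N(1) by (simp add: field_simps)
  qed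
  moreover have "0 < pmin ^ B / real N" using pmin N by simp
  ultimately show ?thesis using that by blast
qed

definition cg :: real where
  "cg = (SOME c. 0 < c \<and> (\<forall>n D k E w. essential n D \<longrightarrow> conn B n D k E \<longrightarrow> w \<in> nb (n + k) E \<longrightarrow> c * mass n D \<le> Q (n + k) E w))"

lemma cg: "0 < cg" "essential n D \<Longrightarrow> conn B n D k E \<Longrightarrow> w \<in> nb (n + k) E \<Longrightarrow> cg * mass n D \<le> Q (n + k) E w"
proof -
  have "\<exists>c. 0 < c \<and> (\<forall>n D k E w. essential n D \<longrightarrow> conn B n D k E \<longrightarrow> w \<in> nb (n + k) E \<longrightarrow> c * mass n D \<le> Q (n + k) E w)"
    using conn_mass by metis
  from someI_ex[OF this] show "0 < cg" "essential n D \<Longrightarrow> conn B n D k E \<Longrightarrow> w \<in> nb (n + k) E \<Longrightarrow> cg * mass n D \<le> Q (n + k) E w"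
    unfolding cg_def by blast+
qed

abbreviation comp :: "nat \<Rightarrow> net_interval \<Rightarrow> net_interval \<Rightarrow> net_interval" where
  "comp n D E \<equiv> embI nR R n D E"

text \<open>All entries of the weight vector of a good interval are comparable with their sum, which is why
  composing with it is multiplicative up to a constant.\<close>

definition good :: "nat \<Rightarrow> net_interval \<Rightarrow> bool" where
  "good n D \<longleftrightarrow> D \<in> net_intervals n \<and> char_vector n D = alpha \<and> (\<forall>v\<in>nb n D. cg * mass n D \<le> Q n D v)"

text \<open>A loop may be copied into any net interval with vector \<open>alpha\<close>, where its
  weight vector also depends on the surroundings. The last clause therefore demands goodness of all
  copies, as needed for repeated composition.\<close>

definition loop :: "nat \<Rightarrow> net_interval \<Rightarrow> bool" where
  "loop k E \<longleftrightarrow> 0 < k \<and> E \<in> net_intervals (nR + k) \<and> char_vector (nR + k) E = alpha \<and>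
     fst R + gap * rho ^ (nR + k) \<le> fst E \<and> snd E + gap * rho ^ (nR + k) \<le> snd R \<and>
     (\<forall>v\<in>nb nR R. \<forall>w\<in>nb (nR + k) E. linked nR R k E v w) \<and>
     (\<forall>n D. D \<in> net_intervals n \<longrightarrow> char_vector n D = alpha \<longrightarrow> good (n + k) (comp n D E))"

lemma loopD:
  assumes "loop k E"
  shows "0 < k" "E \<in> net_intervals (nR + k)" "char_vector (nR + k) E = alpha"
     "fst R + gap * rho ^ (nR + k) \<le> fst E" "snd E + gap * rho ^ (nR + k) \<le> snd R"
     "\<And>v w. v \<in> nb nR R \<Longrightarrow> w \<in> nb (nR + k) E \<Longrightarrow> linked nR R k E v w"
     "\<And>n D. D \<in> net_intervals n \<Longrightarrow> char_vector n D = alpha \<Longrightarrow> good (n + k) (comp n D E)"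
     "sub E R" "sim nR R (nR + k) E"
proof -
  show "0 < k" "E \<in> net_intervals (nR + k)" "char_vector (nR + k) E = alpha"
     and m: "fst R + gap * rho ^ (nR + k) \<le> fst E" "snd E + gap * rho ^ (nR + k) \<le> snd R"
     and "\<And>v w. v \<in> nb nR R \<Longrightarrow> w \<in> nb (nR + k) E \<Longrightarrow> linked nR R k E v w"
     "\<And>n D. D \<in> net_intervals n \<Longrightarrow> char_vector n D = alpha \<Longrightarrow> good (n + k) (comp n D E)"
    using assms unfolding loop_def by blast+
  then show "sim nR R (nR + k) E" using alpha_sim by blast
  have "0 \<le> gap * rho ^ (nR + k)" using gap by simp
  then show "sub E R" using m by linarith
qed

lemma char_alpha_R: "char_vector nR R = alpha"
  by (simp add: alpha_def)

lemma comp_R [simp]: "comp nR R E = E"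
  by (simp add: emb_def)

lemma loop_good: "loop k E \<Longrightarrow> good (nR + k) E"
  using loopD(7)[OF _ R_net char_alpha_R, of k E] by simp

lemma comp_assoc: "comp n D (comp (nR + k) E F) = comp (n + k) (comp n D E) F"
  by (simp add: emb_comp)

lemma comp_alpha:
  assumes "D \<in> net_intervals n" "char_vector n D = alpha" "E \<in> net_intervals (nR + k)" "sub E R" "char_vector (nR + k) E = alpha"
  shows "comp n D E \<in> net_intervals (n + k)" "sub (comp n D E) D" "char_vector (n + k) (comp n D E) = alpha"
proof -
  have s: "sim nR R n D" using alpha_sim[OF assms(1,2)] .
  show "comp n D E \<in> net_intervals (n + k)" "sub (comp n D E) D" using sim_desc_net[OF s assms(3,4)] by simp_all
  show "char_vector (n + k) (comp n D E) = alpha"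
  proof (cases k)
    case 0
    then have "E = R" using assms(3,4) netD(3)[OF R_net] netD(3)[OF assms(3)] R_net
      by (intro net_eqI[of E nR R]) auto
    then show ?thesis using 0 assms(2) emb_snd[OF s] by simp
  next
    case (Suc l)
    then show ?thesis using sim_char_vector[OF s, of E l] assms(3-5) by simp
  qed
qed

text \<open>Any descendant of \<open>R\<close> becomes a loop after adding a connector. Goodness of
  every copy is due to the connector alone: it survives transport, and the mass does not grow on the
  way down.\<close>

lemma loop_conn:
  assumes "E' \<in> net_intervals (nR + k)" "sub E' R" "conn B (nR + k) E' l E"
  shows "loop (k + l) E"
proof -
  have c: "0 < l" "E \<in> net_intervals (nR + k + l)" "char_vector (nR + k + l) E = alpha"
    "fst E' + gap * rho ^ (nR + k) \<le> fst E" "snd E + gap * rho ^ (nR + k) \<le> snd E'"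
    "\<And>v w. v \<in> nb (nR + k) E' \<Longrightarrow> w \<in> nb (nR + k + l) E \<Longrightarrow> linked (nR + k) E' l E v w" "sub E E'"
    using assms(3) conn_sub[OF assms(3)] by (simp_all add: conn_def gap_def)
  have ess: "essential (nR + k) E'" using essential_desc[OF essential_R assms(1,2)] .
  have "rho ^ (nR + (k + l)) \<le> rho ^ (nR + k)" using rho_pos rho_less_1 by (intro power_decreasing) auto
  then have "gap * rho ^ (nR + (k + l)) \<le> gap * rho ^ (nR + k)" using gap by (intro mult_left_mono) auto
  then have m: "fst R + gap * rho ^ (nR + (k + l)) \<le> fst E" "snd E + gap * rho ^ (nR + (k + l)) \<le> snd R"
    using c(4,5) assms(2) by linarith+
  have links: "linked nR R (k + l) E v w" if v: "v \<in> nb nR R" and w: "w \<in> nb (nR + (k + l)) E" for v w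
  proof -
    obtain v' where v': "v' \<in> nb (nR + k) E'" "linked nR R k E' v v'" using row_desc[OF essential_R assms(1,2) v] by blast
    show ?thesis using linked_trans[OF v'(2) c(6)[OF v'(1)]] w by (simp add: add.assoc)
  qed
  have gd: "good (n + (k + l)) (comp n D E)" if D: "D \<in> net_intervals n" "char_vector n D = alpha" for n D
  proof -
    have s: "sim nR R n D" using alpha_sim[OF D] .
    have E'': "comp n D E' \<in> net_intervals (n + k)" "sim (nR + k) E' (n + k) (comp n D E')"
      "sub (comp n D E') D"
      using sim_desc_net[OF s assms(1,2)] sim_desc[OF s assms(1,2)] by simp_all
    have "conn B (n + k) (comp n D E') l (comp n D E)"
      using conn_sim[OF E''(2) assms(3)] by (simp only: emb_emb)
    moreover have e: "essential (n + k) (comp n D E')" using essential_desc[OF essential_alpha[OF D] E''(1,3)] .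
    ultimately have cn: "comp n D E \<in> net_intervals (n + k + l)" "char_vector (n + k + l) (comp n D E) = alpha"
      "sub (comp n D E) (comp n D E')" "\<And>w. w \<in> nb (n + k + l) (comp n D E) \<Longrightarrow> cg * mass (n + k) (comp n D E') \<le> Q (n + k + l) (comp n D E) w"
      using cg(2) conn_sub unfolding conn_def by blast+
    have "cg * mass (n + k + l) (comp n D E) \<le> cg * mass (n + k) (comp n D E')"
      using mass_desc[OF E''(1) cn(1,3)] cg(1) by simp
    then show ?thesis unfolding good_def using cn by (force simp: add.assoc)
  qed
  show ?thesis unfolding loop_def using c m links gd by (auto simp: add.assoc)
qed

lemma comp_margin:
  assumes "D \<in> net_intervals n" "char_vector n D = alpha" "loop k E"
  shows "fst D + gap * rho ^ (n + k) \<le> fst (comp n D E)" "snd (comp n D E) + gap * rho ^ (n + k) \<le> snd D"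
proof -
  have s: "sim nR R n D" using alpha_sim[OF assms(1,2)] .
  \<comment> \<open>The margin is written as a multiple of \<open>rho ^ nR\<close> to let
    \<open>emb_add\<close> rescale it.\<close>
  have "emb nR R n D (fst R + rho ^ nR * (gap * rho ^ k)) \<le> emb nR R n D (fst E)"
    using loopD(4)[OF assms(3)] by (simp add: power_add mult.left_commute mult.commute)
  then show "fst D + gap * rho ^ (n + k) \<le> fst (comp n D E)"
    by (simp only: emb_add emb_fst fst_conv) (simp add: power_add mult.left_commute mult.commute)
  have "emb nR R n D (snd E + rho ^ nR * (gap * rho ^ k)) \<le> emb nR R n D (snd R)"
    using loopD(5)[OF assms(3)] by (simp add: power_add mult.left_commute mult.commute)
  then show "snd (comp n D E) + gap * rho ^ (n + k) \<le> snd D"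
    by (simp only: emb_add emb_snd[OF s] snd_conv) (simp add: power_add mult.left_commute mult.commute)
qed

text \<open>Links compose through any intermediate neighbour since both factors are fully linked.
  Goodness is that of \<open>F\<close>, read in the copy of \<open>E\<close>.\<close>

lemma loop_comp:
  assumes "loop k E" "loop l F" shows "loop (k + l) (comp (nR + k) E F)"
proof -
  note E = loopD[OF assms(1)] and F = loopD[OF assms(2)]
  let ?G = "comp (nR + k) E F"
  have G: "?G \<in> net_intervals (nR + k + l)" "sub ?G E" "char_vector (nR + k + l) ?G = alpha"
    using comp_alpha[OF E(2,3) F(2,8,3)] by simp_all
  have m: "fst R + gap * rho ^ (nR + (k + l)) \<le> fst ?G" "snd ?G + gap * rho ^ (nR + (k + l)) \<le> snd R"
    using comp_margin[OF E(2,3) assms(2)] E(8) unfolding add.assoc by linarith+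
  have sF: "sim nR R (nR + k) E" using E(9) .
  have links: "linked nR R (k + l) ?G v w" if v: "v \<in> nb nR R" and w: "w \<in> nb (nR + (k + l)) ?G" for v w
  proof -
    obtain v' where v': "v' \<in> nb (nR + k) E" using nb_nonempty[OF E(2)] by blast
    have w': "w \<in> nb (nR + l) F" using w sim_desc[OF sF F(2,8)] by (simp add: sim_def add.assoc)
    have "v' \<in> nb nR R" using v' E(9) by (simp add: sim_def)
    then have "linked nR R l F v' w" using F(6) w' by blast
    then have "linked (nR + k) E l ?G v' w" by (simp only: linked_emb)
    then show ?thesis using linked_trans[OF E(6)[OF v v']] by blast
  qed
  have gd: "good (n + (k + l)) (comp n D ?G)" if D: "D \<in> net_intervals n" "char_vector n D = alpha" for n D
    using F(7)[OF comp_alpha(1,3)[OF D E(2,8,3)]] unfolding comp_assoc by (simp add: add.assoc)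
  show ?thesis unfolding loop_def using E(1) G m links gd by (auto simp: add.assoc)
qed

text \<open>All entries of a good vector are at least \<open>cg * mass n D\<close>, whereas those of
  \<open>Q nR R\<close> are at most 1. So one vector dominates a multiple of the other, and
  monotonicity carries this to the descendants.\<close>

lemma good_mass_lower:
  assumes "good n D" "E \<in> net_intervals (nR + k)" "sub E R"
  shows "cg * mass n D * mass (nR + k) E \<le> mass (n + k) (comp n D E)"
proof -
  have D: "D \<in> net_intervals n" "char_vector n D = alpha" "\<And>v. v \<in> nb n D \<Longrightarrow> cg * mass n D \<le> Q n D v"
    using assms(1) by (simp_all add: good_def)
  have s: "sim nR R n D" using alpha_sim[OF D(1,2)] .
  have "cg * mass n D * Q nR R v \<le> Q n D v" if v: "v \<in> nb n D" for v
  proof -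
    have vR: "v \<in> nb nR R" using v s by (simp add: sim_def)
    have "cg * mass n D * Q nR R v \<le> cg * mass n D"
      using Q_le_mass[OF vR] mass_le_1[of nR R] cg(1) mass_pos[OF D(1)] Q_nonneg[of nR R v] by (intro mult_left_le) auto
    then show ?thesis using D(3)[OF v] by linarith
  qed
  from mass_mono[OF sim_sym[OF s] this sim_desc_net[OF s assms(2,3)]] show ?thesis by simp
qed

text \<open>The reverse domination: entries of \<open>Q n D\<close> are at most its mass, and those
  of \<open>Q nR R\<close> are at least \<open>pmin ^ nR\<close>.\<close>

lemma alpha_mass_upper:
  assumes "D \<in> net_intervals n" "char_vector n D = alpha" "E \<in> net_intervals (nR + k)" "sub E R"
  shows "pmin ^ nR * mass (n + k) (comp n D E) \<le> mass n D * mass (nR + k) E"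
proof -
  have s: "sim nR R n D" using alpha_sim[OF assms(1,2)] .
  have mp: "0 < mass n D" using mass_pos[OF assms(1)] .
  have "pmin ^ nR / mass n D * Q n D v \<le> Q nR R v" if v: "v \<in> nb nR R" for v
  proof -
    have vD: "v \<in> nb n D" using v s by (simp add: sim_def)
    have "pmin ^ nR / mass n D * Q n D v \<le> pmin ^ nR / mass n D * mass n D"
      using Q_le_mass[OF vD] pmin(1) mp by (intro mult_left_mono) auto
    then show ?thesis using Q_ge[OF v] mp by simp
  qed
  from mass_mono[OF s this assms(3,4)] show ?thesis using mp by (simp add: field_simps)
qed

section \<open>Logarithmic weights and their quasi-additivity\<close>

definition lm :: "nat \<Rightarrow> net_interval \<Rightarrow> real" where "lm n D = - ln (mass n D)"

text \<open>The two terms are the logarithmic costs in \<open>good_mass_lower\<close> and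
  \<open>alpha_mass_upper\<close>.\<close>

definition C0 :: real where "C0 = max (- ln cg) (- ln (pmin ^ nR))"

lemma lm_nonneg: "D \<in> net_intervals n \<Longrightarrow> 0 \<le> lm n D"
  using mass_pos[of D n] mass_le_1[of n D] by (simp add: lm_def)

lemma lm_le: "D \<in> net_intervals n \<Longrightarrow> lm n D \<le> real n * - ln pmin"
proof -
  assume D: "D \<in> net_intervals n"
  have "ln (pmin ^ n) \<le> ln (mass n D)" using mass_ge[OF D] pmin(1) by (intro ln_mono) auto
  then show ?thesis using pmin(1) by (simp add: lm_def ln_realpow)
qed

lemma C0_nonneg: "0 \<le> C0"
proof -
  have "pmin ^ nR \<le> 1" using pmin by (simp add: power_le_one)
  then have "0 \<le> - ln (pmin ^ nR)" using pmin(1) by (simp del: ln_realpow)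
  then show ?thesis by (simp add: C0_def del: ln_realpow)
qed

lemma comp_quasi:
  assumes "good n D" "E \<in> net_intervals (nR + k)" "sub E R"
  shows "\<bar>lm (n + k) (comp n D E) - lm n D - lm (nR + k) E\<bar> \<le> C0"
proof -
  have D: "D \<in> net_intervals n" "char_vector n D = alpha" using assms(1) by (simp_all add: good_def)
  have net: "comp n D E \<in> net_intervals (n + k)" using sim_desc_net(1)[OF alpha_sim[OF D] assms(2,3)] .
  have pos: "0 < mass n D" "0 < mass (nR + k) E" "0 < mass (n + k) (comp n D E)"
    using mass_pos D(1) assms(2) net by blast+
  have "ln (cg * mass n D * mass (nR + k) E) \<le> ln (mass (n + k) (comp n D E))"
    using good_mass_lower[OF assms] pos cg(1) by (intro ln_mono) auto
  then have 1: "lm (n + k) (comp n D E) - lm n D - lm (nR + k) E \<le> - ln cg"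
    using pos cg(1) by (simp add: lm_def ln_mult)
  have "ln (pmin ^ nR * mass (n + k) (comp n D E)) \<le> ln (mass n D * mass (nR + k) E)"
    using alpha_mass_upper[OF D assms(2,3)] pos pmin(1) by (intro ln_mono) auto
  then have 2: "ln (pmin ^ nR) \<le> lm (n + k) (comp n D E) - lm n D - lm (nR + k) E"
    using pos pmin(1) by (simp add: lm_def ln_mult)
  show ?thesis using 1 2 by (auto simp: C0_def)
qed

lemma lm_conn:
  assumes "essential n D" "conn B n D k E"
  shows "\<bar>lm (n + k) E - lm n D\<bar> \<le> C0"
proof -
  have D: "D \<in> net_intervals n" using essential_net[OF assms(1)] .
  have E: "E \<in> net_intervals (n + k)" "sub E D" using assms(2) conn_sub[OF assms(2)] by (simp_all add: conn_def)
  obtain w where w: "w \<in> nb (n + k) E" using nb_nonempty[OF E(1)] by blast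
  have "cg * mass n D \<le> mass (n + k) E" using cg(2)[OF assms w] Q_le_mass[OF w] by linarith
  then have "ln (cg * mass n D) \<le> ln (mass (n + k) E)" using cg(1) mass_pos[OF D] by (intro ln_mono) auto
  then have "lm (n + k) E - lm n D \<le> - ln cg" using cg(1) mass_pos[OF D] by (simp add: lm_def ln_mult)
  moreover have "ln (mass (n + k) E) \<le> ln (mass n D)" using mass_desc[OF D E] mass_pos[OF E(1)] by (intro ln_mono) auto
  then have "lm n D \<le> lm (n + k) E" by (simp add: lm_def)
  ultimately show ?thesis by (auto simp: C0_def)
qed

end

subsection \<open>Local dimensions along nested sequences\<close>

text \<open>Iteration gives \<open>b (i * j)\<close> up to \<open>i * C\<close> from
  \<open>b j\<close>, so two quotients are compared through the common multiple of their indices.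
  The last bound is what yields the error \<open>O(1/k)\<close> for the rate of a repeated
  loop.\<close>

lemma quasi_additive_limit:
  fixes b :: "nat \<Rightarrow> real"
  assumes "\<And>i j. 0 < i \<Longrightarrow> 0 < j \<Longrightarrow> \<bar>b (i + j) - b i - b j\<bar> \<le> C"
  obtains l where "(\<lambda>i. b i / real i) \<longlonglongrightarrow> l" "\<bar>l - b 1\<bar> \<le> C"
proof -
  have mult: "\<bar>b (i * j) - real i * b j\<bar> \<le> real i * C" if "0 < i" "0 < j" for i j
    using that(1)
  proof (induction i rule: nat_induct_non_zero)
    case 1
    have "0 \<le> C" using assms[of 1 1] by simp
    then show ?case by simp
  next
    case (Suc i)
    have "\<bar>b (i * j + j) - b (i * j) - b j\<bar> \<le> C" using assms Suc.hyps that(2) by simp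
    then show ?case using Suc.IH by (simp add: algebra_simps)
  qed
  have quot: "\<bar>b (i * j) / real (i * j) - b j / real j\<bar> \<le> C / real j" if "0 < i" "0 < j" for i j
  proof -
    have "b (i * j) / real (i * j) - b j / real j = (b (i * j) - real i * b j) / real (i * j)"
      using that by (simp add: field_simps)
    then have "\<bar>b (i * j) / real (i * j) - b j / real j\<bar> = \<bar>b (i * j) - real i * b j\<bar> / real (i * j)"
      by (simp only: abs_divide abs_of_nat)
    also have "\<dots> \<le> (real i * C) / real (i * j)"
      by (rule divide_right_mono[OF mult[OF that]]) simp
    finally have "\<bar>b (i * j) / real (i * j) - b j / real j\<bar> \<le> (real i * C) / real (i * j)" .
    then show ?thesis using that by simp
  qed
  have cmp: "\<bar>b i / real i - b j / real j\<bar> \<le> C / real i + C / real j" if "0 < i" "0 < j" for i j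
    using quot[OF that] quot[OF that(2,1)] by (simp add: mult.commute)
  have C: "0 \<le> C" using assms[of 1 1] by simp
  have "Cauchy (\<lambda>i. b i / real i)"
  proof (rule metric_CauchyI)
    fix e :: real assume e: "0 < e"
    obtain M :: nat where M: "2 * C / e < real M" using reals_Archimedean2 by blast
    have "C / real i < e / 2" if "i \<ge> Suc M" for i
    proof -
      have "2 * C / e < real i" using M that by linarith
      then show ?thesis using e that by (simp add: field_simps)
    qed
    note small = this
    have "dist (b i / real i) (b j / real j) < e" if ij: "i \<ge> Suc M" "j \<ge> Suc M" for i j
    proof -
      have "0 < i" "0 < j" using ij by simp_all
      from cmp[OF this] small[OF ij(1)] small[OF ij(2)] show ?thesis unfolding dist_real_def by linarith
    qed
    then show "\<exists>M. \<forall>i\<ge>M. \<forall>j\<ge>M. dist (b i / real i) (b j / real j) < e" by blast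
  qed
  then obtain l where l: "(\<lambda>i. b i / real i) \<longlonglongrightarrow> l" using Cauchy_convergent_iff convergent_def by blast
  have "\<bar>l - b 1\<bar> \<le> C"
  proof (rule LIMSEQ_le_const2)
    show "(\<lambda>i. \<bar>b i / real i - b 1\<bar>) \<longlonglongrightarrow> \<bar>l - b 1\<bar>" using l by (intro tendsto_intros)
    show "\<exists>N. \<forall>n\<ge>N. \<bar>b n / real n - b 1\<bar> \<le> C" using quot[of _ 1] by (intro exI[of _ 1]) auto
  qed
  then show ?thesis using that l by blast
qed

lemma strict_mono_nat_between:
  fixes N :: "nat \<Rightarrow> nat"
  assumes "strict_mono N" "N 0 \<le> n"
  obtains i where "N i \<le> n" "n < N (Suc i)"
proof -
  have "finite {i. N i \<le> n}"
    by (rule finite_subset[of _ "{..n}"]) (use strict_mono_imp_increasing[OF assms(1)] order_trans in auto)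
  moreover have "{i. N i \<le> n} \<noteq> {}" using assms(2) by blast
  ultimately have M: "Max {i. N i \<le> n} \<in> {i. N i \<le> n}" and "\<And>i. N i \<le> n \<Longrightarrow> i \<le> Max {i. N i \<le> n}"
    using Max_in Max_ge by auto
  from this(2)[of "Suc (Max {i. N i \<le> n})"] have "n < N (Suc (Max {i. N i \<le> n}))" by force
  then show ?thesis using that M by blast
qed

section \<open>Local dimensions from balls of radius \<open>rho ^ n\<close>\<close>

context ifs
begin

abbreviation Lam :: real where "Lam \<equiv> - ln rho"

lemma Lam_pos: "0 < - ln rho"
  using rho_pos rho_less_1 by simp

lemma ln_rho_pow: "- ln (rho ^ n) = real n * Lam"
  using rho_pos by (simp add: ln_realpow)

lemma scale_bracket:
  assumes "0 < r" "r \<le> rho ^ M"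
  obtains n where "n \<ge> M" "rho ^ Suc n < r" "r \<le> rho ^ n"
proof -
  obtain N where N: "\<And>n. n \<ge> N \<Longrightarrow> rho ^ n < r" using rho_pow_small[OF assms(1)] by blast
  define A where "A = {n. r \<le> rho ^ n}"
  have "A \<subseteq> {..N}"
  proof
    fix n assume "n \<in> A"
    then have "\<not> N \<le> n" using N[of n] by (auto simp: A_def)
    then show "n \<in> {..N}" by simp
  qed
  then have "finite A" using finite_subset by blast
  moreover have "M \<in> A" using assms by (simp add: A_def)
  ultimately have M: "Max A \<in> A" "M \<le> Max A" and mx: "\<And>n. n \<in> A \<Longrightarrow> n \<le> Max A"
    using Max_in[of A] Max_ge[of A] by blast+
  have "Suc (Max A) \<notin> A" using mx[of "Suc (Max A)"] by auto
  note M = M this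
  then show ?thesis using that[of "Max A"] by (auto simp: A_def)
qed

lemma inv_ln_tendsto: "((\<lambda>r. a + C / ln r) \<longlongrightarrow> (a::real)) (at_right 0)"
proof -
  have "((\<lambda>r. C / ln r) \<longlongrightarrow> 0) (at_right 0)"
    by (rule tendsto_divide_0[OF tendsto_const]) (rule filterlim_at_bot_imp_at_infinity[OF ln_at_0])
  from tendsto_add[OF tendsto_const this, of a] show ?thesis by simp
qed

text \<open>A radius between two consecutive powers is enlarged to the larger one; the bounded error
  disappears after division by \<open>ln r\<close>.\<close>

lemma ball_dim_lower:
  fixes F :: "real \<Rightarrow> real"
  assumes pos: "\<And>r. 0 < r \<Longrightarrow> 0 < F r" and mono: "\<And>r s. 0 < r \<Longrightarrow> r \<le> s \<Longrightarrow> F r \<le> F s"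
    and lo: "\<And>n. n \<ge> M \<Longrightarrow> a * (real n * Lam) - C \<le> - ln (F (rho ^ n))"
  shows "ereal a \<le> Liminf (at_right 0) (\<lambda>r. ereal (ln (F r) / ln r))"
proof -
  \<comment> \<open>The term \<open>\<bar>a\<bar> * Lam\<close> pays for replacing
    \<open>- ln r\<close> by the logarithm of the neighbouring power.\<close>
  define C' where "C' = \<bar>a\<bar> * Lam + \<bar>C\<bar>"
  have "\<forall>\<^sub>F r in at_right 0. ereal (a + C' / ln r) \<le> ereal (ln (F r) / ln r)"
    unfolding eventually_at_right_field
  proof (intro exI[of _ "rho ^ Suc M"] conjI allI impI)
    fix r :: real assume r: "0 < r" "r < rho ^ Suc M"
    have "rho ^ Suc M \<le> rho ^ M" "rho ^ Suc M < 1" using rho_pos rho_less_1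
      by (auto intro!: power_decreasing simp del: power_Suc intro: power_Suc_less_one)
    then have r1: "r < 1" "r \<le> rho ^ M" using r by linarith+
    obtain n where n: "n \<ge> M" "rho ^ Suc n < r" "r \<le> rho ^ n" using scale_bracket[OF r(1) r1(2)] .
    define s where "s = - ln r"
    have s: "0 < s" using r1 r by (simp add: s_def)
    have "ln r \<le> ln (rho ^ n)" using n r by (intro ln_mono) auto
    then have s1: "real n * Lam \<le> s" using ln_rho_pow[of n] by (simp add: s_def)
    have "ln (rho ^ Suc n) < ln r" using n(2) r by (intro ln_strict_mono) (auto simp del: power_Suc)
    then have s2: "s \<le> real n * Lam + Lam" using ln_rho_pow[of "Suc n"] by (simp add: s_def algebra_simps del: power_Suc)
    have "a * s - \<bar>a\<bar> * Lam \<le> a * (real n * Lam)"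
    proof -
      have "\<bar>a * (s - real n * Lam)\<bar> \<le> \<bar>a\<bar> * Lam"
        unfolding abs_mult using s1 s2 by (intro mult_left_mono) auto
      then show ?thesis by (simp add: algebra_simps)
    qed
    then have "a * s - C' \<le> - ln (F (rho ^ n))" using lo[OF n(1)] by (simp add: C'_def)
    also have "ln (F r) \<le> ln (F (rho ^ n))" using pos r n mono by (intro ln_mono) auto
    then have "- ln (F (rho ^ n)) \<le> - ln (F r)" by simp
    finally have "(a * s - C') / s \<le> - ln (F r) / s" using s by (intro divide_right_mono) auto
    moreover have "(a * s - C') / s = a + C' / ln r" using s by (simp add: s_def field_simps)
    moreover have "- ln (F r) / s = ln (F r) / ln r" by (simp add: s_def)
    ultimately show "ereal (a + C' / ln r) \<le> ereal (ln (F r) / ln r)" by simp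
  qed (rule rho_pow_pos)
  then have "Liminf (at_right 0) (\<lambda>r. ereal (a + C' / ln r)) \<le> Liminf (at_right 0) (\<lambda>r. ereal (ln (F r) / ln r))"
    by (rule Liminf_mono)
  moreover have "Liminf (at_right 0) (\<lambda>r. ereal (a + C' / ln r)) = ereal a"
    by (rule lim_imp_Liminf) (auto intro!: tendsto_ereal inv_ln_tendsto)
  ultimately show ?thesis by simp
qed

text \<open>Here a lower bound of the measure is wanted, so the radius is shrunk to
  \<open>rho ^ Suc n\<close>.\<close>

lemma ball_dim_upper:
  fixes F :: "real \<Rightarrow> real"
  assumes pos: "\<And>r. 0 < r \<Longrightarrow> 0 < F r" and mono: "\<And>r s. 0 < r \<Longrightarrow> r \<le> s \<Longrightarrow> F r \<le> F s"
    and up: "\<And>n. n \<ge> M \<Longrightarrow> - ln (F (rho ^ n)) \<le> a * (real n * Lam) + C"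
  shows "Limsup (at_right 0) (\<lambda>r. ereal (ln (F r) / ln r)) \<le> ereal a"
proof -
  define C' where "C' = \<bar>a\<bar> * Lam + \<bar>C\<bar>"
  have "\<forall>\<^sub>F r in at_right 0. ereal (ln (F r) / ln r) \<le> ereal (a + - C' / ln r)"
    unfolding eventually_at_right_field
  proof (intro exI[of _ "rho ^ Suc M"] conjI allI impI)
    fix r :: real assume r: "0 < r" "r < rho ^ Suc M"
    have "rho ^ Suc M \<le> rho ^ M" "rho ^ Suc M < 1" using rho_pos rho_less_1
      by (auto intro!: power_decreasing simp del: power_Suc intro: power_Suc_less_one)
    then have r1: "r < 1" "r \<le> rho ^ M" using r by linarith+
    obtain n where n: "n \<ge> M" "rho ^ Suc n < r" "r \<le> rho ^ n" using scale_bracket[OF r(1) r1(2)] .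
    define s where "s = - ln r"
    have s: "0 < s" using r1 r by (simp add: s_def)
    have "ln r \<le> ln (rho ^ n)" using n r by (intro ln_mono) auto
    then have s1: "real n * Lam \<le> s" using ln_rho_pow[of n] by (simp add: s_def)
    have "ln (rho ^ Suc n) < ln r" using n(2) r by (intro ln_strict_mono) (auto simp del: power_Suc)
    then have s2: "s \<le> real (Suc n) * Lam" using ln_rho_pow[of "Suc n"] by (simp add: s_def algebra_simps del: power_Suc)
    have "a * (real (Suc n) * Lam) \<le> a * s + \<bar>a\<bar> * Lam"
    proof -
      have "\<bar>a * (real (Suc n) * Lam - s)\<bar> \<le> \<bar>a\<bar> * Lam"
        unfolding abs_mult using s1 s2 by (intro mult_left_mono) (auto simp: algebra_simps)
      then show ?thesis by (simp add: algebra_simps)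
    qed
    then have "- ln (F (rho ^ Suc n)) \<le> a * s + C'" using up[of "Suc n"] n(1) by (simp add: C'_def del: power_Suc)
    moreover have "ln (F (rho ^ Suc n)) \<le> ln (F r)" using pos r n mono by (intro ln_mono) (auto simp del: power_Suc)
    ultimately have "- ln (F r) \<le> a * s + C'" by linarith
    then have "- ln (F r) / s \<le> (a * s + C') / s" using s by (intro divide_right_mono) auto
    moreover have "(a * s + C') / s = a + - C' / ln r" using s by (simp add: s_def field_simps)
    moreover have "- ln (F r) / s = ln (F r) / ln r" by (simp add: s_def)
    ultimately show "ereal (ln (F r) / ln r) \<le> ereal (a + - C' / ln r)" by simp
  qed (rule rho_pow_pos)
  then have "Limsup (at_right 0) (\<lambda>r. ereal (ln (F r) / ln r)) \<le> Limsup (at_right 0) (\<lambda>r. ereal (a + - C' / ln r))"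
    by (rule Limsup_mono)
  moreover have "Limsup (at_right 0) (\<lambda>r. ereal (a + - C' / ln r)) = ereal a"
    by (rule lim_imp_Limsup) (simp, intro tendsto_ereal inv_ln_tendsto)
  ultimately show ?thesis by simp
qed

end

section \<open>Points given by nested essential net intervals\<close>

context ft_ssm
begin

abbreviation ballm :: "real \<Rightarrow> real \<Rightarrow> real" where
  "ballm x r \<equiv> measure mu {x - r..x + r}"

lemma ballm_mono: "r \<le> s \<Longrightarrow> ballm x r \<le> ballm x s"
  by (intro mu_mono) auto

lemma ballm_pos: assumes "x \<in> K" "0 < r" shows "0 < ballm x r"
proof -
  obtain n where "rho ^ n < r" using rho_pow_small[OF assms(2)] by blast
  then have "ballm x (rho ^ n) \<le> ballm x r" by (intro ballm_mono) simp
  moreover have "0 < pmin ^ n" using pmin(1) by simp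
  ultimately show ?thesis using mu_ball_ge[OF assms(1), of n] by linarith
qed

lemma lower_dim_ge:
  assumes "x \<in> K" "\<And>n. n \<ge> M \<Longrightarrow> a * (real n * Lam) - C \<le> - ln (ballm x (rho ^ n))"
  shows "ereal a \<le> lower_local_dim mu x"
  unfolding lower_local_dim_def
  by (rule ball_dim_lower[of "ballm x", OF ballm_pos[OF assms(1)] ballm_mono assms(2)])

lemma upper_dim_le:
  assumes "x \<in> K" "\<And>n. n \<ge> M \<Longrightarrow> - ln (ballm x (rho ^ n)) \<le> a * (real n * Lam) + C"
  shows "upper_local_dim mu x \<le> ereal a"
  unfolding upper_local_dim_def
  by (rule ball_dim_upper[of "ballm x", OF ballm_pos[OF assms(1)] ballm_mono assms(2)])

lemma lower_le_upper: "lower_local_dim mu x \<le> upper_local_dim mu x"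
  unfolding lower_local_dim_def upper_local_dim_def by (rule Liminf_le_Limsup) simp

lemma mu_lm:
  obtains C where "0 \<le> C" "\<And>n D. essential n D \<Longrightarrow> 0 < measure mu {fst D..snd D}"
    "\<And>n D. essential n D \<Longrightarrow> lm n D \<le> - ln (measure mu {fst D..snd D})"
    "\<And>n D. essential n D \<Longrightarrow> - ln (measure mu {fst D..snd D}) \<le> lm n D + C"
proof -
  obtain c where c: "0 < c" "\<And>n D. essential n D \<Longrightarrow> c * mass n D \<le> measure mu {fst D..snd D}"
    using mu_ge_mass_essential by blast
  have pos: "0 < measure mu {fst D..snd D}" if "essential n D" for n D
    using c(2)[OF that] mult_pos_pos[OF c(1) mass_pos[OF essential_net[OF that]]] by linarith
  have lo: "lm n D \<le> - ln (measure mu {fst D..snd D})" if "essential n D" for n D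
    using mu_le_mass[OF essential_net[OF that]] pos[OF that] by (simp add: lm_def ln_mono)
  have up: "- ln (measure mu {fst D..snd D}) \<le> lm n D + \<bar>ln c\<bar>" if e: "essential n D" for n D
  proof -
    have mp: "0 < mass n D" using mass_pos[OF essential_net[OF e]] .
    have "ln (c * mass n D) \<le> ln (measure mu {fst D..snd D})" using c(2)[OF e] c(1) mp by (intro ln_mono) auto
    then show ?thesis using c(1) mp by (simp add: lm_def ln_mult)
  qed
  show ?thesis using that[of "\<bar>ln c\<bar>"] pos lo up by auto
qed

text \<open>The margin puts a ball into \<open>D i\<close>, and the length bound puts
  \<open>D (Suc i)\<close> into a ball. As consecutive levels have ratio tending to 1, scales
  between them do not affect the limit.\<close>

lemma sequence_dim:
  fixes N :: "nat \<Rightarrow> nat"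
  assumes x: "x \<in> K" and N: "strict_mono N" and ratio: "(\<lambda>i. real (N (Suc i)) / real (N i)) \<longlonglongrightarrow> 1"
    and D: "\<And>i. essential (N i) (D i)" "\<And>i. fst (D i) \<le> x" "\<And>i. x \<le> snd (D i)"
    and margin: "\<And>i. fst (D i) + gap * rho ^ N (Suc i) \<le> x" "\<And>i. x + gap * rho ^ N (Suc i) \<le> snd (D i)"
    and lim: "(\<lambda>i. lm (N i) (D i) / real (N i)) \<longlonglongrightarrow> t * Lam"
  shows "has_local_dim mu x (ereal t)"
proof -
  obtain C1 where C1: "0 \<le> C1" "\<And>n D. essential n D \<Longrightarrow> 0 < measure mu {fst D..snd D}"
    "\<And>n D. essential n D \<Longrightarrow> lm n D \<le> - ln (measure mu {fst D..snd D})"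
    "\<And>n D. essential n D \<Longrightarrow> - ln (measure mu {fst D..snd D}) \<le> lm n D + C1" using mu_lm by blast
  have Ni: "i \<le> N i" for i using strict_mono_imp_increasing[OF N] .
  have Npos: "0 < N (Suc i)" for i using Ni[of "Suc i"] by linarith
  have ev: "\<forall>\<^sub>F i in sequentially. N i \<noteq> 0"
    using Ni by (intro eventually_sequentiallyI[of 1]) (metis le_zero_eq not_one_le_zero order_trans)
  have lm0: "0 \<le> lm (N i) (D i)" for i using lm_nonneg essential_net[OF D(1)] by blast
  have tL: "0 \<le> t * Lam" by (rule LIMSEQ_le_const[OF lim]) (use lm0 in auto)
  then have t0: "0 \<le> t" using Lam_pos by (simp only: zero_le_mult_iff) linarith
  \<comment> \<open>For the upper bound a ball at scale between levels \<open>N i\<close> and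
    \<open>N (Suc i)\<close> is compared with the smaller interval \<open>D (Suc i)\<close>.\<close>
  have r1: "(\<lambda>i. lm (N (Suc i)) (D (Suc i)) / real (N i)) \<longlonglongrightarrow> t * Lam"
  proof (rule Lim_transform_eventually)
    show "(\<lambda>i. lm (N (Suc i)) (D (Suc i)) / real (N (Suc i)) * (real (N (Suc i)) / real (N i))) \<longlonglongrightarrow> t * Lam"
      using tendsto_mult[OF LIMSEQ_Suc[OF lim] ratio] by simp
    show "\<forall>\<^sub>F i in sequentially. lm (N (Suc i)) (D (Suc i)) / real (N (Suc i)) * (real (N (Suc i)) / real (N i)) = lm (N (Suc i)) (D (Suc i)) / real (N i)"
    proof (intro always_eventually allI)
      fix i show "lm (N (Suc i)) (D (Suc i)) / real (N (Suc i)) * (real (N (Suc i)) / real (N i)) = lm (N (Suc i)) (D (Suc i)) / real (N i)"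
        using Npos[of i] by simp
    qed
  qed
  \<comment> \<open>For the lower bound the ball must fit into \<open>D i\<close> with the margin of
    level \<open>N (Suc i)\<close>, and its scale may reach down to about level
    \<open>N (Suc (Suc i))\<close>; hence a shift by two.\<close>
  have r2: "(\<lambda>i. lm (N i) (D i) / real (N (Suc (Suc i)))) \<longlonglongrightarrow> t * Lam"
  proof (rule Lim_transform_eventually)
    have "(\<lambda>i. lm (N i) (D i) / real (N i) / (real (N (Suc i)) / real (N i)) / (real (N (Suc (Suc i))) / real (N (Suc i)))) \<longlonglongrightarrow> t * Lam / 1 / 1"
      by (intro tendsto_divide lim ratio LIMSEQ_Suc[OF ratio]) auto
    then show "(\<lambda>i. lm (N i) (D i) / real (N i) / (real (N (Suc i)) / real (N i)) / (real (N (Suc (Suc i))) / real (N (Suc i)))) \<longlonglongrightarrow> t * Lam"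
      by simp
    show "\<forall>\<^sub>F i in sequentially. lm (N i) (D i) / real (N i) / (real (N (Suc i)) / real (N i)) / (real (N (Suc (Suc i))) / real (N (Suc i))) = lm (N i) (D i) / real (N (Suc (Suc i)))"
      using ev
    proof eventually_elim
      case (elim i)
      then show ?case using Npos[of i] Npos[of "Suc i"] by (simp add: field_simps)
    qed
  qed
  \<comment> \<open>The factor \<open>gap\<close> is absorbed into \<open>s\<close> further
    levels.\<close>
  obtain s where s: "rho ^ s \<le> gap" using rho_pow_small[OF gap(1)] less_imp_le by blast
  \<comment> \<open>For a nonpositive rate the bound is trivial since the measure is at most 1;
    otherwise multiplication by the rate preserves inequalities between levels.\<close>
  have low: "ereal (t - e) \<le> lower_local_dim mu x" if e: "0 < e" for e
  proof (cases "t - e \<le> 0")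
    case True
    have "(t - e) * (real n * Lam) - 0 \<le> - ln (ballm x (rho ^ n))" for n
    proof -
      have "0 \<le> real n * Lam" using Lam_pos by (intro mult_nonneg_nonneg) auto
      then have "(t - e) * (real n * Lam) \<le> 0" using True by (intro mult_nonpos_nonneg)
      also have "0 \<le> - ln (ballm x (rho ^ n))" using ballm_pos[OF x, of "rho ^ n"] mu_le_1 by simp
      finally show ?thesis by simp
    qed
    then show ?thesis using lower_dim_ge[OF x, of 0 "t - e" 0] by blast
  next
    case False
    have "0 < e * Lam" by (intro mult_pos_pos e Lam_pos)
    then have "t * Lam - e * Lam < t * Lam" by linarith
    from order_tendstoD(1)[OF r2 this] obtain i0 where i0: "\<And>i. i \<ge> i0 \<Longrightarrow> t * Lam - e * Lam < lm (N i) (D i) / real (N (Suc (Suc i)))"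
      by (auto simp: eventually_sequentially)
    have "(t - e) * (real n * Lam) - (t - e) * Lam * real s \<le> - ln (ballm x (rho ^ n))" if n: "n \<ge> N (Suc i0) + s" for n
    proof -
      have "N (Suc 0) \<le> n - s" using n strict_mono_less_eq[OF N, of "Suc 0" "Suc i0"] by linarith
      moreover have "strict_mono (\<lambda>i. N (Suc i))" using N by (simp add: strict_mono_Suc_iff)
      ultimately obtain i where i: "N (Suc i) \<le> n - s" "n - s < N (Suc (Suc i))"
        using strict_mono_nat_between[of "\<lambda>i. N (Suc i)" "n - s"] by blast
      have "N (Suc i0) < N (Suc (Suc i))" using n i by linarith
      then have "i \<ge> i0" using strict_mono_less[OF N] by simp
      from i0[OF this] have a: "(t * Lam - e * Lam) * real (N (Suc (Suc i))) < lm (N i) (D i)"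
        using Npos[of "Suc i"] by (simp add: pos_less_divide_eq)
      have "rho ^ n \<le> rho ^ (s + N (Suc i))" using i n rho_pos rho_less_1 by (intro power_decreasing) auto
      also have "\<dots> \<le> gap * rho ^ N (Suc i)" using s by (simp add: power_add mult_right_mono)
      finally have "{x - rho ^ n..x + rho ^ n} \<subseteq> {fst (D i)..snd (D i)}" using margin[of i] by auto
      then have "ballm x (rho ^ n) \<le> measure mu {fst (D i)..snd (D i)}" by (intro mu_mono) auto
      then have "ln (ballm x (rho ^ n)) \<le> ln (measure mu {fst (D i)..snd (D i)})" using ballm_pos[OF x, of "rho ^ n"] by (intro ln_mono) auto
      then have b: "lm (N i) (D i) \<le> - ln (ballm x (rho ^ n))" using C1(3)[OF D(1), of i] by linarith
      have "(t - e) * Lam * (real n - real s) \<le> (t - e) * Lam * real (N (Suc (Suc i)))"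
        using i n False Lam_pos by (intro mult_left_mono mult_nonneg_nonneg) auto
      then show ?thesis using a b by (simp add: algebra_simps)
    qed
    then show ?thesis using lower_dim_ge[OF x] by blast
  qed
  have up: "upper_local_dim mu x \<le> ereal (t + e)" if e: "0 < e" for e
  proof -
    have "0 < e * Lam" by (intro mult_pos_pos e Lam_pos)
    then have "t * Lam < t * Lam + e * Lam" by linarith
    from order_tendstoD(2)[OF r1 this] obtain i0 where i0: "\<And>i. i \<ge> i0 \<Longrightarrow> lm (N (Suc i)) (D (Suc i)) / real (N i) < t * Lam + e * Lam"
      by (auto simp: eventually_sequentially)
    have "- ln (ballm x (rho ^ n)) \<le> (t + e) * (real n * Lam) + C1" if n: "n \<ge> N (Suc i0)" for n
    proof -
      have "N 0 \<le> n" using n strict_mono_less_eq[OF N, of 0 "Suc i0"] by linarith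
      then obtain i where i: "N i \<le> n" "n < N (Suc i)" using strict_mono_nat_between[OF N] by blast
      have "N (Suc i0) < N (Suc i)" using n i by linarith
      then have ii: "i > i0" using strict_mono_less[OF N] by simp
      then have "0 < N i" using Ni[of i] by linarith
      then have a: "lm (N (Suc i)) (D (Suc i)) \<le> (t * Lam + e * Lam) * real (N i)"
        using i0[of i] ii by (simp add: pos_divide_less_eq less_imp_le)
      have "snd (D (Suc i)) - fst (D (Suc i)) \<le> rho ^ N (Suc i)" using net_length[OF essential_net[OF D(1)]] .
      also have "\<dots> \<le> rho ^ n" using i rho_pos rho_less_1 by (intro power_decreasing) auto
      finally have "{fst (D (Suc i))..snd (D (Suc i))} \<subseteq> {x - rho ^ n..x + rho ^ n}"
        using D(2)[of "Suc i"] D(3)[of "Suc i"] by auto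
      then have "measure mu {fst (D (Suc i))..snd (D (Suc i))} \<le> ballm x (rho ^ n)" by (intro mu_mono) auto
      then have "ln (measure mu {fst (D (Suc i))..snd (D (Suc i))}) \<le> ln (ballm x (rho ^ n))"
        using C1(2)[OF D(1), of "Suc i"] by (intro ln_mono) auto
      then have b: "- ln (ballm x (rho ^ n)) \<le> lm (N (Suc i)) (D (Suc i)) + C1" using C1(4)[OF D(1), of "Suc i"] by linarith
      have "(t + e) * Lam * real (N i) \<le> (t + e) * Lam * real n"
        using i e t0 Lam_pos by (intro mult_left_mono mult_nonneg_nonneg) auto
      then show ?thesis using a b by (simp add: algebra_simps)
    qed
    then show ?thesis using upper_dim_le[OF x] by blast
  qed
  have "ereal t \<le> lower_local_dim mu x"
  proof (rule ereal_le_epsilon2)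
    fix e :: real assume "0 < e"
    from low[OF this] have "ereal (t - e) + ereal e \<le> lower_local_dim mu x + ereal e" by (rule add_right_mono)
    then show "ereal t \<le> lower_local_dim mu x + ereal e" by simp
  qed
  moreover have "upper_local_dim mu x \<le> ereal t"
    by (rule ereal_le_epsilon2) (use up in simp)
  ultimately show ?thesis unfolding has_local_dim_def using lower_le_upper[of x]
    by (meson order_antisym order_trans)
qed

text \<open>The margins keep the limit point strictly inside every interval, which excludes boundary
  points.\<close>

lemma nested_point:
  fixes N :: "nat \<Rightarrow> nat"
  assumes N: "strict_mono N" and D: "\<And>i. essential (N i) (D i)"
    and margin: "\<And>i. fst (D i) + gap * rho ^ N (Suc i) \<le> fst (D (Suc i))" "\<And>i. snd (D (Suc i)) + gap * rho ^ N (Suc i) \<le> snd (D i)"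
  obtains x where "interior_essential x" "\<And>i. fst (D i) < x" "\<And>i. x < snd (D i)"
    "\<And>i. fst (D i) + gap * rho ^ N (Suc i) \<le> x" "\<And>i. x + gap * rho ^ N (Suc i) \<le> snd (D i)"
    "\<And>y. (\<And>i. fst (D i) \<le> y \<and> y \<le> snd (D i)) \<Longrightarrow> y = x"
proof -
  have gp: "0 < gap * rho ^ n" for n using gap by simp
  have net: "D i \<in> net_intervals (N i)" for i using essential_net[OF D] .
  have inc: "incseq (\<lambda>i. fst (D i))" using margin(1) gp by (intro incseq_SucI) (smt (verit))
  have dec: "decseq (\<lambda>i. snd (D i))" using margin(2) gp by (intro decseq_SucI) (smt (verit))
  have le: "fst (D i) \<le> snd (D j)" for i j
  proof -
    have "fst (D i) \<le> fst (D (max i j))" "snd (D (max i j)) \<le> snd (D j)"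
      using incseqD[OF inc, of i "max i j"] decseqD[OF dec, of j "max i j"] by simp_all
    then show ?thesis using netD(3)[OF net[of "max i j"]] by linarith
  qed
  define x where "x = (SUP i. fst (D i))"
  have bdd: "bdd_above (range (\<lambda>i. fst (D i)))" using le[of _ 0] by (auto simp: bdd_above_def)
  have x1: "fst (D i) \<le> x" for i unfolding x_def by (intro cSUP_upper bdd) simp
  have x2: "x \<le> snd (D i)" for i unfolding x_def by (intro cSUP_least) (use le in auto)
  have m1: "fst (D i) + gap * rho ^ N (Suc i) \<le> x" and m2: "x + gap * rho ^ N (Suc i) \<le> snd (D i)" for i
    using margin[of i] x1[of "Suc i"] x2[of "Suc i"] by linarith+
  have s1: "fst (D i) < x" and s2: "x < snd (D i)" for i using m1[of i] m2[of i] gp[of "N (Suc i)"] by linarith+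
  have Ni: "i \<le> N i" for i using strict_mono_imp_increasing[OF N] .
  have small: "\<exists>i. snd (D i) - fst (D i) < e" if e: "0 < e" for e
  proof -
    obtain n where n: "\<And>k. k \<ge> n \<Longrightarrow> rho ^ k < e" using rho_pow_small[OF e] by blast
    have "snd (D n) - fst (D n) < e" using net_length[OF net[of n]] n[OF Ni[of n]] by linarith
    then show ?thesis by blast
  qed
  have uniq: "y = x" if y: "\<And>i. fst (D i) \<le> y \<and> y \<le> snd (D i)" for y
  proof (rule ccontr)
    assume "y \<noteq> x"
    then obtain i where "snd (D i) - fst (D i) < \<bar>y - x\<bar>" using small[of "\<bar>y - x\<bar>"] by auto
    then show False using y[of i] x1[of i] x2[of i] by linarith
  qed
  have xK: "x \<in> K"
  proof -
    have "\<exists>y\<in>K. dist y x < e" if "0 < e" for e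
    proof -
      obtain i where i: "snd (D i) - fst (D i) < e" using small[OF \<open>0 < e\<close>] by blast
      obtain y where "y \<in> K" "fst (D i) < y" "y < snd (D i)" using netD(5)[OF net[of i]] by auto
      then show ?thesis using i x1[of i] x2[of i] by (intro bexI[of _ y]) (auto simp: dist_real_def)
    qed
    then show ?thesis using closed_approachable[OF compact_imp_closed[OF compact_K]] by blast
  qed
  \<comment> \<open>An endpoint of level \<open>n\<close> is an endpoint of the deeper level
    \<open>N n\<close>, but \<open>x\<close> lies in the interior of \<open>D n\<close>.\<close>
  have "\<not> boundary_point x"
  proof
    assume "boundary_point x"
    then obtain n E where "E \<in> net_intervals n" "x = fst E \<or> x = snd E" by (auto simp: boundary_point_def)
    then have "x \<in> endpoints n" using netD(1,2) by blast
    then have "x \<in> endpoints (N n)" using endpoints_mono[OF Ni[of n]] by blast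
    then show False using netD(4)[OF net[of n]] s1[of n] s2[of n] by auto
  qed
  then have "interior_essential x" unfolding interior_essential_def using xK D[of 0] s1[of 0] s2[of 0]
    by (intro conjI exI[of _ "N 0"] exI[of _ "D 0"]) auto
  then show ?thesis using that s1 s2 m1 m2 uniq by blast
qed

primrec chain :: "(nat \<Rightarrow> nat) \<Rightarrow> (nat \<Rightarrow> net_interval) \<Rightarrow> nat \<Rightarrow> net_interval" where
  "chain k E 0 = E 0"
| "chain k E (Suc i) = comp (nR + sum k {..i}) (chain k E i) (E (Suc i))"

lemma chain_loop:
  assumes "\<And>i. loop (k i) (E i)" shows "loop (sum k {..i}) (chain k E i)"
proof (induction i)
  case (Suc i)
  show ?case using loop_comp[OF Suc assms[of "Suc i"]] by simp
qed (use assms in simp)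

lemma chain_strict_mono:
  fixes k :: "nat \<Rightarrow> nat"
  assumes "\<And>i. loop (k i) (E i)" shows "strict_mono (\<lambda>i. nR + sum k {..i})"
  using loopD(1)[OF assms] by (simp add: strict_mono_Suc_iff)

lemma loop_essential: "loop k E \<Longrightarrow> essential (nR + k) E"
  using essential_alpha loopD(2,3) by blast

lemma chain_point:
  assumes "\<And>i. loop (k i) (E i)"
  defines "N \<equiv> \<lambda>i. nR + sum k {..i}" and "D \<equiv> chain k E"
  obtains x where "interior_essential x" "\<And>i. fst (D i) < x" "\<And>i. x < snd (D i)"
    "\<And>i. fst (D i) + gap * rho ^ N (Suc i) \<le> x" "\<And>i. x + gap * rho ^ N (Suc i) \<le> snd (D i)"
    "\<And>y. (\<And>i. fst (D i) \<le> y \<and> y \<le> snd (D i)) \<Longrightarrow> y = x"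
proof (rule nested_point[of N D])
  show "strict_mono N" unfolding N_def by (rule chain_strict_mono[OF assms(1)])
  have l: "loop (sum k {..i}) (D i)" for i unfolding D_def by (rule chain_loop[OF assms(1)])
  show "essential (N i) (D i)" for i unfolding N_def by (rule loop_essential[OF l])
  have "fst (D i) + gap * rho ^ (nR + sum k {..i} + k (Suc i)) \<le> fst (D (Suc i)) \<and>
    snd (D (Suc i)) + gap * rho ^ (nR + sum k {..i} + k (Suc i)) \<le> snd (D i)" for i
    using comp_margin[OF loopD(2,3)[OF l[of i]] assms(1)[of "Suc i"]] by (simp add: D_def)
  then show "fst (D i) + gap * rho ^ N (Suc i) \<le> fst (D (Suc i))" "snd (D (Suc i)) + gap * rho ^ N (Suc i) \<le> snd (D i)" for i
    by (simp_all add: N_def add.assoc)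
qed (use that in blast)

lemma chain_dim:
  assumes "\<And>i. loop (k i) (E i)"
  defines "N \<equiv> \<lambda>i. nR + sum k {..i}" and "D \<equiv> chain k E"
  assumes ratio: "(\<lambda>i. real (N (Suc i)) / real (N i)) \<longlonglongrightarrow> 1"
    and lim: "(\<lambda>i. lm (N i) (D i) / real (N i)) \<longlonglongrightarrow> t * Lam"
    and x: "x \<in> K" "\<And>i. fst (D i) < x" "\<And>i. x < snd (D i)"
      "\<And>i. fst (D i) + gap * rho ^ N (Suc i) \<le> x" "\<And>i. x + gap * rho ^ N (Suc i) \<le> snd (D i)"
  shows "has_local_dim mu x (ereal t)"
proof (rule sequence_dim[OF x(1) _ ratio _ _ _ x(4,5) lim])
  show "strict_mono N" unfolding N_def by (rule chain_strict_mono[OF assms(1)])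
  show "essential (N i) (D i)" for i unfolding N_def D_def by (rule loop_essential[OF chain_loop[OF assms(1)]])
qed (use x less_imp_le in blast)+

end

subsection \<open>Periodic points of loops\<close>

context ft_ssm
begin

abbreviation iter :: "nat \<Rightarrow> net_interval \<Rightarrow> nat \<Rightarrow> net_interval" where
  "iter k E \<equiv> chain (\<lambda>_. k) (\<lambda>_. E)"

text \<open>\<open>iter k E i\<close> consists of \<open>Suc i\<close> copies of \<open>E\<close>,
  so the numbers of copies add up to those of index \<open>Suc (i + j)\<close>.\<close>

lemma iter_add: "iter k E (Suc (i + j)) = comp (nR + Suc i * k) (iter k E i) (iter k E j)"
proof (induction j)
  case (Suc j)
  have "iter k E (Suc (i + Suc j)) = comp (nR + Suc i * k + Suc j * k) (iter k E (Suc (i + j))) E"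
    by (simp add: algebra_simps)
  also have "\<dots> = comp (nR + Suc i * k) (iter k E i) (comp (nR + Suc j * k) (iter k E j) E)"
    unfolding Suc comp_assoc ..
  finally show ?case by simp
qed simp

lemma iter_loop: "loop k E \<Longrightarrow> loop (Suc i * k) (iter k E i)"
  using chain_loop[of "\<lambda>_. k" "\<lambda>_. E" i] by simp

text \<open>By \<open>iter_add\<close> and \<open>comp_quasi\<close> the logarithmic weight is
  quasi-additive in the number of copies.\<close>

lemma iter_limit:
  assumes "loop k E"
  obtains s where "(\<lambda>i. lm (nR + Suc i * k) (iter k E i) / real (nR + Suc i * k)) \<longlonglongrightarrow> s * Lam"
    "\<bar>s * (real k * Lam) - lm (nR + k) E\<bar> \<le> C0"
proof -
  have k: "0 < k" using loopD(1)[OF assms] .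
  \<comment> \<open>\<open>b i\<close> belongs to \<open>i\<close> copies, whereas
    \<open>iter\<close> starts with one copy at index 0.\<close>
  define b where "b = (\<lambda>i. lm (nR + i * k) (iter k E (i - 1)))"
  have "\<bar>b (i + j) - b i - b j\<bar> \<le> C0" if ij: "0 < i" "0 < j" for i j
  proof -
    obtain i' j' where e: "i = Suc i'" "j = Suc j'" using ij by (metis gr0_implies_Suc)
    note L = loop_good[OF iter_loop[OF assms, of i']] and M = loopD(2,8)[OF iter_loop[OF assms, of j']]
    have "iter k E (i + j - 1) = comp (nR + Suc i' * k) (iter k E i') (iter k E j')"
      using iter_add[of k E i' j'] by (simp add: e)
    moreover have "nR + (i + j) * k = nR + Suc i' * k + Suc j' * k" by (simp add: e algebra_simps)
    ultimately have "b (i + j) = lm (nR + Suc i' * k + Suc j' * k) (comp (nR + Suc i' * k) (iter k E i') (iter k E j'))"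
      unfolding b_def by (simp only:)
    moreover have "b i = lm (nR + Suc i' * k) (iter k E i')" "b j = lm (nR + Suc j' * k) (iter k E j')"
      by (simp_all only: b_def e diff_Suc_1)
    ultimately show ?thesis using comp_quasi[OF L M] by (simp only:)
  qed
  then obtain l where l: "(\<lambda>i. b i / real i) \<longlonglongrightarrow> l" "\<bar>l - b 1\<bar> \<le> C0" using quasi_additive_limit by blast
  define s where "s = l / (real k * Lam)"
  have sk: "s * (real k * Lam) = l" using k Lam_pos by (simp add: s_def)
  \<comment> \<open>\<open>0 + real k\<close> is the limit of the denominators after division by the
    number of copies.\<close>
  have ek: "s * Lam = l / (0 + real k)" using k Lam_pos by (simp add: s_def field_simps)
  have "(\<lambda>i. real nR / real (Suc i)) \<longlonglongrightarrow> 0" by (rule LIMSEQ_Suc[OF lim_const_over_n])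
  then have "(\<lambda>i. (b (Suc i) / real (Suc i)) / (real nR / real (Suc i) + real k)) \<longlonglongrightarrow> s * Lam"
    unfolding ek using k by (intro tendsto_divide tendsto_add LIMSEQ_Suc[OF l(1)] tendsto_const) auto
  also have "(\<lambda>i. (b (Suc i) / real (Suc i)) / (real nR / real (Suc i) + real k)) = (\<lambda>i. lm (nR + Suc i * k) (iter k E i) / real (nR + Suc i * k))"
  proof
    fix i
    have "(b (Suc i) / real (Suc i)) / (real nR / real (Suc i) + real k) = b (Suc i) / (real (Suc i) * (real nR / real (Suc i) + real k))"
      by (rule divide_divide_eq_left)
    also have "real (Suc i) * (real nR / real (Suc i) + real k) = real (nR + Suc i * k)"
      by (simp add: distrib_left del: of_nat_Suc) (simp add: algebra_simps)
    finally show "(b (Suc i) / real (Suc i)) / (real nR / real (Suc i) + real k) = lm (nR + Suc i * k) (iter k E i) / real (nR + Suc i * k)"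
      by (simp add: b_def)
  qed
  finally show ?thesis using that[of s] l(2) sk by (simp add: b_def)
qed

lemma interior_symbolic:
  assumes "x \<in> K" "\<not> boundary_point x"
  obtains Dn where "\<And>n. Dn n \<in> net_intervals n" "\<And>n. fst (Dn n) < x" "\<And>n. x < snd (Dn n)"
    "\<And>n. parent n (Dn n) (Dn (Suc n))" "symbolic_rep x (\<lambda>n. char_vector n (Dn n))"
    "\<And>n E. E \<in> net_intervals n \<Longrightarrow> fst E < x \<Longrightarrow> x < snd E \<Longrightarrow> E = Dn n"
proof -
  have "\<exists>D. D \<in> net_intervals n \<and> fst D < x \<and> x < snd D" for n
  proof -
    obtain D where D: "D \<in> net_intervals n" "fst D \<le> x" "x \<le> snd D" using net_point[OF assms(1)] .
    then have "x \<noteq> fst D" "x \<noteq> snd D" using assms unfolding boundary_point_def by blast+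
    then show ?thesis using D by (intro exI[of _ D]) auto
  qed
  then obtain Dn where Dn: "\<And>n. Dn n \<in> net_intervals n" "\<And>n. fst (Dn n) < x" "\<And>n. x < snd (Dn n)" by metis
  have par: "parent n (Dn n) (Dn (Suc n))" for n
    using net_subset[OF Dn(1)[of n], of "Dn (Suc n)" "Suc 0"] Dn(1)[of "Suc n"] Dn(2)[of n] Dn(3)[of n] Dn(2)[of "Suc n"] Dn(3)[of "Suc n"] Dn(1)[of n]
    by (auto simp: parent_iff)
  have sr: "symbolic_rep x (\<lambda>n. char_vector n (Dn n))"
    unfolding symbolic_rep_def
  proof (intro exI[of _ Dn] allI conjI)
    show "x \<in> {fst (Dn n)..snd (Dn n)}" for n using Dn(2,3)[of n] by simp
  qed (use Dn par in auto)
  have un: "E = Dn n" if "E \<in> net_intervals n" "fst E < x" "x < snd E" for n E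
    using net_eqI[OF that(1) Dn(1)[of n]] that Dn(2,3)[of n] by linarith
  show ?thesis using that[of Dn] Dn par sr un by blast
qed

text \<open>The limit point of the iterates is the fixed point of the affine map from
  \<open>R\<close> onto \<open>E\<close>. This map moves the net intervals around the point down by
  \<open>k\<close> levels, so the symbolic representation repeats; the links of the loop make the
  matrix of the period positive.\<close>

lemma loop_periodic:
  assumes L: "loop k E"
  obtains y s where "interior_essential y" "positive_periodic y" "has_local_dim mu y (ereal s)"
    "\<bar>s * (real k * Lam) - lm (nR + k) E\<bar> \<le> C0"
proof -
  define N where "N = (\<lambda>i. nR + Suc i * k)"
  define D where "D = iter k E"
  have k: "0 < k" using loopD(1)[OF L] .
  have Nsum: "nR + sum (\<lambda>_. k) {..i} = N i" for i by (simp add: N_def)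
  obtain y where y: "interior_essential y" "\<And>i. fst (D i) < y" "\<And>i. y < snd (D i)"
    "\<And>i. fst (D i) + gap * rho ^ N (Suc i) \<le> y" "\<And>i. y + gap * rho ^ N (Suc i) \<le> snd (D i)"
    "\<And>z. (\<And>i. fst (D i) \<le> z \<and> z \<le> snd (D i)) \<Longrightarrow> z = y"
    using chain_point[of "\<lambda>_. k" "\<lambda>_. E", OF L] unfolding Nsum D_def[symmetric] by blast
  have yK: "y \<in> K" "\<not> boundary_point y" using y(1) by (simp_all add: interior_essential_def)
  obtain s where s: "(\<lambda>i. lm (N i) (D i) / real (N i)) \<longlonglongrightarrow> s * Lam" "\<bar>s * (real k * Lam) - lm (nR + k) E\<bar> \<le> C0"
    unfolding N_def D_def using iter_limit[OF L] .
  have ratio: "(\<lambda>i. real (N (Suc i)) / real (N i)) \<longlonglongrightarrow> 1"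
  proof -
    have sm: "strict_mono N" by (rule strict_monoI_Suc) (use k in \<open>simp add: N_def\<close>)
    have "filterlim N sequentially sequentially" using filterlim_subseq[OF sm] .
    then have "filterlim (\<lambda>i. real (N i)) at_top sequentially"
      by (rule filterlim_compose[OF filterlim_real_sequentially])
    then have "(\<lambda>i. real k / real (N i)) \<longlonglongrightarrow> 0"
      by (intro tendsto_divide_0[OF tendsto_const] filterlim_at_top_imp_at_infinity)
    from tendsto_add[OF tendsto_const[of 1] this] have "(\<lambda>i. 1 + real k / real (N i)) \<longlonglongrightarrow> 1" by simp
    moreover have "1 + real k / real (N i) = real (N (Suc i)) / real (N i)" for i
    proof -
      have "N i \<noteq> 0" "N (Suc i) = N i + k" using nR by (simp_all add: N_def)
      then show ?thesis by (simp add: add_divide_distrib)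
    qed
    ultimately show ?thesis by simp
  qed
  have dim: "has_local_dim mu y (ereal s)"
    using chain_dim[of "\<lambda>_. k" "\<lambda>_. E" s y, OF L] unfolding Nsum D_def[symmetric]
    using ratio s(1) yK(1) y(2-5) by blast
  have sR: "sim nR R (nR + k) E" using loopD(9)[OF L] .
  define g where "g = emb nR R (nR + k) E"
  \<comment> \<open>\<open>g\<close> maps each iterate onto the next, so \<open>g y\<close> lies in
    all of them, and \<open>y\<close> is the only such point.\<close>
  have inD: "g y = y"
  proof (rule y(6))
    fix i show "fst (D i) \<le> g y \<and> g y \<le> snd (D i)"
    proof (cases i)
      case 0
      have "fst R < y" "y < snd R" using y(2)[of 0] y(3)[of 0] loopD(8)[OF L] by (auto simp: D_def)
      then show ?thesis using emb_between[OF sR] by (simp add: 0 D_def g_def less_imp_le)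
    next
      case (Suc j)
      have "D i = embI nR R (nR + k) E (D j)" using iter_add[of k E 0 j] by (simp add: Suc D_def)
      then show ?thesis using y(2)[of j] y(3)[of j] by (simp add: g_def less_imp_le)
    qed
  qed
  obtain Dn where Dn: "\<And>n. Dn n \<in> net_intervals n" "\<And>n. fst (Dn n) < y" "\<And>n. y < snd (Dn n)"
    "\<And>n. parent n (Dn n) (Dn (Suc n))" and rep: "symbolic_rep y (\<lambda>n. char_vector n (Dn n))"
    and un: "\<And>n E. E \<in> net_intervals n \<Longrightarrow> fst E < y \<Longrightarrow> y < snd E \<Longrightarrow> E = Dn n"
    using interior_symbolic[OF yK] by blast
  have yE: "fst E < y" "y < snd E" using y(2)[of 0] y(3)[of 0] by (simp_all add: D_def)
  have DnR: "Dn nR = R" using un[OF R_net] yE loopD(8)[OF L] by fastforce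
  have Dnk: "Dn (nR + k) = E" using un[OF loopD(2)[OF L] yE] by simp
  have subR: "sub (Dn (nR + j)) R" for j
    using net_subset[OF R_net Dn(1)[of "nR + j"]] Dn(2)[of "nR + j"] Dn(3)[of "nR + j"] yE loopD(8)[OF L] by fastforce
  define ga where "ga = (\<lambda>n. char_vector n (Dn n))"
  \<comment> \<open>For \<open>j = 0\<close> similarity says nothing about positions; there both
    vectors are \<open>alpha\<close> by the definition of a loop.\<close>
  have per: "ga (nR + j + k) = ga (nR + j)" for j
  proof (cases j)
    case 0
    then show ?thesis using DnR Dnk loopD(3)[OF L] by (simp add: ga_def alpha_def)
  next
    case (Suc i)
    have net: "Dn (nR + j) \<in> net_intervals (nR + Suc i)" using Dn(1)[of "nR + j"] by (simp add: Suc)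
    have "embI nR R (nR + k) E (Dn (nR + j)) \<in> net_intervals (nR + k + Suc i)"
      using sim_desc_net(1)[OF sR net subR] .
    moreover have "emb nR R (nR + k) E (fst (Dn (nR + j))) < g y" "g y < emb nR R (nR + k) E (snd (Dn (nR + j)))"
      using Dn(2,3)[of "nR + j"] by (simp_all add: g_def)
    ultimately have "embI nR R (nR + k) E (Dn (nR + j)) = Dn (nR + k + Suc i)"
      unfolding inD by (intro un) auto
    moreover have "char_vector (nR + k + Suc i) (embI nR R (nR + k) E (Dn (nR + j))) = char_vector (nR + Suc i) (Dn (nR + j))"
      using sim_char_vector[OF sR net subR] .
    ultimately show ?thesis by (simp add: ga_def Suc add_ac)
  qed
  have per': "ga (nR + i) = ga (nR + i mod k)" for i
  proof (induction i rule: less_induct)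
    case (less i)
    show ?case
    proof (cases "i < k")
      case False
      then have "ga (nR + i) = ga (nR + (i - k))" using per[of "i - k"] by (simp add: add_ac)
      also have "\<dots> = ga (nR + (i - k) mod k)" using less[of "i - k"] False k by simp
      also have "(i - k) mod k = i mod k" using False by (simp add: le_mod_geq)
      finally show ?thesis .
    qed simp
  qed
  define \<theta> where "\<theta> = map (\<lambda>i. ga (nR + i)) [0..<Suc k]"
  have bl: "butlast \<theta> = map (\<lambda>i. ga (nR + i)) [0..<k]" by (simp add: \<theta>_def)
  have cyc: "cycle \<theta>"
    unfolding cycle_def admissible_path_def
  proof (intro conjI)
    show "\<theta> \<noteq> []" by (simp add: \<theta>_def)
    show "set \<theta> \<subseteq> Omega" using char_vector_in_Omega[OF Dn(1)] by (auto simp: \<theta>_def ga_def)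
    have "child_vec (ga n) (ga (Suc n))" for n unfolding child_vec_def ga_def using Dn(4) by blast
    then show "successively child_vec \<theta>" unfolding \<theta>_def successively_conv_nth by (auto simp del: upt_Suc)
    show "2 \<le> length \<theta>" using k by (simp add: \<theta>_def)
    have "hd \<theta> = ga nR" by (simp add: \<theta>_def upt_conv_Cons del: upt_Suc)
    moreover have "last \<theta> = ga (nR + k)" by (simp add: \<theta>_def)
    ultimately show "hd \<theta> = last \<theta>" using per[of 0] by simp
  qed
  have "period y \<theta>"
    unfolding period_def
  proof (intro conjI yK(1) cyc exI allI)
    show "symbolic_rep y ga" using rep by (simp add: ga_def)
    fix i
    \<comment> \<open>The preperiod ends at \<open>J = n0\<close>, because
      \<open>nR = Suc n0\<close> is the level of \<open>R\<close>.\<close>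
    have "ga (Suc n0 + i) = ga (nR + i mod k)" using per'[of i] by (simp add: nR)
    also have "\<dots> = butlast \<theta> ! (i mod length (butlast \<theta>))" using k unfolding bl by simp
    finally show "ga (Suc n0 + i) = butlast \<theta> ! (i mod length (butlast \<theta>))" .
  qed
  moreover have "0 < path_transition \<theta> $$ (j, l)" if jl: "j < dim_row (path_transition \<theta>)" "l < dim_col (path_transition \<theta>)" for j l
  proof -
    define Ds where "Ds = (\<lambda>i. Dn (nR + i))"
    have th: "\<theta> = map (\<lambda>i. char_vector (nR + i) (Ds i)) [0..<Suc k]" by (simp add: \<theta>_def ga_def Ds_def)
    have Ds: "parent (nR + i) (Ds i) (Ds (Suc i))" for i using Dn(4)[of "nR + i"] by (simp add: Ds_def)
    have D0: "Ds 0 = R" "Ds k = E" using DnR Dnk by (simp_all add: Ds_def)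
    note pt = path_transition_chain[of k nR Ds, OF Ds, folded th, unfolded D0, OF R_net]
    have "neighbours nR R ! j \<in> nb nR R" using jl(1) pt(1) set_neighbours[OF R_net] nth_mem by metis
    moreover have "neighbours (nR + k) E ! l \<in> nb (nR + k) E" using jl(2) pt(2) set_neighbours[OF loopD(2)[OF L]] nth_mem by metis
    ultimately show ?thesis using pt(4)[OF jl] loopD(6)[OF L] by blast
  qed
  ultimately have "positive_periodic y" unfolding positive_periodic_def by blast
  then show ?thesis using that y(1) dim s(2) by blast
qed

end

subsection \<open>Truly essential points\<close>

context ft_ssm
begin

text \<open>The entries of the two weight vectors lie between a power of \<open>pmin\<close> and 1,
  so each vector dominates a multiple of the other; the cost is independent of the depth
  \<open>k\<close>.\<close>

lemma lm_sim:
  assumes "sim n D n' D'" "E \<in> net_intervals (n + k)" "sub E D"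
  shows "\<bar>lm (n + k) E - lm (n' + k) (embI n D n' D' E)\<bar> \<le> real (n + n') * - ln pmin"
proof -
  have *: "lm (n + k) E \<le> lm (n' + k) (embI n D n' D' E) + real n * - ln pmin"
    if s: "sim n D n' D'" and E: "E \<in> net_intervals (n + k)" "sub E D" for n D n' D' E
  proof -
    have "pmin ^ n * Q n' D' v \<le> Q n D v" if v: "v \<in> nb n D" for v
    proof -
      have "v \<in> nb n' D'" using s v by (simp add: sim_def)
      then have "Q n' D' v \<le> 1" using Q_le_mass mass_le_1 order_trans by blast
      then have "pmin ^ n * Q n' D' v \<le> pmin ^ n" using pmin(1) by (intro mult_left_le) auto
      then show ?thesis using Q_ge[OF v] by linarith
    qed
    from mass_mono[OF s this E] have m: "pmin ^ n * mass (n' + k) (embI n D n' D' E) \<le> mass (n + k) E" .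
    have pos: "0 < mass (n' + k) (embI n D n' D' E)" "0 < mass (n + k) E"
      using mass_pos sim_desc_net(1)[OF s E] E(1) by blast+
    have "ln (pmin ^ n * mass (n' + k) (embI n D n' D' E)) \<le> ln (mass (n + k) E)"
      using m pos pmin(1) by (intro ln_mono) auto
    then show ?thesis using pos pmin(1) by (simp add: lm_def ln_mult ln_realpow)
  qed
  have "ln pmin \<le> 0" using pmin by simp
  then have nn: "0 \<le> real n * - ln pmin" for n by (intro mult_nonneg_nonneg) auto
  have "lm (n' + k) (embI n D n' D' E) \<le> lm (n + k) E + real n' * - ln pmin"
    using *[OF sim_sym[OF assms(1)] sim_desc_net[OF assms]] by simp
  then show ?thesis using *[OF assms] nn[of n] nn[of n'] by (simp add: algebra_simps)
qed

text \<open>\<open>D0\<close> has a similar copy below \<open>R\<close>. Moving \<open>D\<close>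
  into that copy and adding a connector produces a loop, with errors that do not depend on
  \<open>j\<close>.\<close>

lemma essential_loop:
  assumes "essential n1 D0"
  obtains C where "0 \<le> C" "\<And>j D. D \<in> net_intervals (n1 + j) \<Longrightarrow> sub D D0 \<Longrightarrow>
    \<exists>k E. loop k E \<and> \<bar>real k - real (n1 + j)\<bar> \<le> C \<and> \<bar>lm (nR + k) E - lm (n1 + j) D\<bar> \<le> C"
proof -
  obtain k0 E0 where E0: "E0 \<in> net_intervals (nR + k0)" "sub E0 R" "char_vector (nR + k0) E0 = char_vector n1 D0"
    using essentialD[OF assms] .
  have s: "sim n1 D0 (nR + k0) E0" using char_vector_eq_iff[OF essential_net[OF assms] E0(1)] E0(3) by simp
  \<comment> \<open>Level shift of the copy and depth of the connector, then the weight errors of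
    \<open>lm_sim\<close> and \<open>lm_conn\<close>.\<close>
  define C where "C = real (k0 + B + n1) + (real (n1 + (nR + k0)) * - ln pmin + C0)"
  have "ln pmin \<le> 0" using pmin by simp
  then have nn: "0 \<le> real (n1 + (nR + k0)) * - ln pmin" by (intro mult_nonneg_nonneg) auto
  have "\<exists>k E. loop k E \<and> \<bar>real k - real (n1 + j)\<bar> \<le> C \<and> \<bar>lm (nR + k) E - lm (n1 + j) D\<bar> \<le> C"
    if D: "D \<in> net_intervals (n1 + j)" "sub D D0" for j D
  proof -
    let ?E' = "embI n1 D0 (nR + k0) E0 D"
    have E': "?E' \<in> net_intervals (nR + (k0 + j))" "sub ?E' E0" using sim_desc_net[OF s D] by (simp_all add: add.assoc)
    have E'R: "sub ?E' R" using E'(2) E0(2) by linarith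
    have ess: "essential (nR + (k0 + j)) ?E'" using essential_desc[OF essential_R E'(1) E'R] .
    obtain l E where c: "conn B (nR + (k0 + j)) ?E' l E" using conn_B[OF ess] .
    have L: "loop (k0 + j + l) E" using loop_conn[OF E'(1) E'R c] .
    have "l \<le> B" using c by (simp add: conn_def)
    then have "\<bar>real (k0 + j + l) - real (n1 + j)\<bar> \<le> real (k0 + B + n1)" by (simp add: abs_if)
    moreover have "\<bar>lm (nR + (k0 + j) + l) E - lm (nR + (k0 + j)) ?E'\<bar> \<le> C0" using lm_conn[OF ess c] .
    moreover have "\<bar>lm (n1 + j) D - lm (nR + k0 + j) ?E'\<bar> \<le> real (n1 + (nR + k0)) * - ln pmin" using lm_sim[OF s D] .
    ultimately show ?thesis using L nn C0_nonneg
      by (intro exI[of _ "k0 + j + l"] exI[of _ E] conjI) (auto simp: C_def add.assoc)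
  qed
  moreover have "0 \<le> C" using nn C0_nonneg by (simp add: C_def)
  ultimately show ?thesis using that by blast
qed

text \<open>A common form of the two cases: at some level every net interval containing
  \<open>x\<close> is essential. At a boundary point these are the given one and possibly the other
  one.\<close>

lemma truly_essential_nets:
  assumes "truly_essential x"
  obtains n where "x \<in> K" "\<And>A. A \<in> net_intervals n \<Longrightarrow> fst A \<le> x \<Longrightarrow> x \<le> snd A \<Longrightarrow> essential n A"
  using assms unfolding truly_essential_def
proof
  assume "boundary_essential x"
  then obtain n D where D: "x \<in> K" "D \<in> net_intervals n" "x = fst D \<or> x = snd D" "essential n D"
    "\<And>E. other_net_interval n x D E \<Longrightarrow> essential n E" unfolding boundary_essential_def by blast
  have "x \<in> endpoints n" using D netD(1,2) by blast
  have "essential n A" if A: "A \<in> net_intervals n" "fst A \<le> x" "x \<le> snd A" for A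
  proof -
    have "x \<notin> {fst A<..<snd A}" using netD(4)[OF A(1)] \<open>x \<in> endpoints n\<close> by blast
    then have xa: "x = fst A \<or> x = snd A" using A by auto
    note lt = netD(3)[OF A(1)] netD(3)[OF D(2)]
    consider "x = fst D" "x = snd A" | "x = snd D" "x = fst A" | "fst D < snd A" "fst A < snd D"
      using xa D(3) lt by linarith
    then show ?thesis
    proof cases
      case 3
      then show ?thesis using net_eqI[OF D(2) A(1)] D(4) by simp
    qed (use D(5)[of A] A(1) in \<open>auto simp: other_net_interval_def\<close>)
  qed
  then show ?thesis using that D(1) by blast
next
  assume "interior_essential x"
  then obtain n D where D: "x \<in> K" "essential n D" "fst D < x" "x < snd D" unfolding interior_essential_def by auto
  have "essential n A" if A: "A \<in> net_intervals n" "fst A \<le> x" "x \<le> snd A" for A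
  proof -
    have "A = D" using net_eqI[OF A(1) essential_net[OF D(2)]] A D by linarith
    then show ?thesis using D by simp
  qed
  then show ?thesis using that D(1) by blast
qed

text \<open>Endpoints of level \<open>n\<close> other than \<open>x\<close> keep a positive distance
  from \<open>x\<close>. So a deeper net interval close to \<open>x\<close> has an ancestor that
  contains \<open>x\<close>.\<close>

lemma net_near:
  obtains r where "0 < r" "\<And>j D. D \<in> net_intervals (n + j) \<Longrightarrow> fst D \<le> x + r \<Longrightarrow> x - r \<le> snd D \<Longrightarrow>
    \<exists>A\<in>net_intervals n. fst A \<le> x \<and> x \<le> snd A \<and> sub D A"
proof -
  obtain e where e: "0 < e" "\<And>y. y \<in> endpoints n \<Longrightarrow> y \<noteq> x \<Longrightarrow> e \<le> dist x y"
    using finite_set_avoid[OF finite_endpoints[of n], of x] by blast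
  have "\<exists>A\<in>net_intervals n. fst A \<le> x \<and> x \<le> snd A \<and> sub D A"
    if D: "D \<in> net_intervals (n + j)" "fst D \<le> x + e / 2" "x - e / 2 \<le> snd D" for j D
  proof -
    obtain A where A: "A \<in> net_intervals n" "sub D A" using net_ancestor[OF D(1)] .
    have "fst A \<le> x"
    proof (rule ccontr)
      assume "\<not> fst A \<le> x"
      then show False using e(2)[OF netD(1)[OF A(1)]] A(2) D(2) e(1) unfolding dist_real_def by linarith
    qed
    moreover have "x \<le> snd A"
    proof (rule ccontr)
      assume "\<not> x \<le> snd A"
      then show False using e(2)[OF netD(2)[OF A(1)]] A(2) D(3) e(1) unfolding dist_real_def by linarith
    qed
    ultimately show ?thesis using A by blast
  qed
  then show ?thesis using that[of "e / 2"] e(1) by simp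
qed

text \<open>Net intervals of one level have comparable lengths and disjoint interiors, so boundedly
  many meet the ball. The heaviest one has at least the share \<open>1 / N\<close> of its
  measure.\<close>

lemma ball_cover:
  obtains N :: nat where "0 < N" "\<And>x n. 0 < ballm x (rho ^ n) \<Longrightarrow> \<exists>D\<in>net_intervals n. fst D \<le> x + rho ^ n \<and> x - rho ^ n \<le> snd D \<and>
     ballm x (rho ^ n) \<le> real N * measure mu {fst D..snd D}"
proof -
  obtain l where l: "0 < l" "\<And>n D. D \<in> net_intervals n \<Longrightarrow> l \<le> norm_length n D" using min_length by blast
  \<comment> \<open>Intervals of length at least \<open>l * rho ^ n\<close> are packed into one of
    length \<open>4 * rho ^ n\<close>: the ball, extended on each side by the maximal
    length.\<close>
  obtain N :: nat where N: "4 / l < real N" using reals_Archimedean2 by blast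
  have "\<exists>D\<in>net_intervals n. fst D \<le> x + rho ^ n \<and> x - rho ^ n \<le> snd D \<and> ballm x (rho ^ n) \<le> real N * measure mu {fst D..snd D}"
    if pos: "0 < ballm x (rho ^ n)" for x n
  proof -
    define DD where "DD = {D \<in> net_intervals n. fst D \<le> x + rho ^ n \<and> x - rho ^ n \<le> snd D}"
    have fin: "finite DD" by (simp add: DD_def)
    have "{x - rho ^ n..x + rho ^ n} \<inter> K \<subseteq> (\<Union>D\<in>DD. {fst D..snd D})"
    proof
      fix y assume y: "y \<in> {x - rho ^ n..x + rho ^ n} \<inter> K"
      then obtain D where D: "D \<in> net_intervals n" "fst D \<le> y" "y \<le> snd D" using net_point by blast
      then have "D \<in> DD" using y by (simp add: DD_def)
      then show "y \<in> (\<Union>D\<in>DD. {fst D..snd D})" by (rule UN_I) (use D in simp)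
    qed
    then have "ballm x (rho ^ n) \<le> measure mu (\<Union>D\<in>DD. {fst D..snd D})"
      using mu_Int_K[of "{x - rho ^ n..x + rho ^ n}"] mu_mono[of "{x - rho ^ n..x + rho ^ n} \<inter> K" "\<Union>D\<in>DD. {fst D..snd D}"]
        sets.finite_UN[OF fin, of "\<lambda>D. {fst D..snd D}" borel] by simp
    also have "\<dots> \<le> (\<Sum>D\<in>DD. measure mu {fst D..snd D})"
      by (rule measure_UNION_le[OF fin]) simp
    finally have sum: "ballm x (rho ^ n) \<le> (\<Sum>D\<in>DD. measure mu {fst D..snd D})" .
    then have ne: "DD \<noteq> {}" using pos by auto
    define Mx where "Mx = Max ((\<lambda>D. measure mu {fst D..snd D}) ` DD)"
    have "Mx \<in> (\<lambda>D. measure mu {fst D..snd D}) ` DD" unfolding Mx_def using fin ne by (intro Max_in) auto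
    then obtain D where D: "D \<in> DD" "Mx = measure mu {fst D..snd D}" by blast
    have "(\<Sum>D\<in>DD. measure mu {fst D..snd D}) \<le> (\<Sum>D\<in>DD. Mx)"
      unfolding Mx_def using fin by (intro sum_mono Max_ge) auto
    then have s2: "ballm x (rho ^ n) \<le> real (card DD) * Mx" using sum by simp
    have "real (card DD) * (l * rho ^ n) \<le> (\<Sum>D\<in>DD. snd D - fst D)"
    proof -
      have "l * rho ^ n \<le> snd D - fst D" if "D \<in> DD" for D
      proof -
        have "rho ^ n * l \<le> rho ^ n * norm_length n D" using l(2)[of D n] that by (intro mult_left_mono) (auto simp: DD_def)
        then show ?thesis using snd_eq[of D n] by (simp add: mult.commute)
      qed
      then show ?thesis using sum_bounded_below[of DD "l * rho ^ n" "\<lambda>D. snd D - fst D"] by simp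
    qed
    also have "\<dots> = (\<Sum>D\<in>DD. measure lborel {fst D<..<snd D})"
    proof (rule sum.cong[OF refl])
      fix D assume "D \<in> DD"
      then show "snd D - fst D = measure lborel {fst D<..<snd D}" using netD(3)[of D n] by (simp add: DD_def)
    qed
    also have "\<dots> = measure lborel (\<Union>D\<in>DD. {fst D<..<snd D})"
    proof (rule measure_finite_Union[symmetric, OF fin])
      show "disjoint_family_on (\<lambda>D. {fst D<..<snd D}) DD"
        unfolding disjoint_family_on_def
      proof (intro ballI impI)
        fix D E assume DE: "D \<in> DD" "E \<in> DD" "D \<noteq> E"
        show "{fst D<..<snd D} \<inter> {fst E<..<snd E} = {}"
        proof (rule ccontr)
          assume "{fst D<..<snd D} \<inter> {fst E<..<snd E} \<noteq> {}"
          then obtain z where "fst D < z" "z < snd D" "fst E < z" "z < snd E"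
            by (metis IntE ex_in_conv greaterThanLessThan_iff)
          then show False using net_eqI[of D n E] DE by (auto simp: DD_def)
        qed
      qed
      show "emeasure lborel {fst D<..<snd D} \<noteq> \<infinity>" if "D \<in> DD" for D
        using netD(3)[of D n] that by (simp add: DD_def)
    qed auto
    also have "\<dots> \<le> measure lborel {x - 2 * rho ^ n..x + 2 * rho ^ n}"
    proof (rule measure_mono_fmeasurable)
      show "(\<Union>D\<in>DD. {fst D<..<snd D}) \<subseteq> {x - 2 * rho ^ n..x + 2 * rho ^ n}"
      proof
        fix z assume "z \<in> (\<Union>D\<in>DD. {fst D<..<snd D})"
        then obtain D where "D \<in> DD" "fst D < z" "z < snd D" by auto
        then show "z \<in> {x - 2 * rho ^ n..x + 2 * rho ^ n}" using net_length[of D n] by (auto simp: DD_def)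
      qed
      show "{x - 2 * rho ^ n..x + 2 * rho ^ n} \<in> fmeasurable lborel" by (rule fmeasurable_compact) simp
    qed (use fin in auto)
    also have "\<dots> = 4 * rho ^ n" by simp
    finally have "(real (card DD) * l) * rho ^ n \<le> 4 * rho ^ n" by (simp add: mult.assoc)
    then have "real (card DD) * l \<le> 4" by simp
    then have "real (card DD) \<le> 4 / l" using l(1) by (simp add: pos_le_divide_eq)
    then have "real (card DD) \<le> real N" using N by linarith
    then have "real (card DD) * Mx \<le> real N * Mx" using D(2) by (intro mult_right_mono) auto
    then show ?thesis using s2 D by (intro bexI[of _ D]) (auto simp: DD_def)
  qed
  moreover have "0 < N" using N l(1) by (metis divide_pos_pos not_less_iff_gr_or_eq of_nat_0 of_nat_0_less_iff zero_less_numeral less_trans)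
  ultimately show ?thesis using that by blast
qed

text \<open>The two estimates may use different loops. Bounding the ball from above uses the
  heaviest net interval meeting it, which need not contain \<open>x\<close>; bounding it from below
  uses one that contains \<open>x\<close>.\<close>

lemma track:
  assumes "truly_essential x"
  obtains C M where "x \<in> K" "0 \<le> C"
    "\<And>n. n \<ge> M \<Longrightarrow> \<exists>k E. loop k E \<and> \<bar>real k - real n\<bar> \<le> C \<and> lm (nR + k) E \<le> - ln (ballm x (rho ^ n)) + C"
    "\<And>n. n \<ge> M \<Longrightarrow> \<exists>k E. loop k E \<and> \<bar>real k - real n\<bar> \<le> C \<and> - ln (ballm x (rho ^ n)) \<le> lm (nR + k) E + C"
proof -
  obtain n1 where x: "x \<in> K" and A: "\<And>A. A \<in> net_intervals n1 \<Longrightarrow> fst A \<le> x \<Longrightarrow> x \<le> snd A \<Longrightarrow> essential n1 A"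
    using truly_essential_nets[OF assms] by blast
  define AA where "AA = {A \<in> net_intervals n1. fst A \<le> x \<and> x \<le> snd A}"
  have finA: "finite AA" by (simp add: AA_def)
  have "\<forall>A\<in>AA. \<exists>C. \<forall>j D. D \<in> net_intervals (n1 + j) \<longrightarrow> sub D A \<longrightarrow>
    (\<exists>k E. loop k E \<and> \<bar>real k - real (n1 + j)\<bar> \<le> C \<and> \<bar>lm (nR + k) E - lm (n1 + j) D\<bar> \<le> C)"
  proof
    fix A' assume "A' \<in> AA"
    then have "essential n1 A'" using A by (simp add: AA_def)
    then obtain C where "\<And>j D. D \<in> net_intervals (n1 + j) \<Longrightarrow> sub D A' \<Longrightarrow>
      \<exists>k E. loop k E \<and> \<bar>real k - real (n1 + j)\<bar> \<le> C \<and> \<bar>lm (nR + k) E - lm (n1 + j) D\<bar> \<le> C" using essential_loop by blast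
    then show "\<exists>C. \<forall>j D. D \<in> net_intervals (n1 + j) \<longrightarrow> sub D A' \<longrightarrow>
      (\<exists>k E. loop k E \<and> \<bar>real k - real (n1 + j)\<bar> \<le> C \<and> \<bar>lm (nR + k) E - lm (n1 + j) D\<bar> \<le> C)" by blast
  qed
  from bchoice[OF this] obtain f where f: "\<And>A j D. A \<in> AA \<Longrightarrow> D \<in> net_intervals (n1 + j) \<Longrightarrow> sub D A \<Longrightarrow>
    \<exists>k E. loop k E \<and> \<bar>real k - real (n1 + j)\<bar> \<le> f A \<and> \<bar>lm (nR + k) E - lm (n1 + j) D\<bar> \<le> f A" by blast
  \<comment> \<open>The inserted 0 makes the maximum nonnegative and well-defined.\<close>
  define C2 where "C2 = Max (insert 0 (f ` AA))"
  have C2: "0 \<le> C2" "\<And>A. A \<in> AA \<Longrightarrow> f A \<le> C2" using finA by (auto simp: C2_def intro!: Max_ge)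
  obtain r where r: "0 < r" "\<And>j D. D \<in> net_intervals (n1 + j) \<Longrightarrow> fst D \<le> x + r \<Longrightarrow> x - r \<le> snd D \<Longrightarrow>
    \<exists>A\<in>net_intervals n1. fst A \<le> x \<and> x \<le> snd A \<and> sub D A" using net_near[of n1 x] by blast
  obtain N :: nat where N: "0 < N" "\<And>x n. 0 < ballm x (rho ^ n) \<Longrightarrow> \<exists>D\<in>net_intervals n. fst D \<le> x + rho ^ n \<and> x - rho ^ n \<le> snd D \<and>
     ballm x (rho ^ n) \<le> real N * measure mu {fst D..snd D}" using ball_cover by blast
  obtain C1 where C1: "0 \<le> C1" "\<And>n D. essential n D \<Longrightarrow> 0 < measure mu {fst D..snd D}"
    "\<And>n D. essential n D \<Longrightarrow> lm n D \<le> - ln (measure mu {fst D..snd D})"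
    "\<And>n D. essential n D \<Longrightarrow> - ln (measure mu {fst D..snd D}) \<le> lm n D + C1" using mu_lm by blast
  obtain M' where M': "\<And>n. n \<ge> M' \<Longrightarrow> rho ^ n < r" using rho_pow_small[OF r(1)] by blast
  define M where "M = max M' n1"
  define C where "C = C2 + ln (real N) + C1"
  have lnN: "0 \<le> ln (real N)" using N(1) by simp
  have near: "\<exists>k E. loop k E \<and> \<bar>real k - real n\<bar> \<le> C2 \<and> \<bar>lm (nR + k) E - lm n D\<bar> \<le> C2" "essential n D"
    if n: "n \<ge> M" and D: "D \<in> net_intervals n" "fst D \<le> x + rho ^ n" "x - rho ^ n \<le> snd D" for n D
  proof -
    define j where "j = n - n1"
    have nj: "n = n1 + j" using n by (simp add: j_def M_def)
    have "rho ^ n < r" using M' n by (simp add: M_def)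
    then obtain A' where A': "A' \<in> AA" "sub D A'" using r(2)[of D j] D unfolding nj AA_def by force
    then show "essential n D" using essential_desc[of n1 A' D j] A[of A'] D(1) unfolding nj AA_def by simp
    show "\<exists>k E. loop k E \<and> \<bar>real k - real n\<bar> \<le> C2 \<and> \<bar>lm (nR + k) E - lm n D\<bar> \<le> C2"
      using f[OF A'(1) _ A'(2), of j] D(1) C2(2)[OF A'(1)] unfolding nj by (meson order_trans)
  qed
  show ?thesis
  proof (rule that[OF x])
    show "0 \<le> C" using C2 C1 lnN by (simp add: C_def)
    fix n assume n: "n \<ge> M"
    have bp: "0 < ballm x (rho ^ n)" using ballm_pos[OF x] by simp
    show "\<exists>k E. loop k E \<and> \<bar>real k - real n\<bar> \<le> C \<and> lm (nR + k) E \<le> - ln (ballm x (rho ^ n)) + C"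
    proof -
      obtain D where D: "D \<in> net_intervals n" "fst D \<le> x + rho ^ n" "x - rho ^ n \<le> snd D"
        "ballm x (rho ^ n) \<le> real N * measure mu {fst D..snd D}" using N(2)[OF bp] by blast
      obtain k E where kE: "loop k E" "\<bar>real k - real n\<bar> \<le> C2" "\<bar>lm (nR + k) E - lm n D\<bar> \<le> C2"
        using near(1)[OF n D(1-3)] by blast
      have e: "essential n D" using near(2)[OF n D(1-3)] .
      have "ln (ballm x (rho ^ n)) \<le> ln (real N * measure mu {fst D..snd D})" using bp D(4) by (intro ln_mono) auto
      also have "\<dots> = ln (real N) + ln (measure mu {fst D..snd D})" using N(1) C1(2)[OF e] by (simp add: ln_mult)
      finally have "lm n D \<le> - ln (ballm x (rho ^ n)) + ln (real N)" using C1(3)[OF e] by linarith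
      then show ?thesis using kE C1(1) C2(1) lnN unfolding C_def by (intro exI[of _ k] exI[of _ E] conjI) linarith+
    qed
    show "\<exists>k E. loop k E \<and> \<bar>real k - real n\<bar> \<le> C \<and> - ln (ballm x (rho ^ n)) \<le> lm (nR + k) E + C"
    proof -
      obtain D where D: "D \<in> net_intervals n" "fst D \<le> x" "x \<le> snd D" using net_point[OF x] .
      have D': "fst D \<le> x + rho ^ n" "x - rho ^ n \<le> snd D" using D(2,3) rho_pow_pos[of n] by linarith+
      obtain k E where kE: "loop k E" "\<bar>real k - real n\<bar> \<le> C2" "\<bar>lm (nR + k) E - lm n D\<bar> \<le> C2"
        using near(1)[OF n D(1) D'] by blast
      have e: "essential n D" using near(2)[OF n D(1) D'] .
      have "{fst D..snd D} \<subseteq> {x - rho ^ n..x + rho ^ n}" using D(2,3) net_length[OF D(1)] by auto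
      then have "measure mu {fst D..snd D} \<le> ballm x (rho ^ n)" by (intro mu_mono) auto
      then have "ln (measure mu {fst D..snd D}) \<le> ln (ballm x (rho ^ n))" using C1(2)[OF e] by (intro ln_mono) auto
      then have "- ln (ballm x (rho ^ n)) \<le> lm n D + C1" using C1(4)[OF e] by linarith
      then show ?thesis using kE C1(1) C2(1) lnN unfolding C_def by (intro exI[of _ k] exI[of _ E] conjI) linarith+
    qed
  qed
qed

text \<open>Bounds for the rates of all loops pass to the point because \<open>track\<close>
  replaces a ball by a loop with bounded errors in level and weight.\<close>

lemma truly_essential_bounds:
  assumes x: "truly_essential x"
    and a: "\<And>k E. loop k E \<Longrightarrow> a * (real k * Lam) - C0 \<le> lm (nR + k) E"
    and b: "\<And>k E. loop k E \<Longrightarrow> lm (nR + k) E \<le> b * (real k * Lam) + C0"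
  shows "ereal a \<le> lower_local_dim mu x" "upper_local_dim mu x \<le> ereal b"
proof -
  obtain C M where xK: "x \<in> K" and C: "0 \<le> C"
    and lo: "\<And>n. n \<ge> M \<Longrightarrow> \<exists>k E. loop k E \<and> \<bar>real k - real n\<bar> \<le> C \<and> lm (nR + k) E \<le> - ln (ballm x (rho ^ n)) + C"
    and up: "\<And>n. n \<ge> M \<Longrightarrow> \<exists>k E. loop k E \<and> \<bar>real k - real n\<bar> \<le> C \<and> - ln (ballm x (rho ^ n)) \<le> lm (nR + k) E + C"
    using track[OF x] by blast
  have dev: "\<bar>a * (real k * Lam) - a * (real n * Lam)\<bar> \<le> \<bar>a\<bar> * (C * Lam)" if "\<bar>real k - real n\<bar> \<le> C" for a k n
  proof -
    have "a * (real k * Lam) - a * (real n * Lam) = a * ((real k - real n) * Lam)" by (simp add: algebra_simps)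
    moreover have "\<bar>(real k - real n) * Lam\<bar> \<le> C * Lam"
      unfolding abs_mult using that Lam_pos C by (intro mult_mono) auto
    ultimately have "\<bar>a * (real k * Lam) - a * (real n * Lam)\<bar> = \<bar>a\<bar> * \<bar>(real k - real n) * Lam\<bar>"
      by (simp only: abs_mult)
    also have "\<dots> \<le> \<bar>a\<bar> * (C * Lam)" using \<open>\<bar>(real k - real n) * Lam\<bar> \<le> C * Lam\<close> by (intro mult_left_mono) auto
    finally show ?thesis .
  qed
  show "ereal a \<le> lower_local_dim mu x"
  proof (rule lower_dim_ge[OF xK, of M a "\<bar>a\<bar> * (C * Lam) + C0 + C"])
    fix n assume "n \<ge> M"
    from lo[OF this] obtain k E where k: "loop k E" "\<bar>real k - real n\<bar> \<le> C" "lm (nR + k) E \<le> - ln (ballm x (rho ^ n)) + C" by blast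
    show "a * (real n * Lam) - (\<bar>a\<bar> * (C * Lam) + C0 + C) \<le> - ln (ballm x (rho ^ n))"
      using a[OF k(1)] k(3) dev[OF k(2), of a] by linarith
  qed
  show "upper_local_dim mu x \<le> ereal b"
  proof (rule upper_dim_le[OF xK, of M b "\<bar>b\<bar> * (C * Lam) + C0 + C"])
    fix n assume "n \<ge> M"
    from up[OF this] obtain k E where k: "loop k E" "\<bar>real k - real n\<bar> \<le> C" "- ln (ballm x (rho ^ n)) \<le> lm (nR + k) E + C" by blast
    show "- ln (ballm x (rho ^ n)) \<le> b * (real n * Lam) + (\<bar>b\<bar> * (C * Lam) + C0 + C)"
      using b[OF k(1)] k(3) dev[OF k(2), of b] by linarith
  qed
qed

lemma local_dim_limit:
  assumes "has_local_dim mu x (ereal t)"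
  shows "(\<lambda>n. - ln (ballm x (rho ^ n)) / real n) \<longlonglongrightarrow> t * Lam"
proof -
  have "((\<lambda>r. ereal (ln (ballm x r) / ln r)) \<longlongrightarrow> ereal t) (at_right 0)"
    using assms unfolding has_local_dim_def lower_local_dim_def upper_local_dim_def
    by (intro Liminf_eq_Limsup) auto
  then have lim: "((\<lambda>r. ln (ballm x r) / ln r) \<longlongrightarrow> t) (at_right 0)" by simp
  have "filterlim (\<lambda>n. rho ^ n) (at_right 0) sequentially"
    by (intro tendsto_imp_filterlim_at_right[OF rho_pow_tendsto_0] always_eventually) simp
  from filterlim_compose[OF lim this] have "(\<lambda>n. ln (ballm x (rho ^ n)) / ln (rho ^ n)) \<longlonglongrightarrow> t" .
  from tendsto_mult_right[OF this, of Lam] have "(\<lambda>n. ln (ballm x (rho ^ n)) / ln (rho ^ n) * Lam) \<longlonglongrightarrow> t * Lam" .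
  moreover have "ln (ballm x (rho ^ n)) / ln (rho ^ n) * Lam = - ln (ballm x (rho ^ n)) / real n" for n
    using Lam_pos rho_pos by (cases "n = 0") (auto simp: ln_realpow)
  ultimately show ?thesis by simp
qed

text \<open>The converse use of \<open>track\<close>: at deep levels its errors are small compared
  with the level, so the loops obtained have rates close to the local dimension.\<close>

lemma approximating_loops:
  assumes "truly_essential x" "has_local_dim mu x (ereal t)" "0 < e"
  shows "\<exists>k E. loop k E \<and> k \<ge> L \<and> lm (nR + k) E \<le> (t + e) * (real k * Lam)"
    and "\<exists>k E. loop k E \<and> k \<ge> L \<and> (t - e) * (real k * Lam) \<le> lm (nR + k) E"
proof -
  obtain C M where "x \<in> K" and C: "0 \<le> C"
    and lo: "\<And>n. n \<ge> M \<Longrightarrow> \<exists>k E. loop k E \<and> \<bar>real k - real n\<bar> \<le> C \<and> lm (nR + k) E \<le> - ln (ballm x (rho ^ n)) + C"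
    and up: "\<And>n. n \<ge> M \<Longrightarrow> \<exists>k E. loop k E \<and> \<bar>real k - real n\<bar> \<le> C \<and> - ln (ballm x (rho ^ n)) \<le> lm (nR + k) E + C"
    using track[OF assms(1)] by blast
  \<comment> \<open>Half of the allowed error goes to the convergence at level \<open>n\<close>; the
    other half absorbs the constants \<open>W\<close> once \<open>n\<close> is large.\<close>
  define h where "h = e * Lam / 2"
  have h: "0 < h" unfolding h_def using mult_pos_pos[OF assms(3) Lam_pos] by linarith
  define W where "W = \<bar>t\<bar> * Lam * C + h * C + C"
  have Lam0: "0 \<le> Lam" using Lam_pos by linarith
  have "0 \<le> \<bar>t\<bar> * Lam * C" using C Lam0 by (intro mult_nonneg_nonneg) (simp_all only: abs_ge_zero)
  moreover have "0 \<le> h * C" using C h by simp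
  ultimately have W: "0 \<le> W" unfolding W_def using C by linarith
  obtain n1 where n1: "\<And>n. n \<ge> n1 \<Longrightarrow> dist (- ln (ballm x (rho ^ n)) / real n) (t * Lam) < h"
    using metric_LIMSEQ_D[OF local_dim_limit[OF assms(2)] h] by blast
  obtain n2 :: nat where n2: "W / h + C + real L + 1 < real n2" using reals_Archimedean2 by blast
  define n where "n = max (max M n1) n2"
  have n: "n \<ge> M" "n \<ge> n1" "W / h + C + real L + 1 < real n" using n2 by (auto simp: n_def)
  have "0 \<le> W / h" using W h by simp
  then have npos: "0 < real n" using n(3) C by linarith
  define Y where "Y = - ln (ballm x (rho ^ n))"
  have "\<bar>Y / real n - t * Lam\<bar> < h" using n1[OF n(2)] by (simp add: dist_real_def Y_def)
  moreover have "Y / real n - t * Lam = (Y - t * Lam * real n) / real n" using npos by (simp add: field_simps)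
  ultimately have "\<bar>Y - t * Lam * real n\<bar> < h * real n" using npos by (simp add: abs_divide pos_divide_less_eq)
  then have Y: "\<bar>Y - t * Lam * real n\<bar> \<le> h * real n" by simp
  have dev: "L \<le> k \<and> \<bar>Y - t * Lam * real k\<bar> + C \<le> 2 * h * real k" if k: "\<bar>real k - real n\<bar> \<le> C" for k
  proof -
    have "W / h < real k" "real L \<le> real k" using k n(3) \<open>0 \<le> W / h\<close> C by linarith+
    then have Wk: "W \<le> h * real k" using h by (simp add: pos_divide_less_eq mult.commute)
    have "\<bar>t * Lam * real n - t * Lam * real k\<bar> \<le> \<bar>t\<bar> * Lam * C"
    proof -
      have "t * Lam * real n - t * Lam * real k = (t * Lam) * (real n - real k)" by (simp add: algebra_simps)
      then have "\<bar>t * Lam * real n - t * Lam * real k\<bar> = (\<bar>t\<bar> * Lam) * \<bar>real n - real k\<bar>"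
        using Lam_pos by (simp add: abs_mult)
      also have "\<dots> \<le> (\<bar>t\<bar> * Lam) * C" using k Lam_pos by (intro mult_left_mono mult_nonneg_nonneg) auto
      finally show ?thesis .
    qed
    moreover have "h * real n \<le> h * (real k + C)" using k h by (intro mult_left_mono) auto
    ultimately show ?thesis using Y Wk \<open>real L \<le> real k\<close> unfolding W_def by (simp add: algebra_simps)
  qed
  have eh: "(t + e) * (real k * Lam) = t * Lam * real k + 2 * h * real k" "(t - e) * (real k * Lam) = t * Lam * real k - 2 * h * real k" for k
    by (simp_all add: h_def algebra_simps)
  obtain k E where k: "loop k E" "\<bar>real k - real n\<bar> \<le> C" "lm (nR + k) E \<le> Y + C" using lo[OF n(1)] by (auto simp: Y_def)
  show "\<exists>k E. loop k E \<and> k \<ge> L \<and> lm (nR + k) E \<le> (t + e) * (real k * Lam)"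
    using dev[OF k(2)] k unfolding eh by (intro exI[of _ k] exI[of _ E] conjI) linarith+
  obtain k' E' where k': "loop k' E'" "\<bar>real k' - real n\<bar> \<le> C" "Y \<le> lm (nR + k') E' + C" using up[OF n(1)] by (auto simp: Y_def)
  show "\<exists>k E. loop k E \<and> k \<ge> L \<and> (t - e) * (real k * Lam) \<le> lm (nR + k) E"
    using dev[OF k'(2)] k' unfolding eh by (intro exI[of _ k'] exI[of _ E'] conjI) linarith+
qed

end

subsection \<open>Prescribed local dimensions\<close>

text \<open>The error \<open>z\<close> either gains a fraction of the block length that tends to 0
  or is bounded by a multiple of one block. Blocks are negligible against \<open>N\<close> since
  \<open>len i * j i\<close> stays below \<open>N i\<close> while \<open>j\<close> tends to
  infinity; so the error is negligible too.\<close>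

lemma greedy_limit:
  fixes N len j :: "nat \<Rightarrow> nat" and z :: "nat \<Rightarrow> real"
  assumes N: "\<And>i. N (Suc i) = N i + len i" and len: "\<And>i. 0 < len i" "\<And>i. len i * j i \<le> N i"
    and j: "filterlim j at_top sequentially" and a: "0 \<le> a"
    and z: "\<And>i. \<bar>z (Suc i)\<bar> \<le> max (\<bar>z i\<bar> + a * real (len i) / (1 + real (j i))) (a * real (len i))"
  shows "(\<lambda>i. real (N (Suc i)) / real (N i)) \<longlonglongrightarrow> 1" "(\<lambda>i. z i / real (N i)) \<longlonglongrightarrow> 0"
proof -
  have jr: "filterlim (\<lambda>i. real (j i)) at_top sequentially"
    by (rule filterlim_compose[OF filterlim_real_sequentially j])
  have j1: "\<forall>\<^sub>F i in sequentially. j i \<ge> 1" using j by (simp add: filterlim_at_top)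
  have sm: "strict_mono N" using N len(1) by (simp add: strict_mono_Suc_iff)
  have Nr: "filterlim (\<lambda>i. real (N i)) at_top sequentially"
    by (rule filterlim_compose[OF filterlim_real_sequentially filterlim_subseq[OF sm]])
  have q: "real (len i) / real (N i) \<le> 1 / real (j i)" if "j i \<ge> 1" for i
  proof -
    have "1 * 1 \<le> len i * j i" using len(1)[of i] that by (intro mult_le_mono) auto
    then have "0 < real (N i)" using len(2)[of i] by linarith
    moreover have "real (len i) * real (j i) \<le> real (N i)" using len(2)[of i] by (metis of_nat_le_iff of_nat_mult)
    ultimately show ?thesis using that by (simp add: field_simps)
  qed
  have "(\<lambda>i. 1 / real (j i)) \<longlonglongrightarrow> 0"
    by (intro tendsto_divide_0[OF tendsto_const] filterlim_at_top_imp_at_infinity jr)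
  then have l0: "(\<lambda>i. real (len i) / real (N i)) \<longlonglongrightarrow> 0"
    by (rule tendsto_sandwich[OF _ _ tendsto_const, rotated 2]) (use q j1 in \<open>auto elim: eventually_mono\<close>)
  from tendsto_add[OF tendsto_const[of 1] this]
  have "(\<lambda>i. 1 + real (len i) / real (N i)) \<longlonglongrightarrow> 1" by simp
  moreover have "\<forall>\<^sub>F i in sequentially. 1 + real (len i) / real (N i) = real (N (Suc i)) / real (N i)"
    using j1
  proof eventually_elim
    case (elim i)
    have "1 * 1 \<le> len i * j i" using len(1)[of i] elim by (intro mult_le_mono) auto
    then have "N i \<noteq> 0" using len(2)[of i] by linarith
    then show ?case by (simp add: N add_divide_distrib)
  qed
  ultimately show "(\<lambda>i. real (N (Suc i)) / real (N i)) \<longlonglongrightarrow> 1" by (rule Lim_transform_eventually)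
  show "(\<lambda>i. z i / real (N i)) \<longlonglongrightarrow> 0"
  proof (rule LIMSEQ_I)
    fix e :: real assume e: "0 < e"
    have "\<forall>\<^sub>F i in sequentially. 2 * a / e + 1 \<le> real (j i)" using jr by (simp add: filterlim_at_top)
    then obtain i0 where i0: "\<And>i. i \<ge> i0 \<Longrightarrow> 2 * a / e + 1 \<le> real (j i)" by (auto simp: eventually_sequentially)
    have ae: "0 \<le> 2 * a / e" using a e by simp
    \<comment> \<open>From \<open>i0\<close> on \<open>j i\<close> is at least about
      \<open>2 * a / e\<close>, which makes both alternatives for the error small.\<close>
    have est: "a * real (len i) / (1 + real (j i)) \<le> e / 2 * real (len i) \<and> a * real (len i) \<le> e / 2 * real (N i)" if "i \<ge> i0" for i
    proof -
      have b: "2 * a / e \<le> real (j i)" "1 \<le> real (j i)" using i0[OF that] ae by linarith+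
      then have c: "a \<le> e / 2 * real (j i)" using e by (simp add: field_simps)
      have "a \<le> e / 2 * (1 + real (j i))" using c e by (simp add: algebra_simps)
      then have "a * real (len i) \<le> (e / 2 * (1 + real (j i))) * real (len i)" by (intro mult_right_mono) auto
      then have 1: "a * real (len i) / (1 + real (j i)) \<le> e / 2 * real (len i)" by (simp add: field_simps)
      have "a * real (len i) \<le> e / 2 * (real (j i) * real (len i))" using mult_right_mono[OF c, of "real (len i)"] by (simp add: mult.assoc)
      also have "real (j i) * real (len i) \<le> real (N i)" using len(2)[of i] by (metis mult.commute of_nat_le_iff of_nat_mult)
      then have "e / 2 * (real (j i) * real (len i)) \<le> e / 2 * real (N i)" using e by (intro mult_left_mono) auto
      finally show ?thesis using 1 by blast
    qed
    have bound: "\<bar>z i\<bar> \<le> \<bar>z i0\<bar> + e / 2 * real (N i)" if "i \<ge> i0" for i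
      using that
    proof (induction i rule: dec_induct)
      case base
      show ?case using e by simp
    next
      case (step i)
      have "e / 2 * real (N i) \<le> e / 2 * real (N (Suc i))" using e by (intro mult_left_mono) (auto simp: N)
      moreover have "e / 2 * real (N (Suc i)) = e / 2 * real (N i) + e / 2 * real (len i)" by (simp add: N algebra_simps)
      ultimately show ?case using z[of i] step.IH est[OF step.hyps(1)] by linarith
    qed
    have "\<forall>\<^sub>F i in sequentially. 2 * \<bar>z i0\<bar> / e + 1 \<le> real (N i)" using Nr by (simp add: filterlim_at_top)
    then obtain i1 where i1: "\<And>i. i \<ge> i1 \<Longrightarrow> 2 * \<bar>z i0\<bar> / e + 1 \<le> real (N i)" by (auto simp: eventually_sequentially)
    have "norm (z i / real (N i) - 0) < e" if i: "i \<ge> max i0 i1" for i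
    proof -
      have z0: "0 \<le> 2 * \<bar>z i0\<bar> / e" using e by simp
      have n: "2 * \<bar>z i0\<bar> / e < real (N i)" using i1[of i] i by linarith
      then have "0 < real (N i)" using z0 by linarith
      moreover have "\<bar>z i0\<bar> < e / 2 * real (N i)" using n e by (simp add: field_simps)
      then have "\<bar>z i\<bar> < e * real (N i)" using bound[of i] i by simp
      ultimately show ?thesis by (simp add: abs_divide pos_divide_less_eq)
    qed
    then show "\<exists>no. \<forall>n\<ge>no. norm (z n / real (N n) - 0) < e" by blast
  qed
qed

context ft_ssm
begin

text \<open>Blocks of rate nearly at most \<open>t\<close> and nearly at least \<open>t\<close> are
  composed so as to push the error back to 0. The stage \<open>j\<close> improves the blocks but
  advances only when the longer blocks are short compared with what has been built.\<close>

lemma dim_exists: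
  assumes t: "\<And>L e. 0 < e \<Longrightarrow> \<exists>k E. loop k E \<and> k \<ge> L \<and> lm (nR + k) E \<le> (t + e) * (real k * Lam)"
    "\<And>L e. 0 < e \<Longrightarrow> \<exists>k E. loop k E \<and> k \<ge> L \<and> (t - e) * (real k * Lam) \<le> lm (nR + k) E"
  shows "\<exists>x. interior_essential x \<and> has_local_dim mu x (ereal t)"
proof -
  \<comment> \<open>Besides the rate, a block of stage \<open>j\<close> has length at least
    \<open>Suc j\<close>, so that the composition error \<open>C0\<close> is a small fraction of the
    length.\<close>
  have "\<forall>j. \<exists>u. loop (fst u) (snd u) \<and> fst u \<ge> Suc j \<and> lm (nR + fst u) (snd u) \<le> (t + 1 / (1 + real j)) * (real (fst u) * Lam)"
  proof
    fix j :: nat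
    obtain k E where "loop k E" "Suc j \<le> k" "lm (nR + k) E \<le> (t + 1 / (1 + real j)) * (real k * Lam)"
      using t(1)[of "1 / (1 + real j)" "Suc j"] by auto
    then show "\<exists>u. loop (fst u) (snd u) \<and> fst u \<ge> Suc j \<and> lm (nR + fst u) (snd u) \<le> (t + 1 / (1 + real j)) * (real (fst u) * Lam)"
      by (intro exI[of _ "(k, E)"]) auto
  qed
  from choice[OF this] obtain U where U: "\<And>j. loop (fst (U j)) (snd (U j))" "\<And>j. Suc j \<le> fst (U j)"
    "\<And>j. lm (nR + fst (U j)) (snd (U j)) \<le> (t + 1 / (1 + real j)) * (real (fst (U j)) * Lam)" by blast
  have "\<forall>j. \<exists>u. loop (fst u) (snd u) \<and> fst u \<ge> Suc j \<and> (t - 1 / (1 + real j)) * (real (fst u) * Lam) \<le> lm (nR + fst u) (snd u)"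
  proof
    fix j :: nat
    obtain k E where "loop k E" "Suc j \<le> k" "(t - 1 / (1 + real j)) * (real k * Lam) \<le> lm (nR + k) E"
      using t(2)[of "1 / (1 + real j)" "Suc j"] by auto
    then show "\<exists>u. loop (fst u) (snd u) \<and> fst u \<ge> Suc j \<and> (t - 1 / (1 + real j)) * (real (fst u) * Lam) \<le> lm (nR + fst u) (snd u)"
      by (intro exI[of _ "(k, E)"]) auto
  qed
  from choice[OF this] obtain V where V: "\<And>j. loop (fst (V j)) (snd (V j))" "\<And>j. Suc j \<le> fst (V j)"
    "\<And>j. (t - 1 / (1 + real j)) * (real (fst (V j)) * Lam) \<le> lm (nR + fst (V j)) (snd (V j))" by blast
  define mx where "mx = (\<lambda>j. max (fst (U j)) (fst (V j)))"
  \<comment> \<open>A nonnegative error calls for a block of small rate, a negative one for a block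
    of large rate.\<close>
  define pick where "pick = (\<lambda>K D j. if t * Lam * real (nR + K) \<le> lm (nR + K) D then U j else V j)"
  \<comment> \<open>\<open>mx j\<close> bounds the block lengths of stage \<open>j\<close>; the test
    secures the invariant \<open>inv\<close>, that is, \<open>len i * j i\<close> is at most
    \<open>N i\<close>.\<close>
  define nxt where "nxt = (\<lambda>K j. if mx (Suc j) * Suc j \<le> (K::nat) then Suc j else j)"
  define step where "step = (\<lambda>(K, D, j). (K + fst (pick K D j), comp (nR + K) D (snd (pick K D j)), nxt (K + fst (pick K D j)) j))"
  define st where "st = rec_nat (fst (U 0), snd (U 0), 0) (\<lambda>_. step)"
  define K where "K = (\<lambda>i. fst (st i))"
  define D where "D = (\<lambda>i. fst (snd (st i)))"
  define j where "j = (\<lambda>i. snd (snd (st i)))"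
  define blk where "blk = (\<lambda>i. pick (K i) (D i) (j i))"
  define len where "len = (\<lambda>i. fst (blk i))"
  have "st (Suc i) = step (st i)" for i by (simp add: st_def)
  then have rec: "K (Suc i) = K i + len i" "D (Suc i) = comp (nR + K i) (D i) (snd (blk i))" "j (Suc i) = nxt (K (Suc i)) (j i)" for i
    by (simp_all add: K_def D_def j_def step_def len_def blk_def split_beta)
  have zero: "K 0 = fst (U 0)" "D 0 = snd (U 0)" "j 0 = 0" by (simp_all add: K_def D_def j_def st_def)
  have blk: "loop (len i) (snd (blk i))" "Suc (j i) \<le> len i" "len i \<le> mx (j i)" for i
    using U V by (auto simp: len_def blk_def pick_def mx_def)
  have len0: "0 < len i" for i using blk(2)[of i] by linarith
  have lD: "loop (K i) (D i)" for i
  proof (induction i)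
    case (Suc i)
    show ?case unfolding rec by (rule loop_comp[OF Suc blk(1)])
  qed (use U zero in simp)
  have inv: "mx (j i) * j i \<le> K i" for i
  proof (induction i)
    case (Suc i)
    show ?case
    proof (cases "mx (Suc (j i)) * Suc (j i) \<le> K (Suc i)")
      case False
      then have "j (Suc i) = j i" by (simp only: rec(3) nxt_def if_False)
      then show ?thesis using Suc rec(1)[of i] by simp
    qed (simp only: rec(3) nxt_def if_True)
  qed (simp add: zero)
  have Ki: "i \<le> K i" for i
  proof (induction i)
    case (Suc i)
    then show ?case using rec(1)[of i] len0[of i] by linarith
  qed simp
  have jm: "j i \<le> j (Suc i)" for i by (simp add: rec(3) nxt_def)
  then have jmono: "i \<le> i' \<Longrightarrow> j i \<le> j i'" for i i' by (rule lift_Suc_mono_le)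
  have unb: "\<exists>i. J \<le> j i" for J
  proof (induction J)
    case (Suc J)
    then obtain i where i: "J \<le> j i" by blast
    show ?case
    proof (rule ccontr)
      assume "\<nexists>i. Suc J \<le> j i"
      then have le: "j i' \<le> J" for i' by (meson not_less_eq_eq)
      \<comment> \<open>If stage \<open>J\<close> were never left, the total length would still grow
        past the fixed threshold of the next stage.\<close>
      define i' where "i' = max i (mx (Suc J) * Suc J)"
      have eq: "j i' = J" using le[of i'] i jmono[of i i'] by (simp add: i'_def)
      have "mx (Suc J) * Suc J \<le> K (Suc i')" using Ki[of "Suc i'"] unfolding i'_def by linarith
      then have "j (Suc i') = Suc J" unfolding rec(3) eq nxt_def by (simp only: if_True)
      then show False using le[of "Suc i'"] by simp
    qed
  qed simp
  have jinf: "filterlim j at_top sequentially"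
    unfolding filterlim_at_top
  proof
    fix J
    obtain i where "J \<le> j i" using unb by blast
    then show "\<forall>\<^sub>F i in sequentially. J \<le> j i" using jmono by (intro eventually_sequentiallyI[of i]) (metis order_trans)
  qed
  define N where "N = (\<lambda>i. nR + K i)"
  define z where "z = (\<lambda>i. lm (N i) (D i) - t * Lam * real (N i))"
  define P where "P = - ln pmin"
  have P: "0 \<le> P" using pmin by (simp add: P_def)
  \<comment> \<open>One constant for all error terms of a step: rate tolerance, composition error,
    target rate, and the maximal weight of a block per unit length.\<close>
  define a where "a = Lam + C0 + \<bar>t\<bar> * Lam + (real nR + 1) * P"
  have Lam0: "0 \<le> Lam" using Lam_pos by linarith
  have tL: "0 \<le> \<bar>t\<bar> * Lam" "0 \<le> (real nR + 1) * P" using Lam0 P by (simp_all only: mult_nonneg_nonneg abs_ge_zero add_nonneg_nonneg of_nat_0_le_iff zero_le_one)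
  have a0: "0 \<le> a" unfolding a_def using Lam0 C0_nonneg tL by linarith
  have Nrec: "N (Suc i) = N i + len i" for i by (simp add: N_def rec)
  have zstep: "\<bar>z (Suc i)\<bar> \<le> max (\<bar>z i\<bar> + a * real (len i) / (1 + real (j i))) (a * real (len i))" for i
  proof -
    define l where "l = real (len i)"
    define w where "w = lm (nR + len i) (snd (blk i))"
    have l1: "1 \<le> l" "1 + real (j i) \<le> l" using blk(2)[of i] by (simp_all add: l_def)
    have net: "snd (blk i) \<in> net_intervals (nR + len i)" "sub (snd (blk i)) R" using loopD(2,8)[OF blk(1)] by blast+
    have "\<bar>lm (N i + len i) (D (Suc i)) - lm (N i) (D i) - w\<bar> \<le> C0"
      unfolding rec(2) N_def w_def by (rule comp_quasi[OF loop_good[OF lD] net])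
    then have zq: "\<bar>z (Suc i) - z i - (w - t * Lam * l)\<bar> \<le> C0"
      by (simp add: z_def Nrec l_def algebra_simps)
    have w0: "0 \<le> w" unfolding w_def by (rule lm_nonneg[OF net(1)])
    have "w \<le> (real nR + l) * P" using lm_le[OF net(1)] by (simp add: w_def l_def P_def)
    also have "\<dots> \<le> ((real nR + 1) * l) * P"
    proof -
      have "real nR \<le> real nR * l" using l1(1) by (simp add: mult_le_cancel_left1)
      then show ?thesis using P by (intro mult_right_mono) (auto simp: algebra_simps)
    qed
    finally have w1: "w \<le> (real nR + 1) * P * l" by (simp add: mult_ac)
    have C0l: "C0 \<le> C0 * l" using C0_nonneg l1(1) by (simp add: mult_le_cancel_left1)
    have Cd: "C0 \<le> C0 * l / (1 + real (j i))"
      using mult_left_mono[OF l1(2) C0_nonneg] by (simp add: pos_le_divide_eq)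
    have al: "a * l = Lam * l + C0 * l + \<bar>t\<bar> * Lam * l + (real nR + 1) * P * l" by (simp add: a_def algebra_simps)
    have nn: "0 \<le> Lam * l" "0 \<le> \<bar>t\<bar> * Lam * l" "0 \<le> (real nR + 1) * P * l"
      using Lam0 tL l1(1) by (simp_all only: mult_nonneg_nonneg order_trans[OF zero_le_one])
    have tl: "\<bar>t * Lam * l\<bar> = \<bar>t\<bar> * Lam * l" using Lam0 l1(1) by (simp add: abs_mult)
    have big: "a * l / (1 + real (j i)) = Lam * l / (1 + real (j i)) + C0 * l / (1 + real (j i)) + (\<bar>t\<bar> * Lam * l + (real nR + 1) * P * l) / (1 + real (j i))"
      unfolding al by (simp add: add_divide_distrib diff_divide_distrib)
    have nn2: "0 \<le> (\<bar>t\<bar> * Lam * l + (real nR + 1) * P * l) / (1 + real (j i))" using nn by (intro divide_nonneg_nonneg add_nonneg_nonneg) auto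
    \<comment> \<open>The chosen block can enlarge the error away from 0 only by its tolerance and
      \<open>C0\<close>. In the other direction the error may cross 0, but it then stays within the
      size of one block.\<close>
    show ?thesis
    proof (cases "0 \<le> z i")
      case True
      then have "blk i = U (j i)" by (simp add: blk_def pick_def z_def N_def)
      then have "w \<le> (t + 1 / (1 + real (j i))) * (l * Lam)" using U(3)[of "j i"] by (simp add: w_def l_def len_def)
      also have "\<dots> = t * Lam * l + Lam * l / (1 + real (j i))" by (simp add: algebra_simps)
      finally have "z (Suc i) \<le> \<bar>z i\<bar> + a * l / (1 + real (j i))" using zq Cd big nn2 True by linarith
      moreover have "- (a * l) \<le> z (Suc i)" using zq True w0 C0l al nn tl by linarith
      moreover have "0 \<le> \<bar>z i\<bar> + a * l / (1 + real (j i))" using a0 l1 by (intro add_nonneg_nonneg divide_nonneg_nonneg mult_nonneg_nonneg) auto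
      ultimately show ?thesis unfolding l_def[symmetric] by linarith
    next
      case False
      then have "blk i = V (j i)" by (simp add: blk_def pick_def z_def N_def)
      then have "(t - 1 / (1 + real (j i))) * (l * Lam) \<le> w" using V(3)[of "j i"] by (simp add: w_def l_def len_def)
      moreover have "(t - 1 / (1 + real (j i))) * (l * Lam) = t * Lam * l - Lam * l / (1 + real (j i))" by (simp add: algebra_simps)
      ultimately have "- (\<bar>z i\<bar> + a * l / (1 + real (j i))) \<le> z (Suc i)" using zq Cd big nn2 False by linarith
      moreover have "z (Suc i) \<le> a * l" using zq False w1 C0l al nn tl by linarith
      moreover have "0 \<le> a * l" using a0 l1 by simp
      ultimately show ?thesis unfolding l_def[symmetric] by linarith
    qed
  qed
  have lj: "len i * j i \<le> N i" for i
    using inv[of i] mult_le_mono1[OF blk(3), of i "j i"] unfolding N_def by linarith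
  note lim = greedy_limit[OF Nrec len0 lj jinf a0 zstep]
  have Nsm: "strict_mono N" using Nrec len0 by (simp add: strict_mono_Suc_iff)
  have lmlim: "(\<lambda>i. lm (N i) (D i) / real (N i)) \<longlonglongrightarrow> t * Lam"
  proof -
    have "N i \<noteq> 0" for i by (simp add: N_def nR)
    then have "lm (N i) (D i) / real (N i) = z i / real (N i) + t * Lam" for i
      by (simp add: z_def diff_divide_distrib add_divide_distrib)
    then show ?thesis using tendsto_add[OF lim(2) tendsto_const[of "t * Lam"]] by simp
  qed
  have ess: "essential (N i) (D i)" for i unfolding N_def by (rule loop_essential[OF lD])
  have m: "fst (D i) + gap * rho ^ N (Suc i) \<le> fst (D (Suc i)) \<and> snd (D (Suc i)) + gap * rho ^ N (Suc i) \<le> snd (D i)" for i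
    using comp_margin[OF loopD(2,3)[OF lD[of i]] blk(1)[of i]] unfolding Nrec unfolding rec(2) N_def by blast
  obtain x where x: "interior_essential x" "\<And>i. fst (D i) < x" "\<And>i. x < snd (D i)"
    "\<And>i. fst (D i) + gap * rho ^ N (Suc i) \<le> x" "\<And>i. x + gap * rho ^ N (Suc i) \<le> snd (D i)"
    using nested_point[OF Nsm ess conjunct1[OF m] conjunct2[OF m]] by metis
  have "has_local_dim mu x (ereal t)"
    using sequence_dim[OF _ Nsm lim(1) ess _ _ x(4,5) lmlim] x(1,2,3) unfolding interior_essential_def
    by (meson less_imp_le)
  then show ?thesis using x(1) by blast
qed

lemma interior_truly: "interior_essential x \<Longrightarrow> truly_essential x"
  by (simp add: truly_essential_def)

text \<open>Loops and positive periodic points exchange rates up to \<open>C0\<close>. Loops thus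
  inherit the bounds of \<open>A\<close>, and elements of \<open>A\<close> near its infimum and
  supremum supply long loops for \<open>dim_exists\<close>.\<close>

lemma local_dims:
  defines "A \<equiv> {t. \<exists>x. interior_essential x \<and> positive_periodic x \<and> has_local_dim mu x t}"
  shows "\<And>x. truly_essential x \<Longrightarrow> Inf A \<le> lower_local_dim mu x \<and> upper_local_dim mu x \<le> Sup A"
    and "\<And>t. Inf A \<le> t \<Longrightarrow> t \<le> Sup A \<Longrightarrow> \<exists>x. interior_essential x \<and> has_local_dim mu x t"
proof -
  \<comment> \<open>A ball of radius \<open>rho ^ n\<close> centred in \<open>K\<close> has measure
    at least \<open>pmin ^ n\<close>, so every dimension is at most \<open>T\<close>.\<close>
  define T where "T = - ln pmin / Lam"
  have A_range: "0 \<le> t \<and> t \<le> ereal T" if "t \<in> A" for t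
  proof -
    obtain x where x: "interior_essential x" "has_local_dim mu x t" using \<open>t \<in> A\<close> by (auto simp: A_def)
    then have xK: "x \<in> K" by (simp add: interior_essential_def)
    have "ereal 0 \<le> lower_local_dim mu x"
      by (rule lower_dim_ge[OF xK, of 0 0 0]) (use ballm_pos[OF xK] mu_le_1 in simp)
    moreover have "upper_local_dim mu x \<le> ereal T"
    proof (rule upper_dim_le[OF xK, of 0 T 0])
      fix n
      have "ln (pmin ^ n) \<le> ln (ballm x (rho ^ n))" using mu_ball_ge[OF xK] pmin(1) by (intro ln_mono) auto
      then have "- ln (ballm x (rho ^ n)) \<le> real n * - ln pmin" using pmin(1) by (simp add: ln_realpow)
      also have "\<dots> = T * (real n * Lam)" using Lam_pos by (simp add: T_def)
      finally show "- ln (ballm x (rho ^ n)) \<le> T * (real n * Lam) + 0" by simp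
    qed
    ultimately show ?thesis using x(2) by (simp add: has_local_dim_def zero_ereal_def)
  qed
  have loopA: "\<exists>s. ereal s \<in> A \<and> \<bar>s * (real k * Lam) - lm (nR + k) E\<bar> \<le> C0" if "loop k E" for k E
    using loop_periodic[OF that] unfolding A_def by blast
  \<comment> \<open>A connector below \<open>R\<close> is already a loop; it shows that
    \<open>A\<close> is nonempty, and hence that its infimum and supremum are finite.\<close>
  obtain k E where "conn B nR R k E" using conn_B[OF essential_R] .
  then have "loop (0 + k) E" using loop_conn[of R 0 k E] R_net by simp
  then obtain s0 where s0: "ereal s0 \<in> A" using loopA by blast
  have "0 \<le> Inf A" using A_range by (intro Inf_greatest) auto
  moreover have "Inf A \<le> ereal s0" using s0 by (rule Inf_lower)
  ultimately obtain a where a: "Inf A = ereal a" by (cases "Inf A") auto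
  have "Sup A \<le> ereal T" using A_range by (intro Sup_least) auto
  moreover have "ereal s0 \<le> Sup A" using s0 by (rule Sup_upper)
  ultimately obtain b where b: "Sup A = ereal b" by (cases "Sup A") auto
  have ab: "a \<le> s \<and> s \<le> b" if "ereal s \<in> A" for s
    using Inf_lower[OF that] Sup_upper[OF that] by (simp add: a b)
  \<comment> \<open>Up to \<open>C0\<close> a loop has the rate of its own periodic point, whose
    dimension lies between \<open>a\<close> and \<open>b\<close>.\<close>
  have la: "a * (real k * Lam) - C0 \<le> lm (nR + k) E" and lb: "lm (nR + k) E \<le> b * (real k * Lam) + C0" if L: "loop k E" for k E
  proof -
    obtain s where s: "ereal s \<in> A" "\<bar>s * (real k * Lam) - lm (nR + k) E\<bar> \<le> C0" using loopA[OF L] by blast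
    have kl: "0 \<le> real k * Lam" using Lam_pos by (intro mult_nonneg_nonneg) auto
    have "a * (real k * Lam) \<le> s * (real k * Lam)" "s * (real k * Lam) \<le> b * (real k * Lam)"
      using ab[OF s(1)] mult_right_mono[OF _ kl] by blast+
    then show "a * (real k * Lam) - C0 \<le> lm (nR + k) E" "lm (nR + k) E \<le> b * (real k * Lam) + C0" using s(2) by linarith+
  qed
  show "Inf A \<le> lower_local_dim mu x \<and> upper_local_dim mu x \<le> Sup A" if "truly_essential x" for x
    using truly_essential_bounds[OF that la lb] by (simp add: a b)
  fix t assume t: "Inf A \<le> t" "t \<le> Sup A"
  then obtain t' where t': "t = ereal t'" by (cases t) (auto simp: a b)
  have tab: "a \<le> t'" "t' \<le> b" using t by (simp_all add: t' a b)
  have app: "\<exists>x s. truly_essential x \<and> has_local_dim mu x (ereal s) \<and> r = ereal s" if r: "r \<in> A" for r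
  proof -
    obtain s where "r = ereal s" using A_range[OF r] by (cases r) auto
    then show ?thesis using r by (auto simp: A_def truly_essential_def)
  qed
  show "\<exists>x. interior_essential x \<and> has_local_dim mu x t"
    unfolding t'
  proof (rule dim_exists)
    fix L :: nat and e :: real assume e: "0 < e"
    have "Inf A < ereal (t' + e / 2)" using tab e by (simp add: a)
    then obtain r where "r \<in> A" "r < ereal (t' + e / 2)" by (auto simp: Inf_less_iff)
    then obtain x s where s: "truly_essential x" "has_local_dim mu x (ereal s)" "s < t' + e / 2" using app by force
    obtain k E where k: "loop k E" "k \<ge> L" "lm (nR + k) E \<le> (s + e / 2) * (real k * Lam)"
      using approximating_loops(1)[OF s(1,2), of "e / 2" L] e by auto
    have "0 \<le> real k * Lam" using Lam_pos by (intro mult_nonneg_nonneg) auto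
    then have "(s + e / 2) * (real k * Lam) \<le> (t' + e) * (real k * Lam)" using s(3) by (intro mult_right_mono) auto
    then show "\<exists>k E. loop k E \<and> k \<ge> L \<and> lm (nR + k) E \<le> (t' + e) * (real k * Lam)" using k by (meson order_trans)
  next
    fix L :: nat and e :: real assume e: "0 < e"
    have "ereal (t' - e / 2) < Sup A" using tab e by (simp add: b)
    then obtain r where "r \<in> A" "ereal (t' - e / 2) < r" by (auto simp: less_Sup_iff)
    then obtain x s where s: "truly_essential x" "has_local_dim mu x (ereal s)" "t' - e / 2 < s" using app by force
    obtain k E where k: "loop k E" "k \<ge> L" "(s - e / 2) * (real k * Lam) \<le> lm (nR + k) E"
      using approximating_loops(2)[OF s(1,2), of "e / 2" L] e by auto
    have "0 \<le> real k * Lam" using Lam_pos by (intro mult_nonneg_nonneg) auto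
    then have "(t' - e) * (real k * Lam) \<le> (s - e / 2) * (real k * Lam)" using s(3) by (intro mult_right_mono) auto
    then show "\<exists>k E. loop k E \<and> k \<ge> L \<and> (t' - e) * (real k * Lam) \<le> lm (nR + k) E" using k by (meson order_trans)
  qed
qed

end

theorem corollary3p15:
  fixes m :: nat and rho :: real and d :: "nat \<Rightarrow> real" and K :: "real set"
    and p :: "nat \<Rightarrow> real" and mu :: "real measure" and I S :: ereal
  assumes "self_similar_measure m rho d K p mu"
    and "ifs.finite_type m rho d"
    and "self_similar_measure.positive_row_property m rho d K p"
    and "I = Inf {t. \<exists>x. ifs.interior_essential m rho d K x \<and>
           self_similar_measure.positive_periodic m rho d K p x \<and> has_local_dim mu x t}"
    and "S = Sup {t. \<exists>x. ifs.interior_essential m rho d K x \<and>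
           self_similar_measure.positive_periodic m rho d K p x \<and> has_local_dim mu x t}"
  shows "{t. \<exists>x. ifs.interior_essential m rho d K x \<and> has_local_dim mu x t} = {I..S}
    \<and> {t. \<exists>x. ifs.truly_essential m rho d K x \<and> has_local_dim mu x t} = {I..S}
    \<and> {lower_local_dim mu x | x. ifs.interior_essential m rho d K x} = {I..S}
    \<and> {lower_local_dim mu x | x. ifs.truly_essential m rho d K x} = {I..S}
    \<and> {upper_local_dim mu x | x. ifs.interior_essential m rho d K x} = {I..S}
    \<and> {upper_local_dim mu x | x. ifs.truly_essential m rho d K x} = {I..S}"
proof -
  interpret ssm: self_similar_measure m rho d K p mu by fact
  obtain n0 R0 where core: "ssm.core n0 R0" using ssm.core_exists[OF assms(2)] .
  then have R0: "R0 \<in> ssm.net_intervals n0" by (simp add: ssm.core_def)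
  \<comment> \<open>A net interval of the next level at an interior point of the core is a child of
    the core.\<close>
  obtain x where "x \<in> K" "fst R0 < x" "x < snd R0" using ssm.netD(5)[OF R0] by auto
  then obtain R where "R \<in> ssm.net_intervals (n0 + 1)" "ssm.sub R R0" using ssm.net_point_in[OF _ R0, of x 1] by blast
  then have R: "ssm.parent n0 R0 R" using R0 by (simp add: ssm.parent_iff)
  interpret ft_ssm m rho d K p mu n0 R0 "Suc n0" R
    by unfold_locales (use assms core R in auto)
  note lo_up = local_dims(1)[folded assms(4,5)] and ex = local_dims(2)[folded assms(4,5)]
  have rng: "lower_local_dim mu x \<in> {I..S}" "upper_local_dim mu x \<in> {I..S}" if "ssm.truly_essential x" for x
    using lo_up[OF that] lower_le_upper[of x] by (auto intro: order_trans)
  have dims: "\<exists>x. ssm.interior_essential x \<and> lower_local_dim mu x = t \<and> upper_local_dim mu x = t" if "t \<in> {I..S}" for t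
    using ex[of t] that by (simp add: has_local_dim_def)
  \<comment> \<open>One argument for every class of points between the interior essential and the
    truly essential ones.\<close>
  have gen: "{t. \<exists>x. P x \<and> has_local_dim mu x t} = {I..S} \<and> {lower_local_dim mu x | x. P x} = {I..S}
      \<and> {upper_local_dim mu x | x. P x} = {I..S}"
    if P: "\<And>x. ssm.interior_essential x \<Longrightarrow> P x" "\<And>x. P x \<Longrightarrow> ssm.truly_essential x" for P
  proof (intro conjI equalityI subsetI)
    fix t assume "t \<in> {I..S}"
    then obtain x where x: "P x" "lower_local_dim mu x = t" "upper_local_dim mu x = t" using dims P(1) by blast
    then show "t \<in> {t. \<exists>x. P x \<and> has_local_dim mu x t}" unfolding has_local_dim_def by blast
  next
    fix t assume "t \<in> {I..S}"
    then obtain x where "P x" "lower_local_dim mu x = t" using dims P(1) by blast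
    then have x: "P x" "t = lower_local_dim mu x" by simp_all
    then show "t \<in> {lower_local_dim mu x | x. P x}" by blast
  next
    fix t assume "t \<in> {I..S}"
    then obtain x where "P x" "upper_local_dim mu x = t" using dims P(1) by blast
    then have x: "P x" "t = upper_local_dim mu x" by simp_all
    then show "t \<in> {upper_local_dim mu x | x. P x}" by blast
  next
    fix t assume "t \<in> {t. \<exists>x. P x \<and> has_local_dim mu x t}"
    then show "t \<in> {I..S}" using rng(1) P(2) unfolding has_local_dim_def by blast
  next
    fix t assume "t \<in> {lower_local_dim mu x | x. P x}"
    then obtain x where "P x" "t = lower_local_dim mu x" by blast
    then show "t \<in> {I..S}" using rng(1)[OF P(2)] by simp
  next
    fix t assume "t \<in> {upper_local_dim mu x | x. P x}"
    then obtain x where "P x" "t = upper_local_dim mu x" by blast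
    then show "t \<in> {I..S}" using rng(2)[OF P(2)] by simp
  qed
  show ?thesis
    using gen[of ssm.interior_essential, OF _ interior_truly] gen[of ssm.truly_essential, OF interior_truly]
    by (simp only:)
qed

end
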